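(* Let $k\in\mathbb N\cup\{0\}$, $\alpha\in(\mathbb N\cup\{0\})^n$, $1<q\le p<\infty$, $1\le r\le\infty$, $1<s<\infty$ and $\gamma>0$, and assume that \[ \frac nq-\frac np<\gamma<n-\frac np . \] Then the following assertions hold: (1) If $q\le s$, then there exists $C>0$ such that for all $t>0$ and all $f\in\mathcal M^p_{q,r}(\mathbb R^n)$, \[ \|\partial_t^k\partial_x^\alpha e^{t\Delta}[|\cdot|^{-\gamma}f]\|_{L^{s,r}} \le C\, t^{-\frac n2\left(\frac1p-\frac1s\right)-k-\frac{|\alpha|}2-\frac\gamma2} \|f\|_{\mathcal M^p_{q,r}}. \] (2) If $q<s$, then there exists $C>0$ such that for all $t>0$ and all $f\in\mathcal M^p_q(\mathbb R^n)$, \[ \|\partial_t^k\partial_x^\alpha e^{t\Delta}[|\cdot|^{-\gamma}f]\|_{L^s} \le C\, t^{-\frac n2\left(\frac1p-\frac1s\right)-k-\frac{|\alpha|}2-\frac\gamma2} \|f\|_{\mathcal M^p_q}. \]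
   Context: Here $n\ge1$ is the dimension. The heat semigroup $\{e^{t\Delta}\}_{t>0}$ is defined by \[ e^{t\Delta}f(x)=\frac1{\sqrt{(4\pi t)^n}}\int_{\mathbb R^n}\exp\left(-\frac{|x-y|^2}{4t}\right)f(y)\,dy,\quad (t,x)\in(0,\infty)\times\mathbb R^n, \] $|\cdot|^{-\gamma}f$ denotes the function $x\mapsto|x|^{-\gamma}f(x)$, $\partial_x^\alpha$ is the usual multi-index partial derivative in $x$ with $|\alpha|=\alpha_1+\cdots+\alpha_n$, and the norms on the left-hand sides are taken in the variable $x$ at fixed $t$. $L^s(\mathbb R^n)$ is the usual Lebesgue space. For $1\le p<\infty$ and $1\le q\le\infty$, the Lorentz space $L^{p,q}(\mathbb R^n)$ is the space of all measurable functions $f$ with finite \[ \|f\|_{L^{p,q}}=\left(\int_0^\infty\left[\lambda\,\|\chi_{\{x\in\mathbb R^n:|f(x)|>\lambda\}}\|_{L^p}\right]^q\frac{d\lambda}\lambda\right)^{\frac1q}\ (q<\infty), \qquad \|f\|_{L^{p,\infty}}=\sup_{\lambda>0}\lambda\,\|\chi_{\{x\in\mathbb R^n:|f(x)|>\lambda\}}\|_{L^p}. \] For $1\le q\le p<\infty$ and $1\le r\le\infty$, the (global) Morrey-type space $\mathcal M^p_{q,r}(\mathbb R^n)$ is the space of all measurable functions $f$ with finite norm \[ \|f\|_{\mathcal M^p_{q,r}}=\sup_{x\in\mathbb R^n}\left(\int_0^\infty\left[\rho^{\frac np-\frac nq}\left(\int_{B(x,\rho)}|f(y)|^q\,dy\right)^{\frac1q}\right]^r\frac{d\rho}\rho\right)^{\frac1r}\quad(r<\infty),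 \] \[ \|f\|_{\mathcal M^p_{q,\infty}}=\sup_{x\in\mathbb R^n,\,\rho>0}\rho^{\frac np-\frac nq}\left(\int_{B(x,\rho)}|f(y)|^q\,dy\right)^{\frac1q}, \] where $B(x,\rho)$ is the ball with center $x$ and radius $\rho$. The Morrey space is $\mathcal M^p_q(\mathbb R^n)=\mathcal M^p_{q,\infty}(\mathbb R^n)$, with $\|f\|_{\mathcal M^p_q}=\|f\|_{\mathcal M^p_{q,\infty}}$. *)

theory Defs
  imports "HOL-Analysis.Analysis"
begin

section \<open>Function spaces\<close>

text \<open>
  Points of $n$-dimensional space have type \<^typ>\<open>real^'n\<close>, so that \<open>n = CARD('n)\<close>.
  ``Measurable'' means Lebesgue measurable. Norms take values in \<^typ>\<open>ennreal\<close>, and the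
  summability exponent \<open>r\<close> of the Lorentz and Morrey scales is an \<^typ>\<open>ennreal\<close>
  with \<open>r = top\<close> for the supremum norms.
\<close>

text \<open>Used for exponents \<open>a > 0\<close> only, where \<open>\<infinity>\<close> to the power \<open>a\<close> is \<open>\<infinity>\<close>.\<close>

definition epowr :: "ennreal \<Rightarrow> real \<Rightarrow> ennreal" (infixr "epowr" 80) where
  "x epowr a = (if x = top then top else ennreal (enn2real x powr a))"

definition Lebesgue_norm :: "real \<Rightarrow> (real^'n \<Rightarrow> 'b::real_normed_vector) \<Rightarrow> ennreal" where
  "Lebesgue_norm p f = (\<integral>\<^sup>+x. ennreal (norm (f x) powr p) \<partial>lebesgue) epowr (1 / p)"

definition Lebesgue_space :: "real \<Rightarrow> (real^'n \<Rightarrow> 'b::real_normed_vector) set" where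
  "Lebesgue_space p = {f \<in> borel_measurable lebesgue. Lebesgue_norm p f < top}"

definition Lorentz_norm ::
    "real \<Rightarrow> ennreal \<Rightarrow> (real^'n \<Rightarrow> 'b::real_normed_vector) \<Rightarrow> ennreal" where
  "Lorentz_norm p r f =
    (let \<phi> = (\<lambda>l. ennreal l * Lebesgue_norm p (indicat_real {x. norm (f x) > l})) in
      if r = top then (SUP l\<in>{0<..}. \<phi> l)
      else (\<integral>\<^sup>+l\<in>{0<..}. (\<phi> l epowr enn2real r) / ennreal l \<partial>lborel) epowr (1 / enn2real r))"

definition Lorentz_space ::
    "real \<Rightarrow> ennreal \<Rightarrow> (real^'n \<Rightarrow> 'b::real_normed_vector) set" where
  "Lorentz_space p r = {f \<in> borel_measurable lebesgue. Lorentz_norm p r f < top}"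

definition Morrey_norm ::
    "real \<Rightarrow> real \<Rightarrow> ennreal \<Rightarrow> (real^'n \<Rightarrow> 'b::real_normed_vector) \<Rightarrow> ennreal" where
  "Morrey_norm p q r f =
    (let \<phi> = (\<lambda>x \<rho>. ennreal (\<rho> powr (real CARD('n) / p - real CARD('n) / q))
                * (\<integral>\<^sup>+y\<in>ball x \<rho>. ennreal (norm (f y) powr q) \<partial>lebesgue) epowr (1 / q)) in
      if r = top then (SUP x. SUP \<rho>\<in>{0<..}. \<phi> x \<rho>)
      else (SUP x. (\<integral>\<^sup>+\<rho>\<in>{0<..}. (\<phi> x \<rho> epowr enn2real r) / ennreal \<rho> \<partial>lborel)
                     epowr (1 / enn2real r)))"

definition Morrey_space ::
    "real \<Rightarrow> real \<Rightarrow> ennreal \<Rightarrow> (real^'n \<Rightarrow> 'b::real_normed_vector) set" where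
  "Morrey_space p q r = {f \<in> borel_measurable lebesgue. Morrey_norm p q r f < top}"

section \<open>Iterated partial derivatives\<close>

definition partial_x :: "'n \<Rightarrow> (real^'n \<Rightarrow> 'b::real_normed_vector) \<Rightarrow> real^'n \<Rightarrow> 'b" where
  "partial_x i g x = vector_derivative (\<lambda>h. g (x + h *\<^sub>R axis i 1)) (at 0)"

definition partial_t ::
    "(real \<Rightarrow> real^'n \<Rightarrow> 'b::real_normed_vector) \<Rightarrow> real \<Rightarrow> real^'n \<Rightarrow> 'b" where
  "partial_t u t x = vector_derivative (\<lambda>\<tau>. u \<tau> x) (at t)"

text \<open>
  The list of directions of a multi-index, in increasing order of the coordinates; the
  derivative with respect to the last entry is taken first. The linear order on the index
  type only serves to fix this order.
\<close>

definition directions :: "('n::{finite,linorder} \<Rightarrow> nat) \<Rightarrow> 'n list" where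
  "directions \<alpha> = concat (map (\<lambda>i. replicate (\<alpha> i) i) (sorted_list_of_set UNIV))"

definition mixed_partial ::
    "nat \<Rightarrow> ('n::{finite,linorder} \<Rightarrow> nat) \<Rightarrow>
     (real \<Rightarrow> real^'n::{finite,linorder} \<Rightarrow> 'b::real_normed_vector) \<Rightarrow>
     real \<Rightarrow> real^'n::{finite,linorder} \<Rightarrow> 'b" where
  "mixed_partial k \<alpha> u = (partial_t ^^ k) (\<lambda>t. foldr partial_x (directions \<alpha>) (u t))"

text \<open>
  Since \<^const>\<open>vector_derivative\<close> is total, existence of the iterated derivatives on
  the half space \<open>t > 0\<close> is expressed separately: every function that gets differentiated
  on the way is differentiable in the direction concerned.
\<close>

fun x_partials_exist :: "'n list \<Rightarrow> (real^'n \<Rightarrow> 'b::real_normed_vector) \<Rightarrow> bool" where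
  "x_partials_exist [] g \<longleftrightarrow> True"
| "x_partials_exist (i # is) g \<longleftrightarrow> x_partials_exist is g \<and>
     (\<forall>x. (\<lambda>h. foldr partial_x is g (x + h *\<^sub>R axis i 1)) differentiable (at (0::real)))"

definition mixed_partial_exists ::
    "nat \<Rightarrow> ('n::{finite,linorder} \<Rightarrow> nat) \<Rightarrow>
     (real \<Rightarrow> real^'n::{finite,linorder} \<Rightarrow> 'b::real_normed_vector) \<Rightarrow> bool" where
  "mixed_partial_exists k \<alpha> u \<longleftrightarrow>
     (\<forall>t>0. x_partials_exist (directions \<alpha>) (u t)) \<and>
     (\<forall>j<k. \<forall>t>0. \<forall>x. (\<lambda>\<tau>. mixed_partial j \<alpha> u \<tau> x) differentiable (at t))"

section \<open>The heat semigroup\<close>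

definition heat ::
    "real \<Rightarrow> (real^'n \<Rightarrow> complex) \<Rightarrow> real^'n \<Rightarrow> complex" where
  "heat t f x = (1 / sqrt ((4 * pi * t) ^ CARD('n))) *\<^sub>R
     (\<integral>y. exp (- ((norm (x - y))\<^sup>2 / (4 * t))) *\<^sub>R f y \<partial>lebesgue)"

definition heat_defined :: "(real^'n \<Rightarrow> complex) \<Rightarrow> bool" where
  "heat_defined f \<longleftrightarrow>
     (\<forall>t>0. \<forall>x. integrable lebesgue (\<lambda>y. exp (- ((norm (x - y))\<^sup>2 / (4 * t))) *\<^sub>R f y))"

text \<open>The value of the weight at the origin is irrelevant, being on a null set.\<close>

definition weighted :: "real \<Rightarrow> (real^'n \<Rightarrow> complex) \<Rightarrow> real^'n \<Rightarrow> complex" where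
  "weighted \<gamma> f x = (norm x powr (- \<gamma>)) *\<^sub>R f x"

definition heat_deriv ::
    "nat \<Rightarrow> ('n::{finite,linorder} \<Rightarrow> nat) \<Rightarrow> (real^'n::{finite,linorder} \<Rightarrow> complex) \<Rightarrow>
     real \<Rightarrow> real^'n::{finite,linorder} \<Rightarrow> complex" where
  "heat_deriv k \<alpha> g = mixed_partial k \<alpha> (\<lambda>t. heat t g)"

text \<open>Under this condition \<open>heat_deriv k \<alpha> g\<close> contains no default values.\<close>

definition heat_deriv_exists ::
    "nat \<Rightarrow> ('n::{finite,linorder} \<Rightarrow> nat) \<Rightarrow> (real^'n::{finite,linorder} \<Rightarrow> complex) \<Rightarrow> bool" where
  "heat_deriv_exists k \<alpha> g \<longleftrightarrow>
     heat_defined g \<and> mixed_partial_exists k \<alpha> (\<lambda>t. heat t g)"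

end

theory Submission
  imports Defs
begin

text \<open>
  Write \<open>n = CARD('n)\<close>, \<open>g = |x|\<^sup>-\<^sup>\<gamma> f\<close> and \<open>\<sigma> = sqrt t\<close>. The theorem is a bound for a convolution of
  \<open>|g|\<close> with a Gaussian of width \<open>\<sigma>\<close>, and all that it takes from the Morrey space is the growth of
  \<open>|f|\<^sup>q\<close> over balls centred at the origin: the integral over the ball of radius \<open>\<rho>\<close> is at most
  \<open>(C M)\<^sup>q\<close> times the power \<open>n - n q / p\<close> of \<open>\<rho>\<close>, where \<open>M\<close> is the Morrey norm. This holds whatever the third index \<open>r\<close>
  is (lemma \<open>Morrey_norm_central\<close>), because the local integrals grow with the radius.

  Kernels. Every derivative of the heat kernel is a combination of products of powers of \<open>t\<close>,
  coordinates of \<open>z\<close> and the Gaussian, all of the same parabolic degree \<open>d = - n - |\<alpha>| - 2 k\<close>. It is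
  therefore at most \<open>C t\<^sup>d\<^sup>/\<^sup>2 exp (- |z|\<^sup>2 / 8t)\<close>, and dominated convergence allows one to differentiate
  under the integral. So the derivative of \<open>e\<^sup>t\<^sup>\<Delta> g\<close> is bounded by \<open>t\<^sup>d\<^sup>/\<^sup>2\<close> times the convolution \<open>v\<close>
  of \<open>|g|\<close> with \<open>exp (- |z|\<^sup>2 / 8t)\<close> (lemmas \<open>heat_deriv_eq_kernel_conv\<close> and \<open>kernel_conv_bound\<close>).

  The weight. On the ring \<open>R \<le> |y| \<le> 2R\<close> the weight is comparable to a constant, and Hoelder's inequality bounds
  the integral of \<open>|g|\<^sup>b\<close> there by a multiple of \<open>M\<^sup>b\<close> times the power \<open>b (n/b - n/p - \<gamma>)\<close> of \<open>R\<close>, for every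
  \<open>1 \<le> b \<le> q\<close>. For \<open>b = 1\<close> this exponent is positive, because \<open>\<gamma> < n - n/p\<close>; the rings inside the ball of
  radius \<open>\<sigma>\<close> then add up to a geometric series, so \<open>g\<close> is integrable there. For \<open>b = q\<close> the exponent is
  negative, because \<open>n/q - n/p < \<gamma>\<close>; by continuity it is still negative for some
  \<open>b = a < q\<close>, and \<open>|g|\<^sup>a\<close> is integrable outside that ball.

  Conclusion. Young's inequality, applied to the two parts of \<open>g\<close>, bounds \<open>v\<close> uniformly and
  in \<open>L\<^sup>a\<close>, with the powers of \<open>\<sigma>\<close> that scaling predicts (lemma \<open>gauss_convolution_bounds\<close>). Since \<open>a < q \<le> s\<close>,
  a function that is bounded and in \<open>L\<^sup>a\<close> belongs to \<open>L\<^sup>s\<close>, and to \<open>L\<^sup>s\<^sup>,\<^sup>r\<close> for every \<open>r\<close>: its distribution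
  function vanishes above the supremum, and the gap between \<open>a\<close> and \<open>s\<close> makes the integral over the levels
  converge at zero (lemmas \<open>Lebesgue_norm_bounded\<close> and \<open>Lorentz_norm_bounded\<close>). In particular the end point \<open>s = q\<close>
  with \<open>r < q\<close> is no harder than the rest.
\<close>

section \<open>A class of Gaussian kernels closed under differentiation\<close>

text \<open>
  The index counts length once and time twice: it is the degree of homogeneity under
  \<open>(t, z) \<mapsto> (c\<^sup>2 t, c z)\<close>, so that the kernel has size \<open>t\<^sup>d\<^sup>/\<^sup>2\<close> where \<open>|z|\<close> is about \<open>sqrt t\<close>. Generating the
  class by rules, instead of writing out Hermite polynomials, turns each statement about derivatives
  into a short induction.
\<close>
inductive heat_kernel :: "real \<Rightarrow> (real \<Rightarrow> real^'n \<Rightarrow> real) \<Rightarrow> bool" where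
  gauss: "heat_kernel 0 (\<lambda>t z. exp (- ((norm z)\<^sup>2 / (4 * t))))"
| coord: "heat_kernel d K \<Longrightarrow> heat_kernel (d + 1) (\<lambda>t z. z $ i * K t z)"
| tpowr: "heat_kernel d K \<Longrightarrow> heat_kernel (d + 2 * c) (\<lambda>t z. a * t powr c * K t z)"
| add: "heat_kernel d K \<Longrightarrow> heat_kernel d L \<Longrightarrow> heat_kernel d (\<lambda>t z. K t z + L t z)"

text \<open>
  The next two rules leave the degree free, to be matched by arithmetic.
\<close>
lemma heat_kernel_scale: "heat_kernel d K \<Longrightarrow> e = d + 2 * c \<Longrightarrow> heat_kernel e (\<lambda>t z. a * t powr c * K t z)"
  by (simp add: heat_kernel.tpowr)

lemma heat_kernel_coord: "heat_kernel d K \<Longrightarrow> e = d + 1 \<Longrightarrow> heat_kernel e (\<lambda>t z. z $ i * K t z)"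
  by (simp add: heat_kernel.coord)

lemma heat_kernel_sum:
  assumes "finite I" "\<And>i. i \<in> I \<Longrightarrow> heat_kernel d (K i)"
  shows "heat_kernel d (\<lambda>t z. \<Sum>i\<in>I. K i t z)"
  using assms
proof (induction I rule: finite_induct)
  case empty
  have "heat_kernel d (\<lambda>t z. 0 * t powr (d/2) * exp (- ((norm z)\<^sup>2 / (4 * t))))"
    by (rule heat_kernel_scale[OF heat_kernel.gauss]) simp
  then show ?case by simp
next
  case (insert i I)
  then show ?case by (simp add: heat_kernel.add)
qed

lemma heat_kernel_continuous:
  assumes "heat_kernel d K" "t > 0"
  shows "continuous_on UNIV (K t)"
  using assms by (induction) (auto intro!: continuous_intros)

lemma heat_kernel_measurable:
  assumes "heat_kernel d K" "t > 0"
  shows "(\<lambda>y. K t (x - y)) \<in> borel_measurable lebesgue"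
proof -
  have "continuous_on UNIV (\<lambda>y. K t (x - y))"
    by (rule continuous_on_compose2[OF heat_kernel_continuous[OF assms]]) (auto intro!: continuous_intros)
  then have "(\<lambda>y. K t (x - y)) \<in> borel_measurable borel" by (rule borel_measurable_continuous_onI)
  then show ?thesis by (simp add: measurable_completion)
qed

text \<open>
  The product rule keeps the class invariant; the only new terms come from the Gaussian, whose
  derivative is \<open>- z\<^sub>i / (2 t)\<close> times the Gaussian, of degree \<open>1 - 2 = - 1\<close>.
\<close>
lemma heat_kernel_space_derivative:
  fixes K :: "real \<Rightarrow> real^'n \<Rightarrow> real" and i :: 'n
  assumes "heat_kernel d K"
  shows "\<exists>K'. heat_kernel (d - 1) K' \<and> (\<forall>t>0. \<forall>z h.
    ((\<lambda>h. K t (z + h *\<^sub>R axis i 1)) has_real_derivative K' t (z + h *\<^sub>R axis i 1)) (at h))"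
  using assms
proof induction
  case gauss
  have "heat_kernel (0-1) (\<lambda>t z. (-(1/2)) * t powr (-1) * (z $ i * exp (- ((norm z)\<^sup>2 / (4 * t)))))"
    by (rule heat_kernel_scale[OF heat_kernel_coord[OF heat_kernel.gauss]]) auto
  moreover
  { fix t h :: real and z :: "real^'n" assume t: "t > 0"
    have n: "(norm (z + h *\<^sub>R axis i 1))\<^sup>2 = (norm z)\<^sup>2 + 2 * h * z $ i + h\<^sup>2" for h
      unfolding power2_norm_eq_inner
      by (simp add: inner_add_left inner_add_right inner_axis inner_axis' inner_axis_axis power2_eq_square distrib_left)
    have "((\<lambda>h. exp (- (((norm z)\<^sup>2 + 2 * h * z $ i + h\<^sup>2) / (4 * t)))) has_real_derivative 
      (-(1/2)) * t powr (-1) * ((z $ i + h) * exp (- (((norm z)\<^sup>2 + 2 * h * z $ i + h\<^sup>2) / (4 * t))))) (at h)"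
      using t by (auto intro!: derivative_eq_intros simp: field_simps powr_minus)
    then have "((\<lambda>h. exp (- ((norm (z + h *\<^sub>R axis i 1))\<^sup>2 / (4 * t)))) has_real_derivative 
      (-(1/2)) * t powr (-1) * ((z + h *\<^sub>R axis i 1) $ i * exp (- ((norm (z + h *\<^sub>R axis i 1))\<^sup>2 / (4 * t))))) (at h)"
      unfolding n by simp }
  ultimately show ?case by blast
next
  case (coord d K j)
  then obtain K' where K': "heat_kernel (d - 1) K'" "\<And>t z h. t > 0 \<Longrightarrow>
    ((\<lambda>h. K t (z + h *\<^sub>R axis i 1)) has_real_derivative K' t (z + h *\<^sub>R axis i 1)) (at h)" by blast
  define \<delta> :: real where "\<delta> = (if i = j then 1 else 0)"
  have "heat_kernel (d + 1 - 1) (\<lambda>t z. \<delta> * t powr 0 * K t z + z $ j * K' t z)"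
    by (intro heat_kernel.add heat_kernel_scale[OF coord.hyps] heat_kernel_coord[OF K'(1)]) auto
  moreover
  { fix t h :: real and z :: "real^'n" assume t: "t > 0"
    have j: "(z + h *\<^sub>R axis i 1) $ j = z $ j + h * \<delta>" for h
      by (simp add: axis_def \<delta>_def)
    have "((\<lambda>h. (z + h *\<^sub>R axis i 1) $ j * K t (z + h *\<^sub>R axis i 1)) has_real_derivative 
      \<delta> * t powr 0 * K t (z + h *\<^sub>R axis i 1) + (z + h *\<^sub>R axis i 1) $ j * K' t (z + h *\<^sub>R axis i 1)) (at h)"
      unfolding j using t by (auto intro!: derivative_eq_intros K'(2))
  }
  ultimately show ?case by blast
next
  case (tpowr d K c a)
  then obtain K' where K': "heat_kernel (d - 1) K'" "\<And>t z h. t > 0 \<Longrightarrow>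
    ((\<lambda>h. K t (z + h *\<^sub>R axis i 1)) has_real_derivative K' t (z + h *\<^sub>R axis i 1)) (at h)" by blast
  have "heat_kernel (d + 2 * c - 1) (\<lambda>t z. a * t powr c * K' t z)"
    by (intro heat_kernel_scale[OF K'(1)]) auto
  moreover have "((\<lambda>h. a * t powr c * K t (z + h *\<^sub>R axis i 1)) has_real_derivative
     a * t powr c * K' t (z + h *\<^sub>R axis i 1)) (at h)" if "t > 0" for t z h
    using that by (intro DERIV_cmult K'(2))
  ultimately show ?case by blast
next
  case (add d K L)
  then obtain K' L' where K': "heat_kernel (d - 1) K'" "\<And>t z h. t > 0 \<Longrightarrow>
    ((\<lambda>h. K t (z + h *\<^sub>R axis i 1)) has_real_derivative K' t (z + h *\<^sub>R axis i 1)) (at h)" 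
   and L': "heat_kernel (d - 1) L'" "\<And>t z h. t > 0 \<Longrightarrow>
    ((\<lambda>h. L t (z + h *\<^sub>R axis i 1)) has_real_derivative L' t (z + h *\<^sub>R axis i 1)) (at h)" by blast
  show ?case using heat_kernel.add[OF K'(1) L'(1)] DERIV_add[OF K'(2) L'(2)] by blast
qed

text \<open>
  Here the Gaussian contributes \<open>|z|\<^sup>2 / (4 t\<^sup>2)\<close> times itself, and \<open>|z|\<^sup>2\<close> is written as a sum of
  products of coordinates to stay within the generating rules.
\<close>
lemma heat_kernel_time_derivative:
  fixes K :: "real \<Rightarrow> real^'n \<Rightarrow> real"
  assumes "heat_kernel d K"
  shows "\<exists>K'. heat_kernel (d - 2) K' \<and> (\<forall>t>0. \<forall>z.
    ((\<lambda>t. K t z) has_real_derivative K' t z) (at t))"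
  using assms
proof induction
  case gauss
  have "heat_kernel (0-2) (\<lambda>t z. (1/4) * t powr (-2) *
     (\<Sum>i\<in>UNIV. z $ i * (z $ i * exp (- ((norm (z::real^'n))\<^sup>2 / (4 * t))))))"
    by (rule heat_kernel_scale[OF heat_kernel_sum[OF _ heat_kernel_coord[OF heat_kernel_coord[OF heat_kernel.gauss]]]]) auto
  moreover
  { fix t :: real and z :: "real^'n" assume t: "t > 0"
    have n: "(\<Sum>i\<in>UNIV. z $ i * (z $ i * c)) = (norm z)\<^sup>2 * c" for c
      by (simp add: power2_norm_eq_inner inner_vec_def sum_distrib_right mult.assoc)
    have p: "t powr (-2) = 1 / t\<^sup>2" using t powr_realpow[of t 2] by (simp add: powr_minus field_simps)
    have "((\<lambda>t. exp (- ((norm z)\<^sup>2 / (4 * t)))) has_real_derivative 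
      (1/4) * t powr (-2) * ((norm z)\<^sup>2 * exp (- ((norm z)\<^sup>2 / (4 * t))))) (at t)"
      using t unfolding p by (auto intro!: derivative_eq_intros simp: field_simps power2_eq_square)
    then have "((\<lambda>t. exp (- ((norm z)\<^sup>2 / (4 * t)))) has_real_derivative 
      (1/4) * t powr (-2) *
     (\<Sum>i\<in>UNIV. z $ i * (z $ i * exp (- ((norm z)\<^sup>2 / (4 * t)))))) (at t)"
      unfolding n . }
  ultimately show ?case by blast
next
  case (coord d K j)
  then obtain K' where K': "heat_kernel (d - 2) K'" "\<And>t z. t > 0 \<Longrightarrow>
    ((\<lambda>t. K t z) has_real_derivative K' t z) (at t)" by blast
  have "heat_kernel (d + 1 - 2) (\<lambda>t z. z $ j * K' t z)"
    by (intro heat_kernel_coord[OF K'(1)]) auto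
  moreover have "((\<lambda>t. z $ j * K t z) has_real_derivative z $ j * K' t z) (at t)" if "t > 0" for t z
    using that by (intro DERIV_cmult K'(2))
  ultimately show ?case by blast
next
  case (tpowr d K c a)
  then obtain K' where K': "heat_kernel (d - 2) K'" "\<And>t z. t > 0 \<Longrightarrow>
    ((\<lambda>t. K t z) has_real_derivative K' t z) (at t)" by blast
  have "heat_kernel (d + 2 * c - 2) (\<lambda>t z. (a * c) * t powr (c - 1) * K t z + a * t powr c * K' t z)"
    by (intro heat_kernel.add heat_kernel_scale[OF K'(1)] heat_kernel_scale[OF tpowr.hyps]) auto
  moreover have "((\<lambda>t. a * t powr c * K t z) has_real_derivative
     (a * c) * t powr (c - 1) * K t z + a * t powr c * K' t z) (at t)" if t: "t > 0" for t z
    using t by (auto intro!: derivative_eq_intros K'(2) has_real_derivative_powr simp: field_simps)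
  ultimately show ?case by blast
next
  case (add d K L)
  then obtain K' L' where K': "heat_kernel (d - 2) K'" "\<And>t z. t > 0 \<Longrightarrow>
    ((\<lambda>t. K t z) has_real_derivative K' t z) (at t)" 
   and L': "heat_kernel (d - 2) L'" "\<And>t z. t > 0 \<Longrightarrow>
    ((\<lambda>t. L t z) has_real_derivative L' t z) (at t)" by blast
  show ?case using heat_kernel.add[OF K'(1) L'(1)] DERIV_add[OF K'(2) L'(2)] by blast
qed

text \<open>
  A coordinate factor is absorbed by giving up an arbitrarily small part of the Gaussian decay. The
  induction goes through because the bound is asserted for all rates \<open>b\<close> below \<open>1/4\<close> at once.
\<close>
lemma heat_kernel_bound:
  fixes K :: "real \<Rightarrow> real^'n \<Rightarrow> real"
  assumes "heat_kernel d K" "b < 1/4"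
  shows "\<exists>C>0. \<forall>t>0. \<forall>z. \<bar>K t z\<bar> \<le> C * t powr (d/2) * exp (- (b * (norm z)\<^sup>2 / t))"
  using assms
proof (induction arbitrary: b)
  case gauss
  have "\<bar>exp (- ((norm z)\<^sup>2 / (4 * t)))\<bar> \<le> 1 * t powr (0/2) * exp (- (b * (norm z)\<^sup>2 / t))"
    if t: "t > 0" for t :: real and z :: "real^'n"
  proof -
    have "b * (norm z)\<^sup>2 / t \<le> (1/4) * (norm z)\<^sup>2 / t"
      using t gauss by (intro divide_right_mono mult_right_mono) auto
    then show ?thesis using t by simp
  qed
  then show ?case by (intro exI[of _ 1]) auto
next
  case (coord d K i)
  obtain b' where b': "b < b'" "b' < 1/4" using coord.prems dense by blast
  obtain C where C: "C > 0" "\<And>t z. t > 0 \<Longrightarrow> \<bar>K t z\<bar> \<le> C * t powr (d/2) * exp (- (b' * (norm z)\<^sup>2 / t))"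
    using coord.IH[OF b'(2)] by blast
  define \<delta> where "\<delta> = b' - b"
  have \<delta>: "\<delta> > 0" using b' by (simp add: \<delta>_def)
  define D where "D = 1 + 1/\<delta>"
  have D: "D > 0" using \<delta> by (simp add: D_def add_pos_pos)
  have x: "x \<le> D * exp (\<delta> * x\<^sup>2)" for x :: real
  proof -
    have "x \<le> 1 + x\<^sup>2" using zero_le_power2[of "x - 1/2"] by (simp add: power2_eq_square algebra_simps)
    also have "\<dots> \<le> D * (1 + \<delta> * x\<^sup>2)" using \<delta> by (simp add: D_def field_simps)
    also have "\<dots> \<le> D * exp (\<delta> * x\<^sup>2)" using D by (intro mult_left_mono exp_ge_add_one_self) auto
    finally show ?thesis .
  qed
  show ?case
  proof (intro exI[of _ "D * C"] conjI allI impI)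
    show "D * C > 0" using D C by simp
    fix t :: real and z :: "real^'n" assume t: "t > 0"
    have "\<bar>z $ i\<bar> \<le> sqrt t * (norm z / sqrt t)" using component_le_norm_cart[of z i] t by simp
    also have "\<dots> \<le> sqrt t * (D * exp (\<delta> * (norm z / sqrt t)\<^sup>2))"
      using x t by (intro mult_left_mono) auto
    also have "(norm z / sqrt t)\<^sup>2 = (norm z)\<^sup>2 / t" using t by (simp add: power_divide)
    finally have z: "\<bar>z $ i\<bar> \<le> sqrt t * (D * exp (\<delta> * ((norm z)\<^sup>2 / t)))" .
    have "\<bar>z $ i * K t z\<bar> \<le> (sqrt t * (D * exp (\<delta> * ((norm z)\<^sup>2 / t)))) *
        (C * t powr (d/2) * exp (- (b' * (norm z)\<^sup>2 / t)))"
      unfolding abs_mult using z C(2)[OF t, of z] D t by (intro mult_mono) auto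
    also have "\<dots> = D * C * (t powr (d/2) * t powr (1/2)) *
        (exp (\<delta> * ((norm z)\<^sup>2 / t)) * exp (- (b' * (norm z)\<^sup>2 / t)))"
      using t by (simp add: powr_half_sqrt)
    also have "exp (\<delta> * ((norm z)\<^sup>2 / t)) * exp (- (b' * (norm z)\<^sup>2 / t)) = exp (- (b * (norm z)\<^sup>2 / t))"
      unfolding exp_add[symmetric] \<delta>_def using t by (intro arg_cong[of _ _ exp]) (simp add: field_simps)
    also have "t powr (d/2) * t powr (1/2) = t powr ((d+1)/2)"
      by (simp add: powr_add[symmetric] add_divide_distrib)
    finally show "\<bar>z $ i * K t z\<bar> \<le> D * C * t powr ((d + 1) / 2) * exp (- (b * (norm z)\<^sup>2 / t))" .
  qed
next
  case (tpowr d K c a)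
  obtain C where C: "C > 0" "\<And>t z. t > 0 \<Longrightarrow> \<bar>K t z\<bar> \<le> C * t powr (d/2) * exp (- (b * (norm z)\<^sup>2 / t))"
    using tpowr.IH[OF tpowr.prems] by blast
  show ?case
  proof (intro exI[of _ "(\<bar>a\<bar> + 1) * C"] conjI allI impI)
    show "(\<bar>a\<bar> + 1) * C > 0" using C by simp
    fix t :: real and z :: "real^'n" assume t: "t > 0"
    have "\<bar>a * t powr c * K t z\<bar> \<le> ((\<bar>a\<bar> + 1) * t powr c) * (C * t powr (d/2) * exp (- (b * (norm z)\<^sup>2 / t)))"
      unfolding abs_mult using C(2)[OF t, of z] by (intro mult_mono) auto
    also have "\<dots> = (\<bar>a\<bar> + 1) * C * (t powr (d/2) * t powr c) * exp (- (b * (norm z)\<^sup>2 / t))" by simp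
    also have "t powr (d/2) * t powr c = t powr ((d + 2 * c) / 2)"
      by (simp add: powr_add[symmetric] add_divide_distrib)
    finally show "\<bar>a * t powr c * K t z\<bar> \<le> (\<bar>a\<bar> + 1) * C * t powr ((d + 2 * c) / 2) * exp (- (b * (norm z)\<^sup>2 / t))" .
  qed
next
  case (add d K L)
  obtain C where C: "C > 0" "\<And>t z. t > 0 \<Longrightarrow> \<bar>K t z\<bar> \<le> C * t powr (d/2) * exp (- (b * (norm z)\<^sup>2 / t))"
    using add.IH(1)[OF add.prems] by blast
  obtain D where D: "D > 0" "\<And>t z. t > 0 \<Longrightarrow> \<bar>L t z\<bar> \<le> D * t powr (d/2) * exp (- (b * (norm z)\<^sup>2 / t))"
    using add.IH(2)[OF add.prems] by blast
  show ?case
    using C(1) D(1) add_mono[OF C(2) D(2)]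
    by (intro exI[of _ "C + D"]) (force simp: algebra_simps intro: order_trans[OF abs_triangle_ineq])
qed

text \<open>
  One Gaussian in \<open>z\<close> dominates the kernel for all times near \<open>t\<close> and all nearby translates; it
  is the majorant in every application of dominated convergence below.
\<close>
lemma heat_kernel_local_bound:
  assumes "heat_kernel d K" "t > 0"
  shows "\<exists>C c. c > 0 \<and> (\<forall>\<tau> z w. t/2 \<le> \<tau> \<and> \<tau> \<le> 2 * t \<and> norm w \<le> 1 \<longrightarrow>
     \<bar>K \<tau> (z + w)\<bar> \<le> C * exp (- (c * (norm z)\<^sup>2)))"
proof -
  obtain C where C: "C > 0" "\<And>t z. t > 0 \<Longrightarrow> \<bar>K t z\<bar> \<le> C * t powr (d/2) * exp (- ((1/8) * (norm z)\<^sup>2 / t))"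
    using heat_kernel_bound[OF assms(1), of "1/8"] by auto
  define T where "T = (t/2) powr (d/2) + (2*t) powr (d/2)"
  have "\<bar>K \<tau> (z + w)\<bar> \<le> (C * T * exp (1/(16*t))) * exp (- ((1/(32*t)) * (norm z)\<^sup>2))"
    if \<tau>: "t/2 \<le> \<tau>" "\<tau> \<le> 2 * t" and w: "norm w \<le> 1" for \<tau> z w
  proof -
    have t0: "\<tau> > 0" using \<tau> \<open>t > 0\<close> by linarith
    have T: "\<tau> powr (d/2) \<le> T"
    proof (cases "d \<ge> 0")
      case True
      then have "\<tau> powr (d/2) \<le> (2*t) powr (d/2)" using \<tau> t0 by (intro powr_mono2) auto
      then show ?thesis unfolding T_def using powr_ge_zero[of "t/2" "d/2"] by linarith
    next
      case False
      then have "\<tau> powr (d/2) \<le> (t/2) powr (d/2)" using \<tau> t0 \<open>t > 0\<close> by (intro powr_mono2') auto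
      then show ?thesis unfolding T_def using powr_ge_zero[of "2*t" "d/2"] by linarith
    qed
    have "norm z \<le> norm (z + w) + norm w" by norm
    then have "(norm z)\<^sup>2 \<le> (norm (z + w) + norm w)\<^sup>2" by (intro power_mono) auto
    also have "\<dots> \<le> 2 * (norm (z + w))\<^sup>2 + 2 * (norm w)\<^sup>2"
      using zero_le_power2[of "norm (z + w) - norm w"] by (simp add: power2_eq_square algebra_simps)
    also have "(norm w)\<^sup>2 \<le> 1" using w by (simp add: power_le_one)
    finally have z: "(norm z)\<^sup>2 - 2 \<le> 2 * (norm (z + w))\<^sup>2" by simp
    have "(1/(32*t)) * ((norm z)\<^sup>2 - 2) \<le> (1/(32*t)) * (2 * (norm (z + w))\<^sup>2)"
      using z \<open>t > 0\<close> by (intro mult_left_mono) auto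
    also have "\<dots> = (1/8) * (norm (z + w))\<^sup>2 / (2 * t)" using \<open>t > 0\<close> by (simp add: field_simps)
    also have "\<dots> \<le> (1/8) * (norm (z + w))\<^sup>2 / \<tau>" using \<tau> t0 by (intro divide_left_mono) auto
    finally have e: "- ((1/8) * (norm (z + w))\<^sup>2 / \<tau>) \<le> 1/(16*t) + - ((1/(32*t)) * (norm z)\<^sup>2)"
      using \<open>t > 0\<close> by (simp add: field_simps)
    have "\<bar>K \<tau> (z + w)\<bar> \<le> C * \<tau> powr (d/2) * exp (- ((1/8) * (norm (z + w))\<^sup>2 / \<tau>))"
      by (rule C(2)[OF t0])
    also have "\<dots> \<le> (C * T) * exp (1/(16*t) + - ((1/(32*t)) * (norm z)\<^sup>2))"
      using T C(1) e by (intro mult_mono) (auto simp: T_def)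
    finally show ?thesis unfolding exp_add mult.assoc .
  qed
  then show ?thesis using \<open>t > 0\<close> by (intro exI[of _ "C * T * exp (1/(16*t))"] exI[of _ "1/(32*t)"]) auto
qed

section \<open>Differentiation of convolutions under the integral sign\<close>

text \<open>
  By the mean value theorem the bound on the derivative of the integrand also bounds its difference
  quotients, and dominated convergence applies along every sequence of increments.
\<close>
lemma has_vector_derivative_lebesgue_integral:
  fixes k k' :: "real \<Rightarrow> 'a \<Rightarrow> real" and g :: "'a \<Rightarrow> 'b::{banach, second_countable_topology}"
  assumes \<epsilon>: "\<epsilon> > 0"
    and deriv: "\<And>h y. \<bar>h - t\<bar> < \<epsilon> \<Longrightarrow> ((\<lambda>h. k h y) has_real_derivative k' h y) (at h)"
    and bound: "\<And>h y. \<bar>h - t\<bar> < \<epsilon> \<Longrightarrow> \<bar>k' h y\<bar> \<le> w y"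
    and int: "\<And>h. \<bar>h - t\<bar> < \<epsilon> \<Longrightarrow> integrable M (\<lambda>y. k h y *\<^sub>R g y)"
    and meas: "(\<lambda>y. k' t y *\<^sub>R g y) \<in> borel_measurable M"
    and w: "integrable M (\<lambda>y. w y *\<^sub>R g y)"
  shows "((\<lambda>h. \<integral>y. k h y *\<^sub>R g y \<partial>M) has_vector_derivative (\<integral>y. k' t y *\<^sub>R g y \<partial>M)) (at t)"
proof -
  let ?F = "\<lambda>h. \<integral>y. k h y *\<^sub>R g y \<partial>M" and ?D = "\<integral>y. k' t y *\<^sub>R g y \<partial>M"
  have lip: "\<bar>k (t + h) y - k t y\<bar> \<le> \<bar>h\<bar> * w y" if h: "\<bar>h\<bar> < \<epsilon>" for h y
  proof -
    have "norm (k (t + h) y - k t y) \<le> w y * norm (t + h - t)"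
    proof (rule field_differentiable_bound[of "{t - \<bar>h\<bar>..t + \<bar>h\<bar>}" _ "\<lambda>h. k' h y"])
      show "((\<lambda>h. k h y) has_real_derivative k' z y) (at z within {t - \<bar>h\<bar>..t + \<bar>h\<bar>})"
        if "z \<in> {t - \<bar>h\<bar>..t + \<bar>h\<bar>}" for z
        using that h by (intro has_field_derivative_at_within[OF deriv]) auto
      show "norm (k' z y) \<le> w y" if "z \<in> {t - \<bar>h\<bar>..t + \<bar>h\<bar>}" for z
        using that h bound[of z y] by auto
    qed auto
    then show ?thesis by (simp add: mult.commute)
  qed
  have q: "(\<lambda>h. (1 / h) *\<^sub>R (?F (t + h) - ?F t)) \<midarrow>0\<rightarrow> ?D"
    unfolding tendsto_at_iff_sequentially comp_def
  proof (intro allI impI)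
    fix X :: "nat \<Rightarrow> real" assume X0: "\<forall>i. X i \<in> UNIV - {0}" and X: "X \<longlonglongrightarrow> 0"
    from X \<epsilon> have "\<forall>\<^sub>F n in sequentially. dist (X n) 0 < \<epsilon>" by (rule tendstoD)
    then obtain N where N: "\<And>n. n \<ge> N \<Longrightarrow> \<bar>X n\<bar> < \<epsilon>"
      unfolding eventually_sequentially by auto
    have lim: "(\<lambda>n. X (n + N)) \<longlonglongrightarrow> 0" by (rule LIMSEQ_ignore_initial_segment[OF X])
    show "(\<lambda>n. (1 / X n) *\<^sub>R (?F (t + X n) - ?F t)) \<longlonglongrightarrow> ?D"
    proof (rule LIMSEQ_offset[of _ N])
      have eq: "(1 / X (n + N)) *\<^sub>R (?F (t + X (n + N)) - ?F t) =
         (\<integral>y. ((k (t + X (n + N)) y - k t y) / X (n + N)) *\<^sub>R g y \<partial>M)" for n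
      proof -
        have "?F (t + X (n + N)) - ?F t = (\<integral>y. k (t + X (n + N)) y *\<^sub>R g y - k t y *\<^sub>R g y \<partial>M)"
          using N[of "n + N"] \<epsilon> by (intro Bochner_Integration.integral_diff[symmetric] int) auto
        then show ?thesis
          by (simp add: integral_scaleR_right[symmetric] scaleR_diff_left diff_divide_distrib scaleR_diff_right
              del: integral_scaleR_right)
      qed
      have m1: "(\<lambda>y. k h y *\<^sub>R g y) \<in> borel_measurable M" if "\<bar>h - t\<bar> < \<epsilon>" for h
        using int[OF that] by simp
      show "(\<lambda>n. (1 / X (n + N)) *\<^sub>R (?F (t + X (n + N)) - ?F t)) \<longlonglongrightarrow> ?D"
        unfolding eq
      proof (rule integral_dominated_convergence[where w = "\<lambda>y. norm (w y *\<^sub>R g y)"])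
        show "(\<lambda>y. ((k (t + X (n + N)) y - k t y) / X (n + N)) *\<^sub>R g y) \<in> borel_measurable M" for n
        proof -
          have "(\<lambda>y. (1 / X (n + N)) *\<^sub>R (k (t + X (n + N)) y *\<^sub>R g y - k t y *\<^sub>R g y)) \<in> borel_measurable M"
            using N[of "n + N"] \<epsilon> by (intro borel_measurable_scaleR borel_measurable_diff m1) auto
          then show ?thesis by (simp add: scaleR_diff_left diff_divide_distrib scaleR_diff_right)
        qed
        show "AE y in M. (\<lambda>n. ((k (t + X (n + N)) y - k t y) / X (n + N)) *\<^sub>R g y) \<longlonglongrightarrow> k' t y *\<^sub>R g y"
        proof (intro AE_I2 tendsto_scaleR tendsto_const)
          fix y
          have "(\<lambda>h. (k (t + h) y - k t y) / h) \<midarrow>0\<rightarrow> k' t y"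
            using deriv[of t y] \<epsilon> unfolding DERIV_def by simp
          then show "(\<lambda>n. (k (t + X (n + N)) y - k t y) / X (n + N)) \<longlonglongrightarrow> k' t y"
            unfolding tendsto_at_iff_sequentially comp_def using lim X0 by auto
        qed
        show "AE y in M. norm (((k (t + X (n + N)) y - k t y) / X (n + N)) *\<^sub>R g y) \<le> norm (w y *\<^sub>R g y)" for n
        proof (intro AE_I2)
          fix y
          have "\<bar>(k (t + X (n + N)) y - k t y) / X (n + N)\<bar> \<le> w y"
            using lip[OF N, of "n + N" y] X0 by (simp add: divide_simps mult.commute)
          then have "\<bar>(k (t + X (n + N)) y - k t y) / X (n + N)\<bar> \<le> \<bar>w y\<bar>" by linarith
          then show "norm (((k (t + X (n + N)) y - k t y) / X (n + N)) *\<^sub>R g y) \<le> norm (w y *\<^sub>R g y)"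
            unfolding norm_scaleR by (intro mult_right_mono) auto
        qed
      qed (use meas w in \<open>auto simp: integrable_norm simp del: norm_scaleR\<close>)
    qed
  qed
  have "((\<lambda>h. norm ((1 / h) *\<^sub>R (?F (t + h) - ?F t) - ?D)) \<longlongrightarrow> 0) (at 0)"
    using q by (simp add: tendsto_norm_zero_iff LIM_zero_iff)
  then have "((\<lambda>h. norm (?F (t + h) - ?F t - h *\<^sub>R ?D) / norm h) \<longlongrightarrow> 0) (at 0)"
  proof (rule Lim_transform_eventually)
    show "\<forall>\<^sub>F h in at 0. norm ((1 / h) *\<^sub>R (?F (t + h) - ?F t) - ?D) = norm (?F (t + h) - ?F t - h *\<^sub>R ?D) / norm h"
      unfolding eventually_at_filter
    proof (intro always_eventually allI impI)
      fix h :: real assume h: "h \<noteq> 0"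
      have "(1 / h) *\<^sub>R (?F (t + h) - ?F t) - ?D = (1 / h) *\<^sub>R (?F (t + h) - ?F t - h *\<^sub>R ?D)"
        using h by (simp add: scaleR_diff_right)
      then show "norm ((1 / h) *\<^sub>R (?F (t + h) - ?F t) - ?D) = norm (?F (t + h) - ?F t - h *\<^sub>R ?D) / norm h"
        by (simp only: norm_scaleR) simp
    qed
  qed
  then show ?thesis unfolding has_vector_derivative_def has_derivative_at
    by (auto intro: bounded_linear_scaleR_left)
qed

definition kernel_conv :: "(real^'n \<Rightarrow> real) \<Rightarrow> (real^'n \<Rightarrow> complex) \<Rightarrow> real^'n \<Rightarrow> complex" where
  "kernel_conv K g x = (\<integral>y. K (x - y) *\<^sub>R g y \<partial>lebesgue)"

text \<open>
  Gaussians of every width are required: a majorant that is uniform for nearby times and points has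
  a larger width than the kernel itself.
\<close>
definition gauss_integrable :: "(real^'n \<Rightarrow> complex) \<Rightarrow> bool" where
  "gauss_integrable g \<longleftrightarrow> g \<in> borel_measurable lebesgue \<and>
     (\<forall>c>0. \<forall>x. integrable lebesgue (\<lambda>y. exp (- (c * (norm (x - y))\<^sup>2)) *\<^sub>R g y))"

lemma heat_kernel_integrable:
  fixes g :: "real^'n \<Rightarrow> complex"
  assumes K: "heat_kernel d K" and g: "gauss_integrable g" and t: "t > 0"
  shows "integrable lebesgue (\<lambda>y. K t (x - y) *\<^sub>R g y)"
proof -
  obtain C c where c: "c > 0" and C: "\<And>\<tau> z w. t/2 \<le> \<tau> \<Longrightarrow> \<tau> \<le> 2 * t \<Longrightarrow> norm w \<le> 1 \<Longrightarrow>
     \<bar>K \<tau> (z + w)\<bar> \<le> C * exp (- (c * (norm z)\<^sup>2))"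
    using heat_kernel_local_bound[OF K t] by blast
  have "integrable lebesgue (\<lambda>y. C *\<^sub>R (exp (- (c * (norm (x - y))\<^sup>2)) *\<^sub>R g y))"
    using g c by (intro integrable_scaleR_right) (auto simp: gauss_integrable_def)
  then show ?thesis
  proof (rule Bochner_Integration.integrable_bound)
    show "(\<lambda>y. K t (x - y) *\<^sub>R g y) \<in> borel_measurable lebesgue"
      using heat_kernel_measurable[OF K t] g by (auto simp: gauss_integrable_def)
    show "AE y in lebesgue. norm (K t (x - y) *\<^sub>R g y) \<le> norm (C *\<^sub>R (exp (- (c * (norm (x - y))\<^sup>2)) *\<^sub>R g y))"
    proof (intro AE_I2)
      fix y
      have "\<bar>K t (x - y)\<bar> \<le> C * exp (- (c * (norm (x - y))\<^sup>2))" using C[of t 0 "x - y"] t by simp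
      then have "\<bar>K t (x - y)\<bar> \<le> \<bar>C * exp (- (c * (norm (x - y))\<^sup>2))\<bar>" by linarith
      then show "norm (K t (x - y) *\<^sub>R g y) \<le> norm (C *\<^sub>R (exp (- (c * (norm (x - y))\<^sup>2)) *\<^sub>R g y))"
        unfolding scaleR_scaleR norm_scaleR by (intro mult_right_mono) auto
    qed
  qed
qed

lemma kernel_conv_space_derivative:
  fixes g :: "real^'n \<Rightarrow> complex"
  assumes K: "heat_kernel d K" "heat_kernel d' K'" and g: "gauss_integrable g" and t: "t > 0"
    and deriv: "\<And>z h. ((\<lambda>h. K t (z + h *\<^sub>R axis i 1)) has_real_derivative K' t (z + h *\<^sub>R axis i 1)) (at h)"
  shows "((\<lambda>h. kernel_conv (K t) g (x + h *\<^sub>R axis i 1)) has_vector_derivative kernel_conv (K' t) g x) (at 0)"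
proof -
  obtain C c where c: "c > 0" and C: "\<And>\<tau> z w. t/2 \<le> \<tau> \<Longrightarrow> \<tau> \<le> 2 * t \<Longrightarrow> norm w \<le> 1 \<Longrightarrow>
     \<bar>K' \<tau> (z + w)\<bar> \<le> C * exp (- (c * (norm z)\<^sup>2))"
    using heat_kernel_local_bound[OF K(2) t] by blast
  have shift: "x + h *\<^sub>R axis i 1 - y = (x - y) + h *\<^sub>R axis i 1" for h y by simp
  have "((\<lambda>h. \<integral>y. K t (x + h *\<^sub>R axis i 1 - y) *\<^sub>R g y \<partial>lebesgue) has_vector_derivative
     (\<integral>y. K' t (x + 0 *\<^sub>R axis i 1 - y) *\<^sub>R g y \<partial>lebesgue)) (at 0)"
  proof (rule has_vector_derivative_lebesgue_integral[where \<epsilon> = 1 and w = "\<lambda>y. C * exp (- (c * (norm (x - y))\<^sup>2))"])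
    show "((\<lambda>h. K t (x + h *\<^sub>R axis i 1 - y)) has_real_derivative K' t (x + h *\<^sub>R axis i 1 - y)) (at h)" for h y
      unfolding shift by (rule deriv)
    show "\<bar>K' t (x + h *\<^sub>R axis i 1 - y)\<bar> \<le> C * exp (- (c * (norm (x - y))\<^sup>2))" if "\<bar>h - 0\<bar> < 1" for h y
      unfolding shift using that t by (intro C) (auto simp: norm_axis_1)
    show "integrable lebesgue (\<lambda>y. K t (x + h *\<^sub>R axis i 1 - y) *\<^sub>R g y)" for h
      by (rule heat_kernel_integrable[OF K(1) g t])
    show "(\<lambda>y. K' t (x + 0 *\<^sub>R axis i 1 - y) *\<^sub>R g y) \<in> borel_measurable lebesgue"
      by (rule borel_measurable_integrable[OF heat_kernel_integrable[OF K(2) g t]])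
    show "integrable lebesgue (\<lambda>y. (C * exp (- (c * (norm (x - y))\<^sup>2))) *\<^sub>R g y)"
      unfolding scaleR_scaleR[symmetric] using g c by (intro integrable_scaleR_right) (auto simp: gauss_integrable_def)
  qed simp
  then show ?thesis by (simp add: kernel_conv_def)
qed

lemma kernel_conv_time_derivative:
  fixes g :: "real^'n \<Rightarrow> complex"
  assumes K: "heat_kernel d K" "heat_kernel d' K'" and g: "gauss_integrable g" and t: "t > 0"
    and deriv: "\<And>t z. t > 0 \<Longrightarrow> ((\<lambda>t. K t z) has_real_derivative K' t z) (at t)"
  shows "((\<lambda>t. kernel_conv (K t) g x) has_vector_derivative kernel_conv (K' t) g x) (at t)"
proof -
  obtain C c where c: "c > 0" and C: "\<And>\<tau> z w. t/2 \<le> \<tau> \<Longrightarrow> \<tau> \<le> 2 * t \<Longrightarrow> norm w \<le> 1 \<Longrightarrow>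
     \<bar>K' \<tau> (z + w)\<bar> \<le> C * exp (- (c * (norm z)\<^sup>2))"
    using heat_kernel_local_bound[OF K(2) t] by blast
  have near: "\<tau> > 0" "t/2 \<le> \<tau>" "\<tau> \<le> 2 * t" if "\<bar>\<tau> - t\<bar> < t/2" for \<tau> using that t by (auto simp: abs_if split: if_splits)
  show ?thesis
    unfolding kernel_conv_def
  proof (rule has_vector_derivative_lebesgue_integral[where \<epsilon> = "t/2" and w = "\<lambda>y. C * exp (- (c * (norm (x - y))\<^sup>2))"])
    show "((\<lambda>\<tau>. K \<tau> (x - y)) has_real_derivative K' h (x - y)) (at h)" if "\<bar>h - t\<bar> < t/2" for h y
      by (rule deriv[OF near(1)[OF that]])
    show "\<bar>K' h (x - y)\<bar> \<le> C * exp (- (c * (norm (x - y))\<^sup>2))" if "\<bar>h - t\<bar> < t/2" for h y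
      using C[of h 0 "x - y"] near[OF that] by simp
    show "integrable lebesgue (\<lambda>y. K h (x - y) *\<^sub>R g y)" if "\<bar>h - t\<bar> < t/2" for h
      by (rule heat_kernel_integrable[OF K(1) g near(1)[OF that]])
    show "(\<lambda>y. K' t (x - y) *\<^sub>R g y) \<in> borel_measurable lebesgue"
      by (rule borel_measurable_integrable[OF heat_kernel_integrable[OF K(2) g t]])
    show "integrable lebesgue (\<lambda>y. (C * exp (- (c * (norm (x - y))\<^sup>2))) *\<^sub>R g y)"
      unfolding scaleR_scaleR[symmetric] using g c by (intro integrable_scaleR_right) (auto simp: gauss_integrable_def)
  qed (use t in simp)
qed

text \<open>
  Continuity in space gives the measurability of the derivatives.
\<close>
lemma kernel_conv_continuous:
  fixes g :: "real^'n \<Rightarrow> complex"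
  assumes K: "heat_kernel d K" and g: "gauss_integrable g" and t: "t > 0"
  shows "continuous_on UNIV (kernel_conv (K t) g)"
  unfolding continuous_on_sequentially comp_def
proof (intro allI ballI impI)
  fix X :: "nat \<Rightarrow> real^'n" and x assume "(\<forall>n. X n \<in> UNIV) \<and> X \<longlonglongrightarrow> x"
  then have X: "X \<longlonglongrightarrow> x" by simp
  obtain C c where c: "c > 0" and C: "\<And>\<tau> z w. t/2 \<le> \<tau> \<Longrightarrow> \<tau> \<le> 2 * t \<Longrightarrow> norm w \<le> 1 \<Longrightarrow>
     \<bar>K \<tau> (z + w)\<bar> \<le> C * exp (- (c * (norm z)\<^sup>2))"
    using heat_kernel_local_bound[OF K t] by blast
  from X have "\<forall>\<^sub>F n in sequentially. dist (X n) x < 1" by (rule tendstoD) simp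
  then obtain N where N: "\<And>n. n \<ge> N \<Longrightarrow> dist (X n) x < 1"
    unfolding eventually_sequentially by auto
  show "(\<lambda>n. kernel_conv (K t) g (X n)) \<longlonglongrightarrow> kernel_conv (K t) g x"
    unfolding kernel_conv_def
  proof (rule LIMSEQ_offset[of _ N], rule integral_dominated_convergence)
    show "(\<lambda>y. K t (x - y) *\<^sub>R g y) \<in> borel_measurable lebesgue"
      "(\<lambda>y. K t (X (n + N) - y) *\<^sub>R g y) \<in> borel_measurable lebesgue" for n
      by (rule borel_measurable_integrable[OF heat_kernel_integrable[OF K g t]])+
    show "integrable lebesgue (\<lambda>y. norm ((C * exp (- (c * (norm (x - y))\<^sup>2))) *\<^sub>R g y))"
      unfolding scaleR_scaleR[symmetric] using g c
      by (intro integrable_norm integrable_scaleR_right) (auto simp: gauss_integrable_def)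
    show "AE y in lebesgue. (\<lambda>n. K t (X (n + N) - y) *\<^sub>R g y) \<longlonglongrightarrow> K t (x - y) *\<^sub>R g y"
    proof (intro AE_I2 tendsto_scaleR tendsto_const)
      fix y
      have "isCont (K t) (x - y)"
        using heat_kernel_continuous[OF K t] by (simp add: continuous_on_eq_continuous_at)
      then show "(\<lambda>n. K t (X (n + N) - y)) \<longlonglongrightarrow> K t (x - y)"
        by (rule isCont_tendsto_compose) (intro tendsto_intros LIMSEQ_ignore_initial_segment X)
    qed
    show "AE y in lebesgue. norm (K t (X (n + N) - y) *\<^sub>R g y) \<le> norm ((C * exp (- (c * (norm (x - y))\<^sup>2))) *\<^sub>R g y)" for n
    proof (intro AE_I2)
      fix y
      have "\<bar>K t ((x - y) + (X (n + N) - x))\<bar> \<le> C * exp (- (c * (norm (x - y))\<^sup>2))"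
        using N[of "n + N"] t by (intro C) (auto simp: dist_norm)
      then have "\<bar>K t (X (n + N) - y)\<bar> \<le> \<bar>C * exp (- (c * (norm (x - y))\<^sup>2))\<bar>" by simp
      then show "norm (K t (X (n + N) - y) *\<^sub>R g y) \<le> norm ((C * exp (- (c * (norm (x - y))\<^sup>2))) *\<^sub>R g y)"
        unfolding norm_scaleR by (intro mult_right_mono) auto
    qed
  qed
qed

lemma heat_eq_kernel_conv:
  "\<exists>K. heat_kernel (- real CARD('n)) K \<and>
     (\<forall>(g :: real^'n \<Rightarrow> complex) t. 0 < t \<longrightarrow> heat t g = kernel_conv (K t) g)"
proof -
  let ?n = "real CARD('n)"
  define K where "K = (\<lambda>t z. (4 * pi) powr (- ?n/2) * t powr (- ?n/2) * exp (- ((norm (z::real^'n))\<^sup>2 / (4 * t))))"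
  have "heat_kernel (- ?n) K"
    unfolding K_def by (rule heat_kernel_scale[OF heat_kernel.gauss]) auto
  moreover have "heat t g = kernel_conv (K t) g" if t: "t > 0" for t and g :: "real^'n \<Rightarrow> complex"
  proof
    fix x
    have root: "1 / sqrt (a ^ CARD('n)) = a powr (- ?n/2)" if "a > 0" for a :: real
    proof -
      have "sqrt (a ^ CARD('n)) = (a powr ?n) powr (1/2)"
        using that by (simp add: powr_realpow powr_half_sqrt)
      then show ?thesis by (simp add: powr_powr powr_minus_divide)
    qed
    have "1 / sqrt ((4 * pi * t) ^ CARD('n)) = (4 * pi * t) powr (- ?n/2)"
      using t by (intro root) simp
    also have "\<dots> = (4 * pi) powr (- ?n/2) * t powr (- ?n/2)"
      using t by (simp add: powr_mult)
    finally have *: "1 / sqrt ((4 * pi * t) ^ CARD('n)) = (4 * pi) powr (- ?n/2) * t powr (- ?n/2)" .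
    show "heat t g x = kernel_conv (K t) g x"
      unfolding heat_def kernel_conv_def * K_def scaleR_scaleR[symmetric] integral_scaleR_right ..
  qed
  ultimately show ?thesis by blast
qed

text \<open>
  The kernel \<open>L\<close> is chosen before the function \<open>g\<close>: the constant in the final estimate depends on the kernel
  and must not depend on \<open>g\<close>. The order of quantifiers below is the same for the same reason.
\<close>
lemma foldr_partial_x_kernel_conv:
  fixes K :: "real \<Rightarrow> real^'n \<Rightarrow> real"
  assumes K: "heat_kernel d K"
  shows "\<exists>L. heat_kernel (d - length is) L \<and> (\<forall>g u t. gauss_integrable g \<and> u = kernel_conv (K t) g \<and> 0 < t \<longrightarrow>
     x_partials_exist is u \<and> foldr partial_x is u = kernel_conv (L t) g)"
proof (induction "is")
  case Nil
  then show ?case using K by auto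
next
  case (Cons i "is")
  then obtain L where L: "heat_kernel (d - length is) L"
    "\<And>g u t. gauss_integrable g \<Longrightarrow> u = kernel_conv (K t) g \<Longrightarrow> t > 0 \<Longrightarrow> x_partials_exist is u"
    "\<And>g u t. gauss_integrable g \<Longrightarrow> u = kernel_conv (K t) g \<Longrightarrow> t > 0 \<Longrightarrow> foldr partial_x is u = kernel_conv (L t) g" by blast
  obtain L' where L': "heat_kernel (d - length is - 1) L'" "\<And>t z h. t > 0 \<Longrightarrow>
    ((\<lambda>h. L t (z + h *\<^sub>R axis i 1)) has_real_derivative L' t (z + h *\<^sub>R axis i 1)) (at h)"
    using heat_kernel_space_derivative[OF L(1), of i] by blast
  have "heat_kernel (d - length (i # is)) L'" using L'(1) by (simp add: algebra_simps)
  moreover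
  { fix g :: "real^'n \<Rightarrow> complex" and u and t :: real
    assume g: "gauss_integrable g" and u: "u = kernel_conv (K t) g" and t: "t > 0"
    have der: "((\<lambda>h. kernel_conv (L t) g (x + h *\<^sub>R axis i 1)) has_vector_derivative kernel_conv (L' t) g x) (at 0)" for x
      by (rule kernel_conv_space_derivative[OF L(1) L'(1) g t L'(2)[OF t]])
    have "x_partials_exist (i # is) u"
      using L(2)[OF g u t] der by (auto simp: L(3)[OF g u t] intro: differentiableI_vector)
    moreover have "foldr partial_x (i # is) u = kernel_conv (L' t) g"
      using der by (auto simp: L(3)[OF g u t] partial_x_def vector_derivative_at)
    ultimately have "x_partials_exist (i # is) u \<and> foldr partial_x (i # is) u = kernel_conv (L' t) g" ..
  }
  ultimately show ?case by blast
qed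

lemma partial_t_funpow_kernel_conv:
  fixes K :: "real \<Rightarrow> real^'n \<Rightarrow> real"
  assumes K: "heat_kernel d K"
  shows "\<exists>L. heat_kernel (d - 2 * real k) L \<and> (\<forall>g u. gauss_integrable g \<and> (\<forall>t>0. u t = kernel_conv (K t) g) \<longrightarrow>
     (\<forall>t>0. (partial_t ^^ k) u t = kernel_conv (L t) g) \<and>
     (\<forall>j<k. \<forall>t>0. \<forall>x. (\<lambda>\<tau>. (partial_t ^^ j) u \<tau> x) differentiable (at t)))"
proof (induction k)
  case 0
  then show ?case using K by auto
next
  case (Suc k)
  then obtain L where L1: "heat_kernel (d - 2 * real k) L" and L0: "\<forall>g u. gauss_integrable g \<and> (\<forall>t>0. u t = kernel_conv (K t) g) \<longrightarrow>
     (\<forall>t>0. (partial_t ^^ k) u t = kernel_conv (L t) g) \<and>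
     (\<forall>j<k. \<forall>t>0. \<forall>x. (\<lambda>\<tau>. (partial_t ^^ j) u \<tau> x) differentiable (at t))" by (elim exE conjE)
  note L = L1 L0[rule_format, THEN conjunct1, rule_format] L0[rule_format, THEN conjunct2, rule_format]
  obtain L' where L': "heat_kernel (d - 2 * real k - 2) L'" "\<And>t z. t > 0 \<Longrightarrow>
    ((\<lambda>t. L t z) has_real_derivative L' t z) (at t)"
    using heat_kernel_time_derivative[OF L(1)] by blast
  have "heat_kernel (d - 2 * real (Suc k)) L'" using L'(1) by (simp add: algebra_simps)
  moreover
  { fix g u assume g: "gauss_integrable g" and u: "\<And>t. t > 0 \<Longrightarrow> u t = kernel_conv (K t) g"
    have uk: "(partial_t ^^ k) u t = kernel_conv (L t) g" if "0 < t" for t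
      using L(2)[of g u t] g u that by blast
    { fix t :: real and x assume t: "t > 0"
      have "((\<lambda>t. kernel_conv (L t) g x) has_vector_derivative kernel_conv (L' t) g x) (at t)"
        by (rule kernel_conv_time_derivative[OF L(1) L'(1) g t L'(2)])
      then have "((\<lambda>\<tau>. (partial_t ^^ k) u \<tau> x) has_vector_derivative kernel_conv (L' t) g x) (at t)"
        by (rule has_vector_derivative_transform_within_open[of _ _ _ "{0<..}"]) (auto simp: uk t) }
    note der = this
    have "(partial_t ^^ Suc k) u t = kernel_conv (L' t) g" if t: "t > 0" for t
      using der[OF t] by (auto simp: partial_t_def vector_derivative_at)
    moreover have "(\<lambda>\<tau>. (partial_t ^^ j) u \<tau> x) differentiable (at t)" if "j < Suc k" "t > 0" for j t x
      using that L(3)[of g u] g u der[OF that(2), THEN differentiableI_vector] by (cases "j = k") auto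
    ultimately have "(\<forall>t>0. (partial_t ^^ Suc k) u t = kernel_conv (L' t) g) \<and>
     (\<forall>j<Suc k. \<forall>t>0. \<forall>x. (\<lambda>\<tau>. (partial_t ^^ j) u \<tau> x) differentiable (at t))" by blast }
  ultimately show ?case by blast
qed

lemma length_directions: "length (directions \<alpha>) = (\<Sum>i\<in>UNIV. \<alpha> i)"
  by (simp add: directions_def length_concat comp_def sum_list_distinct_conv_sum_set)

lemma heat_deriv_eq_kernel_conv:
  fixes \<alpha> :: "'n::{finite,linorder} \<Rightarrow> nat"
  shows "\<exists>L. heat_kernel (- real CARD('n) - real (\<Sum>i\<in>UNIV. \<alpha> i) - 2 * real k) L \<and>
    (\<forall>g. gauss_integrable g \<longrightarrow> heat_deriv_exists k \<alpha> g \<and> (\<forall>t>0. heat_deriv k \<alpha> g t = kernel_conv (L t) g))"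
proof -
  obtain K :: "real \<Rightarrow> real^'n::{finite,linorder} \<Rightarrow> real" where K: "heat_kernel (- real CARD('n)) K" "\<And>g t. t > 0 \<Longrightarrow> heat t g = kernel_conv (K t) g"
    using heat_eq_kernel_conv by blast
  obtain L where L: "heat_kernel (- real CARD('n) - real (\<Sum>i\<in>UNIV. \<alpha> i)) L"
    "\<And>g u t. gauss_integrable g \<Longrightarrow> u = kernel_conv (K t) g \<Longrightarrow> t > 0 \<Longrightarrow> x_partials_exist (directions \<alpha>) u"
    "\<And>g u t. gauss_integrable g \<Longrightarrow> u = kernel_conv (K t) g \<Longrightarrow> t > 0 \<Longrightarrow> foldr partial_x (directions \<alpha>) u = kernel_conv (L t) g"
    using foldr_partial_x_kernel_conv[OF K(1), of "directions \<alpha>"] unfolding length_directions by blast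
  obtain M where M1: "heat_kernel (- real CARD('n) - real (\<Sum>i\<in>UNIV. \<alpha> i) - 2 * real k) M"
    and M0: "\<forall>g u. gauss_integrable g \<and> (\<forall>t>0. u t = kernel_conv (L t) g) \<longrightarrow>
     (\<forall>t>0. (partial_t ^^ k) u t = kernel_conv (M t) g) \<and>
     (\<forall>j<k. \<forall>t>0. \<forall>x. (\<lambda>\<tau>. (partial_t ^^ j) u \<tau> x) differentiable (at t))"
    using partial_t_funpow_kernel_conv[OF L(1), of k] by (elim exE conjE)
  note M = M0[rule_format, THEN conjunct1, rule_format] M0[rule_format, THEN conjunct2, rule_format]
  have "heat_deriv_exists k \<alpha> g \<and> (\<forall>t>0. heat_deriv k \<alpha> g t = kernel_conv (M t) g)" if g: "gauss_integrable g" for g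
  proof -
    have u: "foldr partial_x (directions \<alpha>) (heat t g) = kernel_conv (L t) g" if "t > 0" for t
      by (rule L(3)[OF g K(2)[OF that] that])
    have "heat_defined g"
      unfolding heat_defined_def
    proof (intro allI impI)
      fix t :: real and x assume "t > 0"
      then show "integrable lebesgue (\<lambda>y. exp (- ((norm (x - y))\<^sup>2 / (4 * t))) *\<^sub>R g y)"
        using g[unfolded gauss_integrable_def, THEN conjunct2, rule_format, of "1/(4*t)" x] by simp
    qed
    then show ?thesis
      using L(2)[OF g K(2)] M(1)[of g "\<lambda>t. foldr partial_x (directions \<alpha>) (heat t g)"] M(2)[of g "\<lambda>t. foldr partial_x (directions \<alpha>) (heat t g)"] g u
      by (auto simp: heat_deriv_exists_def mixed_partial_exists_def heat_deriv_def mixed_partial_def)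
  qed
  then show ?thesis using M1 by blast
qed

section \<open>Powers of extended reals and power means\<close>

lemma ennreal_epowr: "0 \<le> x \<Longrightarrow> ennreal x epowr a = ennreal (x powr a)"
  by (simp add: epowr_def)

lemma epowr_mono: "x \<le> y \<Longrightarrow> 0 \<le> a \<Longrightarrow> x epowr a \<le> y epowr a"
  by (auto simp: epowr_def top_unique less_top intro!: ennreal_leI powr_mono2 enn2real_mono)

lemma epowr_le_iff:
  assumes "0 \<le> y" "0 < a"
  shows "x epowr a \<le> ennreal y \<longleftrightarrow> x \<le> ennreal (y powr (1 / a))"
proof (cases x)
  case (real z)
  have "z powr a \<le> y \<longleftrightarrow> z \<le> y powr (1 / a)"
  proof
    assume "z powr a \<le> y"
    then have "(z powr a) powr (1/a) \<le> y powr (1/a)" using assms by (intro powr_mono2) auto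
    then show "z \<le> y powr (1 / a)" using assms real by (simp add: powr_powr)
  next
    assume "z \<le> y powr (1 / a)"
    then have "z powr a \<le> (y powr (1/a)) powr a" using assms real by (intro powr_mono2) auto
    then show "z powr a \<le> y" using assms by (simp add: powr_powr)
  qed
  then show ?thesis using real assms by (simp add: ennreal_epowr)
qed (auto simp: epowr_def top_unique)

text \<open>
  Young's inequality with a free parameter \<open>l\<close>. Optimising over \<open>l\<close> after integration yields the power
  mean inequality.
\<close>
lemma young_scaled:
  fixes u l a :: real
  assumes "1 \<le> a" "0 \<le> u" "0 < l"
  shows "u \<le> l * (1 - 1 / a) + l powr (1 - a) * u powr a / a"
proof (cases "u = 0")
  case True
  then show ?thesis using assms by (simp add: divide_simps)
next
  case False
  have "(u powr a) powr (1 / a) * (l powr a) powr (1 - 1 / a) \<le> (1 / a) * u powr a + (1 - 1 / a) * l powr a"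
    using assms False by (intro Youngs_inequality_0) (auto simp: field_simps)
  also have "(u powr a) powr (1 / a) = u" using assms False by (simp add: powr_powr)
  also have "(l powr a) powr (1 - 1 / a) = l powr (a - 1)" 
  proof -
    have "a * (1 - 1 / a) = a - 1" using assms by (simp add: field_simps)
    then show ?thesis by (simp only: powr_powr)
  qed
  finally have "l powr (1 - a) * (u * l powr (a - 1)) \<le> l powr (1 - a) * ((1 / a) * u powr a + (1 - 1 / a) * l powr a)"
    by (intro mult_left_mono) auto
  moreover have "l powr (1 - a) * l powr (a - 1) = 1" "l powr (1 - a) * l powr a = l"
    using assms by (simp_all add: powr_add[symmetric])
  ultimately show ?thesis by (simp add: algebra_simps)
qed

text \<open>
  Jensen's inequality for the measure \<open>w M\<close>, or Hoelder's inequality with one exponent hidden in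
  \<open>w\<close>. With \<open>w\<close> the indicator of a ring it compares integrals of different powers; with \<open>w\<close> a Gaussian it
  gives Young's convolution inequality.
\<close>
lemma nn_integral_power_mean:
  fixes w \<phi> :: "'a \<Rightarrow> real"
  assumes [measurable]: "w \<in> borel_measurable M" "\<phi> \<in> borel_measurable M"
    and w: "\<And>x. 0 \<le> w x" and \<phi>: "\<And>x. 0 \<le> \<phi> x" and a: "1 \<le> a"
    and W: "0 < W" "(\<integral>\<^sup>+x. ennreal (w x) \<partial>M) \<le> ennreal W"
  shows "(\<integral>\<^sup>+x. ennreal (w x * \<phi> x) \<partial>M) epowr a
    \<le> ennreal (W powr (a - 1)) * (\<integral>\<^sup>+x. ennreal (w x * \<phi> x powr a) \<partial>M)"
proof (cases "\<integral>\<^sup>+x. ennreal (w x * \<phi> x powr a) \<partial>M")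
  case top
  then show ?thesis using W by (simp add: ennreal_mult_top)
next
  case (real b)
  let ?v = "\<integral>\<^sup>+x. ennreal (w x * \<phi> x) \<partial>M"
  \<comment> \<open>The best choice \<open>l = v / W\<close> needs \<open>v\<close> finite, which \<open>l = 1\<close> shows first.\<close>
  have *: "?v \<le> ennreal (l * (1 - 1 / a) * W + l powr (1 - a) * b / a)" if l: "0 < l" for l
  proof -
    have nn: "0 \<le> l * (1 - 1 / a)" "0 \<le> l powr (1 - a) / a" using l a by auto
    have "?v \<le> (\<integral>\<^sup>+x. ennreal (l * (1 - 1 / a)) * ennreal (w x) + ennreal (l powr (1 - a) / a) * ennreal (w x * \<phi> x powr a) \<partial>M)"
    proof (intro nn_integral_mono)
      fix x
      have "w x * \<phi> x \<le> w x * (l * (1 - 1 / a) + l powr (1 - a) * \<phi> x powr a / a)"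
        by (intro mult_left_mono young_scaled a \<phi> l w)
      then have "ennreal (w x * \<phi> x) \<le> ennreal (l * (1 - 1 / a) * w x + l powr (1 - a) / a * (w x * \<phi> x powr a))"
        by (intro ennreal_leI) (simp add: algebra_simps)
      also have "\<dots> = ennreal (l * (1 - 1 / a)) * ennreal (w x) + ennreal (l powr (1 - a) / a) * ennreal (w x * \<phi> x powr a)"
        using nn w[of x] \<phi>[of x] a
        by (subst ennreal_plus) (auto simp: ennreal_mult[symmetric] simp del: ennreal_plus intro!: mult_nonneg_nonneg divide_nonneg_nonneg)
      finally show "ennreal (w x * \<phi> x) \<le> \<dots>" .
    qed
    also have "\<dots> = ennreal (l * (1 - 1 / a)) * (\<integral>\<^sup>+x. ennreal (w x) \<partial>M) + ennreal (l powr (1 - a) / a) * (\<integral>\<^sup>+x. ennreal (w x * \<phi> x powr a) \<partial>M)"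
      by (simp add: nn_integral_add nn_integral_cmult)
    also have "\<dots> \<le> ennreal (l * (1 - 1 / a)) * ennreal W + ennreal (l powr (1 - a) / a) * ennreal b"
      using W real by (intro add_mono mult_left_mono) auto
    also have "\<dots> = ennreal (l * (1 - 1 / a) * W) + ennreal (l powr (1 - a) / a * b)"
      using W real by (intro arg_cong2[where f = "(+)"] ennreal_mult[symmetric] nn) auto
    also have "\<dots> = ennreal (l * (1 - 1 / a) * W + l powr (1 - a) / a * b)"
      using W real by (intro ennreal_plus[symmetric] mult_nonneg_nonneg nn) auto
    also have "l powr (1 - a) / a * b = l powr (1 - a) * b / a" by simp
    finally show ?thesis .
  qed
  obtain v where v: "?v = ennreal v" "0 \<le> v"
    using *[of 1] by (cases ?v) (auto simp: top_unique)
  have "v powr a \<le> W powr (a - 1) * b"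
  proof (cases "v = 0")
    case False
    then have v0: "v > 0" using v by simp
    have nn: "0 \<le> (v / W) * (1 - 1 / a) * W + (v / W) powr (1 - a) * b / a"
      using v0 W a real by (intro add_nonneg_nonneg mult_nonneg_nonneg divide_nonneg_nonneg) auto
    have "v \<le> (v / W) * (1 - 1 / a) * W + (v / W) powr (1 - a) * b / a"
      using *[of "v / W"] v0 W nn unfolding v(1) by (simp add: ennreal_le_iff)
    then have "v / a \<le> (v / W) powr (1 - a) * b / a" using W a by (simp add: field_simps)
    then have "v \<le> (v / W) powr (1 - a) * b" using a by (simp add: divide_le_cancel)
    then have "(v / W) powr (a - 1) * v \<le> (v / W) powr (a - 1) * ((v / W) powr (1 - a) * b)"
      by (intro mult_left_mono) auto
    also have "\<dots> = b" using v0 W by (simp add: powr_add[symmetric] mult.assoc[symmetric])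
    finally have "W powr (a - 1) * ((v / W) powr (a - 1) * v) \<le> W powr (a - 1) * b" by (intro mult_left_mono) auto
    also have "W powr (a - 1) * ((v / W) powr (a - 1) * v) = v powr (a - 1) * v powr 1"
      using v0 W by (simp add: powr_divide)
    also have "\<dots> = v powr a" unfolding powr_add[symmetric] by simp
    finally show ?thesis .
  qed (use real in simp)
  then show ?thesis unfolding v(1) real(2) using v real
    by (simp add: ennreal_epowr ennreal_mult[symmetric] ennreal_leI)
qed

section \<open>Dyadic decomposition around the origin\<close>

text \<open>
  Only an upper bound is needed, so the sets may overlap.
\<close>
lemma nn_integral_geometric_cover:
  fixes h :: "'a \<Rightarrow> ennreal" and A :: "nat \<Rightarrow> 'a set"
  assumes [measurable]: "h \<in> borel_measurable M" "\<And>j. A j \<in> sets M"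
    and cover: "\<And>y. y \<in> S \<Longrightarrow> h y \<noteq> 0 \<Longrightarrow> \<exists>j. y \<in> A j"
    and le: "\<And>j. (\<integral>\<^sup>+y\<in>A j. h y \<partial>M) \<le> ennreal (c * x ^ j)"
    and cx: "0 \<le> c" "0 \<le> x" "x < 1"
  shows "(\<integral>\<^sup>+y\<in>S. h y \<partial>M) \<le> ennreal (c / (1 - x))"
proof -
  have "(\<integral>\<^sup>+y\<in>S. h y \<partial>M) \<le> (\<integral>\<^sup>+y. (\<Sum>j. h y * indicator (A j) y) \<partial>M)"
  proof (intro nn_integral_mono)
    fix y
    show "h y * indicator S y \<le> (\<Sum>j. h y * indicator (A j) y)"
    proof (cases "y \<in> S \<and> h y \<noteq> 0")
      case True
      then obtain j where j: "y \<in> A j" using cover by blast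
      have "h y * indicator S y = (\<Sum>i\<in>{j}. h y * indicator (A i) y)" using True j by simp
      also have "\<dots> \<le> (\<Sum>j. h y * indicator (A j) y)" by (rule sum_le_suminf) auto
      finally show ?thesis .
    qed (auto simp: indicator_def)
  qed
  also have "\<dots> = (\<Sum>j. \<integral>\<^sup>+y. h y * indicator (A j) y \<partial>M)" by (rule nn_integral_suminf) simp
  also have "\<dots> \<le> (\<Sum>j. ennreal (c * x ^ j))" by (intro suminf_le le) auto
  also have "\<dots> = ennreal (c / (1 - x))"
    using cx sums_mult[OF geometric_sums[of x], of c] by (intro suminf_ennreal_eq) auto
  finally show ?thesis .
qed

text \<open>
  Closed on both sides: a norm that is a power of two times the base radius lies in two rings, which is harmless for upper
  bounds and lets the same covering lemma serve inside and outside a ball.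
\<close>
abbreviation dyadic_ring :: "real \<Rightarrow> (real^'n) set" where
  "dyadic_ring R \<equiv> {y. R \<le> norm y \<and> norm y \<le> 2 * R}"

lemma power_of_two_sandwich:
  fixes x :: real assumes "1 \<le> x"
  shows "\<exists>j. 2 ^ j \<le> x \<and> x \<le> 2 ^ (j + 1)"
proof -
  obtain n where n: "x < 2 ^ n" using real_arch_pow[of 2 x] by auto
  define j where "j = (LEAST n. x < 2 ^ Suc n)"
  have ex: "x < 2 ^ Suc n" using less_le_trans[OF n, of "2 ^ Suc n"] by simp
  have "x < 2 ^ Suc j" unfolding j_def by (rule LeastI[of _ n]) (rule ex)
  moreover have "2 ^ j \<le> x"
  proof (cases j)
    case (Suc i)
    then have "\<not> x < 2 ^ Suc i" using not_less_Least[of i "\<lambda>n. x < 2 ^ Suc n"] by (auto simp: j_def)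
    then show ?thesis using Suc by simp
  qed (use assms in simp)
  ultimately show ?thesis by (intro exI[of _ j]) auto
qed

lemma dyadic_ring_sets [measurable]: "dyadic_ring R \<in> sets lebesgue"
proof -
  have "dyadic_ring R = cball 0 (2 * R) - ball 0 R" by auto
  then show ?thesis by simp
qed

lemma nn_integral_outside_ball:
  fixes h :: "real^'n \<Rightarrow> ennreal"
  assumes h: "h \<in> borel_measurable lebesgue" and \<sigma>: "0 < \<sigma>" and e: "e < 0" and B: "0 \<le> B"
    and rings: "\<And>R. \<sigma> \<le> R \<Longrightarrow> (\<integral>\<^sup>+y\<in>dyadic_ring R. h y \<partial>lebesgue) \<le> ennreal (B * R powr e)"
  shows "(\<integral>\<^sup>+y\<in>{y. \<sigma> \<le> norm y}. h y \<partial>lebesgue) \<le> ennreal (B * \<sigma> powr e / (1 - 2 powr e))"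
proof (rule nn_integral_geometric_cover[where A = "\<lambda>j. dyadic_ring (\<sigma> * 2 ^ j)"])
  fix y :: "real^'n" assume "y \<in> {y. \<sigma> \<le> norm y}"
  then have "1 \<le> norm y / \<sigma>" using \<sigma> by simp
  then obtain j where "2 ^ j \<le> norm y / \<sigma>" "norm y / \<sigma> \<le> 2 ^ (j + 1)" using power_of_two_sandwich by blast
  then show "\<exists>j. y \<in> dyadic_ring (\<sigma> * 2 ^ j)" using \<sigma> by (intro exI[of _ j]) (auto simp: field_simps)
next
  fix j :: nat
  have "\<sigma> \<le> \<sigma> * 2 ^ j" using \<sigma> by simp
  then have "(\<integral>\<^sup>+y\<in>dyadic_ring (\<sigma> * 2 ^ j). h y \<partial>lebesgue) \<le> ennreal (B * (\<sigma> * 2 ^ j) powr e)" by (rule rings)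
  also have "(\<sigma> * 2 ^ j) powr e = \<sigma> powr e * (2 powr e) ^ j"
    using \<sigma> by (simp add: powr_mult powr_realpow[symmetric] powr_powr mult.commute)
  finally show "(\<integral>\<^sup>+y\<in>dyadic_ring (\<sigma> * 2 ^ j). h y \<partial>lebesgue) \<le> ennreal (B * \<sigma> powr e * (2 powr e) ^ j)" by (simp add: mult.assoc)
next
  show "2 powr e < 1" using e by (simp add: powr_less_one)
qed (use h B in auto)

text \<open>
  The rings shrinking to the origin miss the origin itself, whence the assumption on \<open>h 0\<close>.
\<close>
lemma nn_integral_inside_ball:
  fixes h :: "real^'n \<Rightarrow> ennreal"
  assumes h: "h \<in> borel_measurable lebesgue" "h 0 = 0" and \<sigma>: "0 < \<sigma>" and e: "0 < e" and B: "0 \<le> B"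
    and rings: "\<And>R. 0 < R \<Longrightarrow> R \<le> \<sigma> \<Longrightarrow> (\<integral>\<^sup>+y\<in>dyadic_ring R. h y \<partial>lebesgue) \<le> ennreal (B * R powr e)"
  shows "(\<integral>\<^sup>+y\<in>{y. norm y < \<sigma>}. h y \<partial>lebesgue) \<le> ennreal (B * \<sigma> powr e / (1 - 2 powr - e))"
proof (rule nn_integral_geometric_cover[where A = "\<lambda>j. dyadic_ring (\<sigma> / 2 ^ (j + 1))"])
  fix y :: "real^'n" assume y: "y \<in> {y. norm y < \<sigma>}" "h y \<noteq> 0"
  then have y0: "norm y > 0" using h by auto
  then have "1 \<le> \<sigma> / norm y" using y by simp
  then obtain j where "2 ^ j \<le> \<sigma> / norm y" "\<sigma> / norm y \<le> 2 ^ (j + 1)" using power_of_two_sandwich by blast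
  then show "\<exists>j. y \<in> dyadic_ring (\<sigma> / 2 ^ (j + 1))" using y0 by (intro exI[of _ j]) (auto simp: field_simps)
next
  fix j :: nat
  have "\<sigma> / 2 ^ (j + 1) \<le> \<sigma> / 1" using \<sigma> by (intro divide_left_mono) (auto intro: one_le_power simp del: power_Suc)
  then have "(\<integral>\<^sup>+y\<in>dyadic_ring (\<sigma> / 2 ^ (j + 1)). h y \<partial>lebesgue) \<le> ennreal (B * (\<sigma> / 2 ^ (j + 1)) powr e)"
    using \<sigma> by (intro rings) auto
  also have "\<dots> \<le> ennreal (B * (\<sigma> / 2 ^ j) powr e)"
    using \<sigma> B e by (intro ennreal_leI mult_left_mono powr_mono2) (auto simp: divide_simps)
  also have "(\<sigma> / 2 ^ j) powr e = \<sigma> powr e * (2 powr - e) ^ j"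
  proof -
    have "\<sigma> / 2 ^ j = \<sigma> * 2 powr - real j" by (simp add: powr_minus powr_realpow divide_inverse)
    moreover have "(2 powr - e) ^ j = (2 powr - e) powr real j" by (simp add: powr_realpow)
    ultimately show ?thesis using \<sigma> by (simp add: powr_mult powr_powr mult.commute)
  qed
  finally show "(\<integral>\<^sup>+y\<in>dyadic_ring (\<sigma> / 2 ^ (j + 1)). h y \<partial>lebesgue) \<le> ennreal (B * \<sigma> powr e * (2 powr - e) ^ j)" by (simp add: mult.assoc)
next
  show "2 powr - e < 1" using e by (simp add: powr_less_one)
qed (use h B in auto)

section \<open>The weighted function on dyadic rings\<close>

text \<open>
  Balls centred at the origin suffice, because the weight singles out the origin. The strict
  inequality \<open>M > 0\<close> keeps all powers of \<open>M\<close> well behaved; a function of norm zero satisfies the bound for every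
  \<open>M > 0\<close>.
\<close>
definition central_morrey_bound :: "real \<Rightarrow> real \<Rightarrow> real \<Rightarrow> (real^'n \<Rightarrow> complex) \<Rightarrow> bool" where
  "central_morrey_bound p q M f \<longleftrightarrow> f \<in> borel_measurable lebesgue \<and> M > 0 \<and>
     (\<forall>\<rho>>0. (\<integral>\<^sup>+y\<in>ball 0 \<rho>. ennreal (norm (f y) powr q) \<partial>lebesgue)
        \<le> ennreal (M powr q * \<rho> powr (real CARD('n) - real CARD('n) * q / p)))"

lemma emeasure_dyadic_ring_le:
  assumes "0 < R"
  shows "emeasure lebesgue (dyadic_ring R :: (real^'n) set) \<le> ennreal (unit_ball_vol (real CARD('n)) * (4 * R) powr real CARD('n))"
proof -
  have "emeasure lebesgue (dyadic_ring R :: (real^'n) set) \<le> emeasure lebesgue (ball 0 (4 * R) :: (real^'n) set)"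
    using assms by (intro emeasure_mono) auto
  also have "\<dots> = ennreal (unit_ball_vol (real CARD('n)) * (4 * R) ^ CARD('n))"
    using assms emeasure_ball[of "4 * R" "0::real^'n"] by (simp add: emeasure_completion)
  finally show ?thesis using assms by (simp add: powr_realpow)
qed

lemma weighted_measurable:
  assumes [measurable]: "f \<in> borel_measurable lebesgue"
  shows "weighted \<gamma> f \<in> borel_measurable lebesgue"
proof -
  have [measurable]: "norm \<in> borel_measurable (lebesgue :: (real^'n) measure)"
    by (intro measurable_completion) simp
  show ?thesis unfolding weighted_def by simp
qed

text \<open>
  Bookkeeping for the lemma that follows: comparing logarithms turns the identity into linear algebra.
\<close>
lemma ring_exponents:
  fixes V R M b q p n \<gamma> :: real
  assumes "V > 0" "R > 0" "M > 0" "b > 0" "q > 0" "p > 0"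
  shows "((V * (4 * R) powr n) powr (q / b - 1) * (R powr (- (\<gamma> * q)) * (M powr q * (4 * R) powr (n - n * q / p)))) powr (1 / (q / b))
    = V powr (1 - b / q) * 4 powr (n - n * b / p) * M powr b * R powr (b * (n / b - n / p - \<gamma>))" (is "?L = ?R")
proof -
  define c where "c = q / b"
  have q: "q = b * c" and c: "c > 0" using assms by (auto simp: c_def)
  have "ln ?L = ((c - 1) * (ln V + n * (ln 4 + ln R)) + (- (\<gamma> * q) * ln R + (q * ln M + (n - n * q / p) * (ln 4 + ln R)))) / c"
    using assms by (simp add: ln_mult ln_powr c_def)
  also have "\<dots> = (1 - 1 / c) * ln V + (n - n * b / p) * ln 4 + b * ln M + (b * (n / b - n / p - \<gamma>)) * ln R"
    using c assms unfolding q by (simp add: divide_simps) (simp add: algebra_simps)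
  also have "\<dots> = ln ?R"
    using assms c by (simp add: ln_mult ln_powr q)
  finally show ?thesis using assms by (subst (asm) ln_inj_iff) auto
qed

text \<open>
  On the ring the weight is at most \<open>R\<^sup>-\<^sup>\<gamma>\<close>, so the integral of \<open>|g|\<^sup>q\<close> is controlled by the growth bound for
  \<open>f\<close>; passing from the power \<open>q\<close> to the power \<open>b\<close> costs the measure of the ring to the power \<open>1 - b/q\<close>.
\<close>
lemma weighted_ring_bound:
  fixes p q b \<gamma> :: real
  assumes b: "1 \<le> b" "b \<le> q" and p: "q \<le> p" and \<gamma>: "0 < \<gamma>"
  shows "\<exists>C>0. \<forall>(f :: real^'n \<Rightarrow> complex) M R. central_morrey_bound p q M f \<and> 0 < R \<longrightarrow>
    (\<integral>\<^sup>+y\<in>dyadic_ring R. ennreal (norm (weighted \<gamma> f y) powr b) \<partial>lebesgue)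
      \<le> ennreal (C * M powr b * R powr (b * (real CARD('n) / b - real CARD('n) / p - \<gamma>)))"
proof -
  let ?n = "real CARD('n)"
  define V where "V = unit_ball_vol ?n"
  have V: "V > 0" by (simp add: V_def)
  have q: "0 < q" "0 < p" using b p by auto
  define C where "C = V powr (1 - b / q) * 4 powr (?n - ?n * b / p)"
  have C: "C > 0" using V by (simp add: C_def)
  have "(\<integral>\<^sup>+y\<in>dyadic_ring R. ennreal (norm (weighted \<gamma> f y) powr b) \<partial>lebesgue)
      \<le> ennreal (C * M powr b * R powr (b * (?n / b - ?n / p - \<gamma>)))"
    if f: "central_morrey_bound p q M f" and R: "0 < R" for f :: "real^'n \<Rightarrow> complex" and M R
  proof -
    have [measurable]: "f \<in> borel_measurable lebesgue" and M: "M > 0"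
      using f by (auto simp: central_morrey_bound_def)
    have [measurable]: "ball (0 :: real^'n) (4 * R) \<in> sets lebesgue" by simp
    have [measurable]: "weighted \<gamma> f \<in> borel_measurable lebesgue" by (rule weighted_measurable) simp
    let ?W = "V * (4 * R) powr ?n"
    let ?Q = "R powr (- (\<gamma> * q)) * (M powr q * (4 * R) powr (?n - ?n * q / p))"
    have pw: "(norm (weighted \<gamma> f y) powr b) powr (q / b) = norm (weighted \<gamma> f y) powr q" for y
      using b by (simp add: powr_powr)
    have mean: "(\<integral>\<^sup>+y. ennreal (indicator (dyadic_ring R) y * norm (weighted \<gamma> f y) powr b) \<partial>lebesgue) epowr (q / b)
      \<le> ennreal (?W powr (q / b - 1)) * (\<integral>\<^sup>+y. ennreal (indicator (dyadic_ring R) y * (norm (weighted \<gamma> f y) powr b) powr (q / b)) \<partial>lebesgue)"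
    proof (rule nn_integral_power_mean)
      have "(\<integral>\<^sup>+y. ennreal (indicator (dyadic_ring R :: (real^'n) set) y) \<partial>lebesgue) = emeasure lebesgue (dyadic_ring R :: (real^'n) set)"
        by (simp add: ennreal_indicator)
      then show "(\<integral>\<^sup>+y. ennreal (indicator (dyadic_ring R :: (real^'n) set) y) \<partial>lebesgue) \<le> ennreal ?W"
        using emeasure_dyadic_ring_le[OF R] by (simp add: V_def)
    qed (use b V R in auto)
    have "(\<integral>\<^sup>+y. ennreal (indicator (dyadic_ring R) y * (norm (weighted \<gamma> f y) powr b) powr (q / b)) \<partial>lebesgue)
      \<le> (\<integral>\<^sup>+y. ennreal (R powr (- (\<gamma> * q))) * (ennreal (norm (f y) powr q) * indicator (ball 0 (4 * R)) y) \<partial>lebesgue)"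
    proof (intro nn_integral_mono)
      fix y :: "real^'n"
      show "ennreal (indicator (dyadic_ring R) y * (norm (weighted \<gamma> f y) powr b) powr (q / b)) \<le>
         ennreal (R powr (- (\<gamma> * q))) * (ennreal (norm (f y) powr q) * indicator (ball 0 (4 * R)) y)"
      proof (cases "y \<in> dyadic_ring R")
        case True
        then have y: "R \<le> norm y" "norm y < 4 * R" using R by auto
        have "norm (weighted \<gamma> f y) powr q = norm y powr (- (\<gamma> * q)) * norm (f y) powr q"
          by (simp add: weighted_def powr_mult powr_powr)
        also have "\<dots> \<le> R powr (- (\<gamma> * q)) * norm (f y) powr q"
          using y R \<gamma> q by (intro mult_right_mono powr_mono2') auto
        finally show ?thesis using True y unfolding pw by (simp add: ennreal_mult[symmetric] ennreal_leI)
      qed simp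
    qed
    also have "\<dots> = ennreal (R powr (- (\<gamma> * q))) * (\<integral>\<^sup>+y\<in>ball 0 (4 * R). ennreal (norm (f y) powr q) \<partial>lebesgue)"
      by (rule nn_integral_cmult) simp
    also have "\<dots> \<le> ennreal (R powr (- (\<gamma> * q))) * ennreal (M powr q * (4 * R) powr (?n - ?n * q / p))"
      using f R unfolding central_morrey_bound_def by (intro mult_left_mono) auto
    also have "\<dots> = ennreal ?Q" by (simp add: ennreal_mult[symmetric])
    finally have "(\<integral>\<^sup>+y. ennreal (indicator (dyadic_ring R) y * (norm (weighted \<gamma> f y) powr b) powr (q / b)) \<partial>lebesgue) \<le> ennreal ?Q" .
    from mult_left_mono[OF this, of "ennreal (?W powr (q / b - 1))"] mean
    have "(\<integral>\<^sup>+y. ennreal (indicator (dyadic_ring R) y * norm (weighted \<gamma> f y) powr b) \<partial>lebesgue) epowr (q / b)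
      \<le> ennreal (?W powr (q / b - 1)) * ennreal ?Q"
      by (auto intro: order_trans)
    also have "\<dots> = ennreal (?W powr (q / b - 1) * ?Q)" by (intro ennreal_mult[symmetric]) auto
    finally have "(\<integral>\<^sup>+y. ennreal (indicator (dyadic_ring R) y * norm (weighted \<gamma> f y) powr b) \<partial>lebesgue) epowr (q / b)
      \<le> ennreal (?W powr (q / b - 1) * ?Q)" .
    then have "(\<integral>\<^sup>+y. ennreal (indicator (dyadic_ring R) y * norm (weighted \<gamma> f y) powr b) \<partial>lebesgue) \<le> 
      ennreal ((?W powr (q / b - 1) * ?Q) powr (1 / (q / b)))"
      using b q V by (subst (asm) epowr_le_iff) auto
    also have "(?W powr (q / b - 1) * ?Q) powr (1 / (q / b)) = C * M powr b * R powr (b * (?n / b - ?n / p - \<gamma>))"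
      unfolding C_def using V R M b q by (intro ring_exponents) auto
    finally show ?thesis by (simp add: ennreal_mult ennreal_indicator mult.commute)
  qed
  then show ?thesis using C by blast
qed

section \<open>Convolution with a Gaussian\<close>

text \<open>
  The dependence on \<open>\<sigma>\<close> is what matters. It comes from the same dyadic decomposition: inside the ball of radius
  \<open>\<sigma>\<close> the integrand is at most 1, and outside it decays faster than \<open>(\<sigma> / |z|)\<^sup>2\<^sup>n\<close>.
\<close>
lemma gaussian_integral_bound:
  "\<exists>G\<ge>1. \<forall>\<sigma>>0. (\<integral>\<^sup>+z. ennreal (exp (- ((norm (z::real^'n))\<^sup>2 / (8 * \<sigma>\<^sup>2)))) \<partial>lebesgue) \<le> ennreal (G * \<sigma> powr real CARD('n))"
proof -
  let ?n = "real CARD('n)"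
  define V where "V = unit_ball_vol ?n"
  have V: "V > 0" by (simp add: V_def)
  define D where "D = (8 * ?n) powr ?n * V * 4 powr ?n"
  have D: "D > 0" using V by (simp add: D_def)
  define G where "G = 1 + (V + D / (1 - 2 powr (- ?n)))"
  have two: "2 powr (- ?n) < 1" by (rule powr_less_one) auto
  have G: "G \<ge> 1" using V D two by (simp add: G_def)
  have "(\<integral>\<^sup>+z. ennreal (exp (- ((norm (z::real^'n))\<^sup>2 / (8 * \<sigma>\<^sup>2)))) \<partial>lebesgue) \<le> ennreal (G * \<sigma> powr ?n)"
    if \<sigma>: "0 < \<sigma>" for \<sigma>
  proof -
    let ?h = "\<lambda>z::real^'n. ennreal (exp (- ((norm z)\<^sup>2 / (8 * \<sigma>\<^sup>2))))"
    have [measurable]: "(\<lambda>z::real^'n. exp (- ((norm z)\<^sup>2 / (8 * \<sigma>\<^sup>2)))) \<in> borel_measurable lebesgue"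
      by (intro measurable_completion) simp
    have [measurable]: "ball (0::real^'n) \<sigma> \<in> sets lebesgue" by simp
    have sets [measurable]: "{z::real^'n. \<sigma> \<le> norm z} \<in> sets lebesgue"
    proof -
      have "{z::real^'n. \<sigma> \<le> norm z} = - ball 0 \<sigma>" by auto
      then show ?thesis by (simp add: Compl_eq_Diff_UNIV)
    qed
    have outer: "(\<integral>\<^sup>+z\<in>{z. \<sigma> \<le> norm z}. ?h z \<partial>lebesgue) \<le> ennreal ((D * \<sigma> powr (2 * ?n)) * \<sigma> powr (- ?n) / (1 - 2 powr (- ?n)))"
    proof (rule nn_integral_outside_ball)
      fix R assume "\<sigma> \<le> R"
      then have R: "R > 0" using \<sigma> by simp
      let ?s = "R\<^sup>2 / (8 * \<sigma>\<^sup>2)"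
      have s: "?s > 0" using R \<sigma> by simp
      have "(?s / ?n) ^ CARD('n) \<le> exp (?s / ?n) ^ CARD('n)"
        
      proof (intro power_mono)
        show "?s / ?n \<le> exp (?s / ?n)" using exp_ge_add_one_self[of "?s / ?n"] by linarith
      qed (use s in simp)
      also have "\<dots> = exp ?s" by (simp add: exp_of_nat_mult[symmetric])
      finally have "(?s / ?n) ^ CARD('n) \<le> exp ?s" .
      note lower = this
      have e: "exp (- ?s) \<le> 1 / (?s / ?n) ^ CARD('n)"
      proof -
        have "1 / exp ?s \<le> 1 / (?s / ?n) ^ CARD('n)"
        proof (rule divide_left_mono[OF lower])
          show "0 < exp ?s * (?s / ?n) ^ CARD('n)"
            using s by (intro mult_pos_pos exp_gt_zero zero_less_power divide_pos_pos[OF s]) simp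
        qed simp
        then show ?thesis by (simp only: exp_minus inverse_eq_divide)
      qed
      have eq: "1 / (?s / ?n) ^ CARD('n) = (8 * ?n) powr ?n * \<sigma> powr (2 * ?n) * R powr (- (2 * ?n))"
      proof -
        have sq: "(x\<^sup>2) powr c = x powr (2 * c)" if "x > 0" for x c :: real
        proof -
          have "(x\<^sup>2) powr c = (x powr 2) powr c" using that by simp
          then show ?thesis by (simp only: powr_powr)
        qed
        have ns: "1 / (?s / ?n) = 8 * ?n * \<sigma>\<^sup>2 / R\<^sup>2" using R \<sigma> by simp
        have "1 / (?s / ?n) ^ CARD('n) = (1 / (?s / ?n)) ^ CARD('n)" by (simp only: power_one_over)
        also have "\<dots> = (8 * ?n * \<sigma>\<^sup>2 / R\<^sup>2) powr ?n"
          unfolding ns using R \<sigma> by (intro powr_realpow[symmetric]) auto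
        also have "\<dots> = (8 * ?n) powr ?n * (\<sigma>\<^sup>2) powr ?n * (R\<^sup>2) powr (- ?n)"
          using R \<sigma> by (simp add: powr_mult powr_divide powr_minus_divide)
        also have "(\<sigma>\<^sup>2) powr ?n = \<sigma> powr (2 * ?n)" by (rule sq[OF \<sigma>])
        also have "(R\<^sup>2) powr (- ?n) = R powr (2 * - ?n)" by (rule sq[OF R])
        also have "2 * - ?n = - (2 * ?n)" by simp
        finally show ?thesis .
      qed
      have "(\<integral>\<^sup>+z\<in>dyadic_ring R. ?h z \<partial>lebesgue) \<le> (\<integral>\<^sup>+z. ennreal (exp (- ?s)) * indicator (dyadic_ring R :: (real^'n) set) z \<partial>lebesgue)"
      proof (intro nn_integral_mono)
        fix z :: "real^'n"
        show "?h z * indicator (dyadic_ring R) z \<le> ennreal (exp (- ?s)) * indicator (dyadic_ring R) z"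
          using R \<sigma> by (auto simp: indicator_def intro!: ennreal_leI divide_right_mono power_mono)
      qed
      also have "\<dots> = ennreal (exp (- ?s)) * emeasure lebesgue (dyadic_ring R :: (real^'n) set)"
        by (rule nn_integral_cmult_indicator) simp
      also have "\<dots> \<le> ennreal ((8 * ?n) powr ?n * \<sigma> powr (2 * ?n) * R powr (- (2 * ?n))) * ennreal (V * (4 * R) powr ?n)"
        unfolding V_def using e eq emeasure_dyadic_ring_le[OF R] by (intro mult_mono ennreal_leI) auto
      also have "\<dots> = ennreal (((8 * ?n) powr ?n * \<sigma> powr (2 * ?n) * R powr (- (2 * ?n))) * (V * (4 * R) powr ?n))"
        using V by (intro ennreal_mult[symmetric]) auto
      also have "((8 * ?n) powr ?n * \<sigma> powr (2 * ?n) * R powr (- (2 * ?n))) * (V * (4 * R) powr ?n) =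
         D * \<sigma> powr (2 * ?n) * (R powr (- (2 * ?n)) * R powr ?n)"
        using R by (simp add: D_def powr_mult)
      also have "R powr (- (2 * ?n)) * R powr ?n = R powr (- ?n)" by (simp add: powr_add[symmetric])
      finally show "(\<integral>\<^sup>+z\<in>dyadic_ring R. ?h z \<partial>lebesgue) \<le> ennreal (D * \<sigma> powr (2 * ?n) * R powr (- ?n))" .
    qed (use \<sigma> D in simp_all)
    have inner: "(\<integral>\<^sup>+z. 1 * indicator (ball (0::real^'n) \<sigma>) z \<partial>lebesgue) = ennreal (V * \<sigma> powr ?n)"
      using emeasure_ball[of \<sigma> "0::real^'n"] \<sigma> by (simp add: emeasure_completion V_def powr_realpow)
    have "(\<integral>\<^sup>+z. ?h z \<partial>lebesgue) \<le> (\<integral>\<^sup>+z. 1 * indicator (ball 0 \<sigma>) z + ?h z * indicator {z. \<sigma> \<le> norm z} z \<partial>lebesgue)"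
      by (intro nn_integral_mono) (auto simp: indicator_def)
    also have "\<dots> = (\<integral>\<^sup>+z. 1 * indicator (ball (0::real^'n) \<sigma>) z \<partial>lebesgue) + (\<integral>\<^sup>+z\<in>{z. \<sigma> \<le> norm z}. ?h z \<partial>lebesgue)"
      by (rule nn_integral_add) auto
    also have "\<dots> \<le> ennreal (V * \<sigma> powr ?n) + ennreal ((D * \<sigma> powr (2 * ?n)) * \<sigma> powr (- ?n) / (1 - 2 powr (- ?n)))"
      unfolding inner by (intro add_left_mono outer)
    also have "\<dots> = ennreal (V * \<sigma> powr ?n + (D * \<sigma> powr (2 * ?n)) * \<sigma> powr (- ?n) / (1 - 2 powr (- ?n)))"
      using V D two by (intro ennreal_plus[symmetric]) auto
    also have "(D * \<sigma> powr (2 * ?n)) * \<sigma> powr (- ?n) = D * \<sigma> powr ?n" by (simp add: powr_add[symmetric])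
    also have "V * \<sigma> powr ?n + D * \<sigma> powr ?n / (1 - 2 powr (- ?n)) = (V + D / (1 - 2 powr (- ?n))) * \<sigma> powr ?n"
      by (simp add: distrib_right)
    also have "ennreal \<dots> \<le> ennreal (G * \<sigma> powr ?n)" unfolding G_def by (intro ennreal_leI mult_right_mono) auto
    finally show ?thesis .
  qed
  then show ?thesis using G by blast
qed

lemma nn_integral_gauss_translate:
  fixes z :: "real^'n"
  assumes G: "(\<integral>\<^sup>+z. ennreal (exp (- ((norm (z::real^'n))\<^sup>2 / c))) \<partial>lborel) \<le> G"
  shows "(\<integral>\<^sup>+x. ennreal (exp (- ((norm (x - z))\<^sup>2 / c))) \<partial>lborel) \<le> G"
    "(\<integral>\<^sup>+y. ennreal (exp (- ((norm (z - y))\<^sup>2 / c))) \<partial>lborel) \<le> G"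
proof -
  have "(\<integral>\<^sup>+x. ennreal (exp (- ((norm (x - z))\<^sup>2 / c))) \<partial>lborel) =
     (\<integral>\<^sup>+x. ennreal (exp (- ((norm (x - z))\<^sup>2 / c))) \<partial>distr lborel borel ((+) z))"
    by (simp add: lborel_distr_plus)
  also have "\<dots> = (\<integral>\<^sup>+x. ennreal (exp (- ((norm (x::real^'n))\<^sup>2 / c))) \<partial>lborel)"
    by (subst nn_integral_distr) auto
  finally show *: "(\<integral>\<^sup>+x. ennreal (exp (- ((norm (x - z))\<^sup>2 / c))) \<partial>lborel) \<le> G" using G by simp
  then show "(\<integral>\<^sup>+y. ennreal (exp (- ((norm (z - y))\<^sup>2 / c))) \<partial>lborel) \<le> G"
    by (simp add: norm_minus_commute)
qed

lemma nn_integral_gauss_convolution: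
  fixes g :: "real^'n \<Rightarrow> real"
  assumes [measurable]: "g \<in> borel_measurable borel"
    and G: "(\<integral>\<^sup>+z. ennreal (exp (- ((norm (z::real^'n))\<^sup>2 / c))) \<partial>lborel) \<le> G"
    and g: "\<And>y. 0 \<le> g y"
  shows "(\<integral>\<^sup>+x. \<integral>\<^sup>+y. ennreal (exp (- ((norm (x - y))\<^sup>2 / c)) * g y) \<partial>lborel \<partial>lborel)
    \<le> G * (\<integral>\<^sup>+y. ennreal (g y) \<partial>lborel)"
proof -
  have "(\<integral>\<^sup>+x. \<integral>\<^sup>+y. ennreal (exp (- ((norm (x - y))\<^sup>2 / c)) * g y) \<partial>lborel \<partial>lborel) =
     (\<integral>\<^sup>+y. \<integral>\<^sup>+x. ennreal (exp (- ((norm (x - y))\<^sup>2 / c)) * g y) \<partial>lborel \<partial>lborel)"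
    by (intro lborel_pair.Fubini') simp
  also have "\<dots> = (\<integral>\<^sup>+y. (\<integral>\<^sup>+x. ennreal (exp (- ((norm (x - y))\<^sup>2 / c))) \<partial>lborel) * ennreal (g y) \<partial>lborel)"
    using g by (simp add: ennreal_mult nn_integral_multc)
  also have "\<dots> \<le> (\<integral>\<^sup>+y. G * ennreal (g y) \<partial>lborel)"
    by (intro nn_integral_mono mult_right_mono nn_integral_gauss_translate G) auto
  also have "\<dots> = G * (\<integral>\<^sup>+y. ennreal (g y) \<partial>lborel)" by (rule nn_integral_cmult) simp
  finally show ?thesis .
qed

lemma epowr_add_le:
  assumes "0 \<le> a"
  shows "(x + y) epowr a \<le> ennreal (2 powr a) * (x epowr a + y epowr a)"
proof (cases "x = top \<or> y = top")
  case True
  then show ?thesis by (auto simp: epowr_def ennreal_mult_top)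
next
  case False
  then obtain u v where uv: "x = ennreal u" "y = ennreal v" "0 \<le> u" "0 \<le> v"
    by (metis ennreal_cases)
  have "(u + v) powr a \<le> (2 * max u v) powr a" using uv assms by (intro powr_mono2) auto
  also have "\<dots> = 2 powr a * max u v powr a" using uv by (simp add: powr_mult)
  also have "\<dots> \<le> 2 powr a * (u powr a + v powr a)" by (intro mult_left_mono) (auto simp: max_def)
  finally show ?thesis unfolding uv using uv(3,4)
    by (simp add: ennreal_epowr ennreal_mult[symmetric] ennreal_plus[symmetric] ennreal_leI del: ennreal_plus)
qed

text \<open>
  Split \<open>g\<close> at radius \<open>\<sigma>\<close>. The inner part \<open>g1\<close> is integrable and the Gaussian is at most 1, so \<open>v1\<close> is bounded by the
  integral of \<open>g1\<close> and integrable, hence in \<open>L\<^sup>a\<close>. For the outer part the power mean inequality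
  bounds \<open>v2\<^sup>a\<close> by the convolution of the Gaussian with \<open>g2\<^sup>a\<close>, times a power of the mass \<open>G \<sigma>\<^sup>n\<close> of the Gaussian. The
  exponents in the two hypotheses are those for which both parts scale alike.
\<close>
lemma gauss_convolution_bounds:
  assumes a: "1 \<le> a"
  shows "\<exists>C>0. \<forall>(g :: real^'n \<Rightarrow> real) \<sigma> M e. g \<in> borel_measurable borel \<and> (\<forall>y. 0 \<le> g y) \<and> 0 < \<sigma> \<and> 0 < M \<and>
    (\<integral>\<^sup>+y\<in>{y. norm y < \<sigma>}. ennreal (g y) \<partial>lborel) \<le> ennreal (M * \<sigma> powr e) \<and>
    (\<integral>\<^sup>+y\<in>{y. \<sigma> \<le> norm y}. ennreal (g y powr a) \<partial>lborel) \<le> ennreal (M powr a * \<sigma> powr (a * e - a * real CARD('n) + real CARD('n))) \<longrightarrow>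
    (\<forall>x. (\<integral>\<^sup>+y. ennreal (exp (- ((norm (x - y))\<^sup>2 / (8 * \<sigma>\<^sup>2))) * g y) \<partial>lborel) \<le> ennreal (C * M * \<sigma> powr e)) \<and>
    (\<integral>\<^sup>+x. (\<integral>\<^sup>+y. ennreal (exp (- ((norm (x - y))\<^sup>2 / (8 * \<sigma>\<^sup>2))) * g y) \<partial>lborel) epowr a \<partial>lborel)
      \<le> ennreal (C * M powr a * \<sigma> powr (a * e + real CARD('n)))"
proof -
  let ?n = "real CARD('n)"
  obtain G where G1: "G \<ge> 1" and G: "\<And>\<sigma>. 0 < \<sigma> \<Longrightarrow> (\<integral>\<^sup>+z. ennreal (exp (- ((norm (z::real^'n))\<^sup>2 / (8 * \<sigma>\<^sup>2)))) \<partial>lborel) \<le> ennreal (G * \<sigma> powr ?n)"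
    using gaussian_integral_bound unfolding nn_integral_completion by blast
  define C where "C = (1 + G powr (1 - 1/a)) + 2 powr a * (G + G powr a)"
  have C: "C > 0" using G1 by (auto simp: C_def intro!: add_pos_pos mult_pos_pos)
  have C': "1 + G powr (1 - 1/a) \<le> C" "2 powr a * (G + G powr a) \<le> C"
    using G1 by (auto simp: C_def intro!: add_nonneg_nonneg)
  show ?thesis
  proof (intro exI[of _ C] conjI C allI impI; elim conjE)
    fix g :: "real^'n \<Rightarrow> real" and \<sigma> M e
    assume [measurable]: "g \<in> borel_measurable borel" and g: "\<forall>y. 0 \<le> g y" and \<sigma>: "0 < \<sigma>" and M: "0 < M"
      and inner: "(\<integral>\<^sup>+y\<in>{y. norm y < \<sigma>}. ennreal (g y) \<partial>lborel) \<le> ennreal (M * \<sigma> powr e)"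
      and outer: "(\<integral>\<^sup>+y\<in>{y. \<sigma> \<le> norm y}. ennreal (g y powr a) \<partial>lborel) \<le> ennreal (M powr a * \<sigma> powr (a * e - a * ?n + ?n))"
    let ?E = "\<lambda>x y. exp (- ((norm (x - y :: real^'n))\<^sup>2 / (8 * \<sigma>\<^sup>2)))"
    define g1 where "g1 = (\<lambda>y. g y * indicator {y. norm y < \<sigma>} y)"
    define g2 where "g2 = (\<lambda>y. g y * indicator {y. \<sigma> \<le> norm y} y)"
    have [measurable]: "g1 \<in> borel_measurable borel" "g2 \<in> borel_measurable borel"
      by (simp_all add: g1_def g2_def)
    have g0: "0 \<le> g1 y" "0 \<le> g2 y" "0 \<le> g2 y powr a" for y using g by (auto simp: g1_def g2_def)
    have g1: "(\<integral>\<^sup>+y. ennreal (g1 y) \<partial>lborel) \<le> ennreal (M * \<sigma> powr e)"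
      using inner g by (simp add: g1_def ennreal_mult ennreal_indicator)
    have "g2 y powr a = g y powr a * indicator {y. \<sigma> \<le> norm y} y" for y using a by (simp add: g2_def indicator_def)
    then have g2: "(\<integral>\<^sup>+y. ennreal (g2 y powr a) \<partial>lborel) \<le> ennreal (M powr a * \<sigma> powr (a * e - a * ?n + ?n))"
      using outer by (simp add: ennreal_mult ennreal_indicator)
    define v1 where "v1 = (\<lambda>x. \<integral>\<^sup>+y. ennreal (?E x y * g1 y) \<partial>lborel)"
    define v2 where "v2 = (\<lambda>x. \<integral>\<^sup>+y. ennreal (?E x y * g2 y) \<partial>lborel)"
    have [measurable]: "v1 \<in> borel_measurable borel" "v2 \<in> borel_measurable borel"
      unfolding v1_def v2_def by simp_all
    have v: "(\<integral>\<^sup>+y. ennreal (?E x y * g y) \<partial>lborel) = v1 x + v2 x" for x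
    proof -
      have "(\<integral>\<^sup>+y. ennreal (?E x y * g y) \<partial>lborel) = (\<integral>\<^sup>+y. ennreal (?E x y * g1 y) + ennreal (?E x y * g2 y) \<partial>lborel)"
        by (intro nn_integral_cong) (auto simp: g1_def g2_def indicator_def)
      also have "\<dots> = v1 x + v2 x" unfolding v1_def v2_def by (rule nn_integral_add) auto
      finally show ?thesis .
    qed
    let ?S = "M * \<sigma> powr e"
    have S: "?S > 0" using M \<sigma> by simp
    have v1: "v1 x \<le> ennreal ?S" for x
    proof -
      have "v1 x \<le> (\<integral>\<^sup>+y. ennreal (g1 y) \<partial>lborel)"
        unfolding v1_def using g0 by (intro nn_integral_mono ennreal_leI mult_left_le_one_le) auto
      then show ?thesis using g1 by (rule order_trans)
    qed
    \<comment> \<open>The bounded factor \<open>v1\<^sup>a\<^sup>-\<^sup>1\<close> is taken out, and \<open>v1\<close> itself is integrable by Tonelli.\<close>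
    have "v1 x epowr a \<le> ennreal (?S powr (a - 1)) * v1 x" for x
    proof -
      obtain u where u: "v1 x = ennreal u" "0 \<le> u" using v1[of x] by (cases "v1 x") (auto simp: top_unique)
      have "u \<le> ?S" using v1[of x] S u by simp
      then have "u powr (a - 1) * u powr 1 \<le> ?S powr (a - 1) * u powr 1" using a u by (intro mult_right_mono powr_mono2) auto
      then have "u powr a \<le> ?S powr (a - 1) * u" unfolding powr_add[symmetric] using u by simp
      then show ?thesis unfolding u(1) using u(2) S by (simp add: ennreal_epowr ennreal_mult[symmetric] ennreal_leI)
    qed
    then have "(\<integral>\<^sup>+x. v1 x epowr a \<partial>lborel) \<le> (\<integral>\<^sup>+x. ennreal (?S powr (a - 1)) * v1 x \<partial>lborel)"
      by (rule nn_integral_mono)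
    also have "\<dots> = ennreal (?S powr (a - 1)) * (\<integral>\<^sup>+x. v1 x \<partial>lborel)" by (rule nn_integral_cmult) simp
    also have "\<dots> \<le> ennreal (?S powr (a - 1)) * (ennreal (G * \<sigma> powr ?n) * ennreal ?S)"
    proof (intro mult_left_mono)
      have "(\<integral>\<^sup>+x. v1 x \<partial>lborel) \<le> ennreal (G * \<sigma> powr ?n) * (\<integral>\<^sup>+y. ennreal (g1 y) \<partial>lborel)"
        unfolding v1_def by (rule nn_integral_gauss_convolution) (use G \<sigma> g0 in auto)
      also have "\<dots> \<le> ennreal (G * \<sigma> powr ?n) * ennreal ?S" by (intro mult_left_mono g1) auto
      finally show "(\<integral>\<^sup>+x. v1 x \<partial>lborel) \<le> ennreal (G * \<sigma> powr ?n) * ennreal ?S" .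
    qed auto
    also have "\<dots> = ennreal (?S powr (a - 1) * (G * \<sigma> powr ?n * ?S))"
      using G1 S by (simp add: ennreal_mult[symmetric])
    also have "?S powr (a - 1) * (G * \<sigma> powr ?n * ?S) = G * M powr a * \<sigma> powr (a * e + ?n)"
    proof -
      have "?S powr (a - 1) * (G * \<sigma> powr ?n * ?S) = G * \<sigma> powr ?n * (?S powr (a - 1) * ?S powr 1)" using S by simp
      also have "?S powr (a - 1) * ?S powr 1 = M powr a * \<sigma> powr (a * e)"
        unfolding powr_add[symmetric] using M \<sigma> by (simp add: powr_mult powr_powr mult.commute)
      finally show ?thesis by (simp add: powr_add)
    qed
    finally have V1: "(\<integral>\<^sup>+x. v1 x epowr a \<partial>lborel) \<le> ennreal (G * M powr a * \<sigma> powr (a * e + ?n))" .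
    let ?W = "G * \<sigma> powr ?n"
    have W: "?W > 0" using G1 \<sigma> by simp
    have v2': "v2 x epowr a \<le> ennreal (?W powr (a - 1)) * (\<integral>\<^sup>+y. ennreal (?E x y * g2 y powr a) \<partial>lborel)" for x
      unfolding v2_def
    proof (rule nn_integral_power_mean)
      show "(\<integral>\<^sup>+y. ennreal (?E x y) \<partial>lborel) \<le> ennreal ?W"
        by (rule nn_integral_gauss_translate(2)) (rule G[OF \<sigma>])
    qed (use a W g0 in auto)
    have pw: "M powr a * \<sigma> powr (a * e - a * ?n + ?n) * ?W powr (a - 1) = G powr (a - 1) * (M * \<sigma> powr e) powr a"
    proof -
      have "M powr a * \<sigma> powr (a * e - a * ?n + ?n) * ?W powr (a - 1) =
         G powr (a - 1) * M powr a * (\<sigma> powr (a * e - a * ?n + ?n) * \<sigma> powr (?n * (a - 1)))"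
        using G1 \<sigma> by (simp add: powr_mult powr_powr)
      also have "\<sigma> powr (a * e - a * ?n + ?n) * \<sigma> powr (?n * (a - 1)) = \<sigma> powr (e * a)"
        unfolding powr_add[symmetric] by (simp add: algebra_simps)
      finally show ?thesis using M \<sigma> by (simp add: powr_mult powr_powr)
    qed
    have v2: "v2 x \<le> ennreal (G powr (1 - 1/a) * ?S)" for x
    proof -
      have "(\<integral>\<^sup>+y. ennreal (?E x y * g2 y powr a) \<partial>lborel) \<le> (\<integral>\<^sup>+y. ennreal (g2 y powr a) \<partial>lborel)"
        using g0 by (intro nn_integral_mono ennreal_leI mult_left_le_one_le) auto
      note order_trans[OF this g2]
      then have "v2 x epowr a \<le> ennreal (?W powr (a - 1)) * ennreal (M powr a * \<sigma> powr (a * e - a * ?n + ?n))"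
        by (intro order_trans[OF v2'] mult_left_mono) auto
      also have "\<dots> = ennreal (M powr a * \<sigma> powr (a * e - a * ?n + ?n) * ?W powr (a - 1))"
        by (simp add: ennreal_mult[symmetric] mult.commute)
      finally have "v2 x \<le> ennreal ((G powr (a - 1) * ?S powr a) powr (1/a))"
        unfolding pw using a by (subst (asm) epowr_le_iff) auto
      also have "(G powr (a - 1) * ?S powr a) powr (1/a) = G powr (1 - 1/a) * ?S"
        using a M G1 by (simp add: powr_mult powr_powr diff_divide_distrib)
      finally show ?thesis .
    qed
    have "(\<integral>\<^sup>+x. v2 x epowr a \<partial>lborel) \<le> (\<integral>\<^sup>+x. ennreal (?W powr (a - 1)) * (\<integral>\<^sup>+y. ennreal (?E x y * g2 y powr a) \<partial>lborel) \<partial>lborel)"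
      by (intro nn_integral_mono v2')
    also have "\<dots> = ennreal (?W powr (a - 1)) * (\<integral>\<^sup>+x. \<integral>\<^sup>+y. ennreal (?E x y * g2 y powr a) \<partial>lborel \<partial>lborel)"
      by (rule nn_integral_cmult) simp
    also have "\<dots> \<le> ennreal (?W powr (a - 1)) * (ennreal ?W * ennreal (M powr a * \<sigma> powr (a * e - a * ?n + ?n)))"
    proof (intro mult_left_mono)
      have "(\<integral>\<^sup>+x. \<integral>\<^sup>+y. ennreal (?E x y * g2 y powr a) \<partial>lborel \<partial>lborel) \<le> ennreal ?W * (\<integral>\<^sup>+y. ennreal (g2 y powr a) \<partial>lborel)"
        by (rule nn_integral_gauss_convolution) (use G \<sigma> in auto)
      also have "\<dots> \<le> ennreal ?W * ennreal (M powr a * \<sigma> powr (a * e - a * ?n + ?n))"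
        by (intro mult_left_mono g2) auto
      finally show "(\<integral>\<^sup>+x. \<integral>\<^sup>+y. ennreal (?E x y * g2 y powr a) \<partial>lborel \<partial>lborel) \<le> \<dots>" .
    qed auto
    also have "\<dots> = ennreal (?W powr (a - 1) * (?W * (M powr a * \<sigma> powr (a * e - a * ?n + ?n))))"
      using less_imp_le[OF W] by (simp only: ennreal_mult mult_nonneg_nonneg powr_ge_zero)
    also have "?W powr (a - 1) * (?W * (M powr a * \<sigma> powr (a * e - a * ?n + ?n))) = M powr a * \<sigma> powr (a * e - a * ?n + ?n) * ?W powr (a - 1) * ?W"
      by (simp only: mult_ac)
    also have "M powr a * \<sigma> powr (a * e - a * ?n + ?n) * ?W powr (a - 1) * ?W = G powr a * M powr a * \<sigma> powr (a * e + ?n)"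
    proof -
      have "M powr a * \<sigma> powr (a * e - a * ?n + ?n) * ?W powr (a - 1) * ?W = G powr (a - 1) * (M * \<sigma> powr e) powr a * ?W"
        unfolding pw ..
      also have "\<dots> = (G powr (a - 1) * G powr 1) * M powr a * (\<sigma> powr (e * a) * \<sigma> powr ?n)"
        using M \<sigma> G1 by (simp add: powr_mult powr_powr)
      also have "G powr (a - 1) * G powr 1 = G powr a" unfolding powr_add[symmetric] by simp
      also have "\<sigma> powr (e * a) * \<sigma> powr ?n = \<sigma> powr (a * e + ?n)" unfolding powr_add[symmetric] by (simp add: mult.commute)
      finally show ?thesis .
    qed
    finally have V2: "(\<integral>\<^sup>+x. v2 x epowr a \<partial>lborel) \<le> ennreal (G powr a * M powr a * \<sigma> powr (a * e + ?n))" .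
    show "(\<integral>\<^sup>+y. ennreal (?E x y * g y) \<partial>lborel) \<le> ennreal (C * M * \<sigma> powr e)" for x
    proof -
      have "v1 x + v2 x \<le> ennreal ?S + ennreal (G powr (1 - 1/a) * ?S)" by (intro add_mono v1 v2)
      also have "\<dots> = ennreal ((1 + G powr (1 - 1/a)) * ?S)"
        using S by (subst ennreal_plus[symmetric]) (auto simp: distrib_right)
      also have "\<dots> \<le> ennreal (C * ?S)" using C' S by (intro ennreal_leI mult_right_mono) auto
      finally show ?thesis unfolding v by (simp add: mult.assoc)
    qed
    have [measurable]: "(\<lambda>x. v1 x epowr a) \<in> borel_measurable borel" "(\<lambda>x. v2 x epowr a) \<in> borel_measurable borel"
      unfolding epowr_def by simp_all
    have "(\<integral>\<^sup>+x. (v1 x + v2 x) epowr a \<partial>lborel) \<le> (\<integral>\<^sup>+x. ennreal (2 powr a) * (v1 x epowr a + v2 x epowr a) \<partial>lborel)"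
      using a by (intro nn_integral_mono epowr_add_le) auto
    also have "\<dots> = ennreal (2 powr a) * ((\<integral>\<^sup>+x. v1 x epowr a \<partial>lborel) + (\<integral>\<^sup>+x. v2 x epowr a \<partial>lborel))"
      by (simp add: nn_integral_cmult nn_integral_add)
    also have "\<dots> \<le> ennreal (2 powr a) * (ennreal (G * M powr a * \<sigma> powr (a * e + ?n)) + ennreal (G powr a * M powr a * \<sigma> powr (a * e + ?n)))"
      by (intro mult_left_mono add_mono V1 V2) auto
    also have "\<dots> = ennreal (2 powr a * (G * M powr a * \<sigma> powr (a * e + ?n) + G powr a * M powr a * \<sigma> powr (a * e + ?n)))"
      using G1 by (subst ennreal_plus[symmetric]) (auto simp del: ennreal_plus simp: ennreal_mult[symmetric])
    also have "2 powr a * (G * M powr a * \<sigma> powr (a * e + ?n) + G powr a * M powr a * \<sigma> powr (a * e + ?n)) =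
      2 powr a * (G + G powr a) * (M powr a * \<sigma> powr (a * e + ?n))" by (simp only: distrib_left distrib_right mult.assoc)
    also have "\<dots> \<le> ennreal (C * (M powr a * \<sigma> powr (a * e + ?n)))" using C' by (intro ennreal_leI mult_right_mono) auto
    finally show "(\<integral>\<^sup>+x. (\<integral>\<^sup>+y. ennreal (?E x y * g y) \<partial>lborel) epowr a \<partial>lborel) \<le> ennreal (C * M powr a * \<sigma> powr (a * e + ?n))"
      unfolding v by (simp only: mult.assoc)
  qed
qed

section \<open>Morrey, Lebesgue and Lorentz norms\<close>

text \<open>
  For finite \<open>r\<close> the integral over the radii between \<open>\<rho>\<close> and \<open>2\<rho>\<close> alone already controls the value at \<open>\<rho>\<close>: the
  integral over the ball increases with the radius, and the power of the radius changes by a bounded factor.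
\<close>
lemma Morrey_norm_central:
  fixes p q :: real and r :: ennreal
  assumes q: "1 \<le> q" "q \<le> p" and r: "1 \<le> r"
  shows "\<exists>C>0. \<forall>(f :: real^'n \<Rightarrow> complex) M. f \<in> borel_measurable lebesgue \<and> 0 < M \<and> Morrey_norm p q r f \<le> ennreal M \<longrightarrow>
     central_morrey_bound p q (C * M) f"
proof -
  let ?n = "real CARD('n)"
  let ?F = "\<lambda>(f :: real^'n \<Rightarrow> complex) \<rho>. \<integral>\<^sup>+y\<in>ball 0 \<rho>. ennreal (norm (f y) powr q) \<partial>lebesgue"
  let ?\<phi> = "\<lambda>(f :: real^'n \<Rightarrow> complex) x \<rho>. ennreal (\<rho> powr (?n / p - ?n / q)) * (\<integral>\<^sup>+y\<in>ball x \<rho>. ennreal (norm (f y) powr q) \<partial>lebesgue) epowr (1 / q)"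
  have np: "?n / p - ?n / q \<le> 0" using q by (simp add: frac_le)
  have central: "central_morrey_bound p q N f"
    if f: "f \<in> borel_measurable lebesgue" and N: "0 < N" and *: "\<And>\<rho>. 0 < \<rho> \<Longrightarrow> ?\<phi> f 0 \<rho> \<le> ennreal N" for f :: "real^'n \<Rightarrow> complex" and N
    unfolding central_morrey_bound_def
  proof (intro conjI f N allI impI)
    fix \<rho> :: real assume \<rho>: "0 < \<rho>"
    have "ennreal (\<rho> powr (?n / q - ?n / p)) * ?\<phi> f 0 \<rho> \<le> ennreal (\<rho> powr (?n / q - ?n / p)) * ennreal N"
      by (intro mult_left_mono *[OF \<rho>]) auto
    also have "ennreal (\<rho> powr (?n / q - ?n / p)) * ?\<phi> f 0 \<rho> = ennreal (\<rho> powr (?n / q - ?n / p) * \<rho> powr (?n / p - ?n / q)) * ?F f \<rho> epowr (1/q)"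
      by (simp add: ennreal_mult mult.assoc)
    also have "\<rho> powr (?n / q - ?n / p) * \<rho> powr (?n / p - ?n / q) = 1" using \<rho> by (simp add: powr_add[symmetric])
    also have "ennreal (\<rho> powr (?n / q - ?n / p)) * ennreal N = ennreal (N * \<rho> powr (?n / q - ?n / p))"
      using N by (simp add: ennreal_mult[symmetric] mult.commute)
    finally have "?F f \<rho> epowr (1/q) \<le> ennreal (N * \<rho> powr (?n / q - ?n / p))" by simp
    then have "?F f \<rho> \<le> ennreal ((N * \<rho> powr (?n / q - ?n / p)) powr (1 / (1 / q)))"
      using q N by (subst (asm) epowr_le_iff) auto
    also have "(N * \<rho> powr (?n / q - ?n / p)) powr (1 / (1 / q)) = N powr q * \<rho> powr (?n - ?n * q / p)"
    proof -
      have "(?n / q - ?n / p) * q = ?n - ?n * q / p" using q by (simp add: left_diff_distrib)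
      then show ?thesis using N by (simp add: powr_mult powr_powr)
    qed
    finally show "?F f \<rho> \<le> ennreal (N powr q * \<rho> powr (?n - ?n * q / p))" .
  qed
  show ?thesis
  proof (cases "r = top")
    case True
    have "central_morrey_bound p q (1 * M) f" if "f \<in> borel_measurable lebesgue" "0 < M" "Morrey_norm p q r f \<le> ennreal M" for f :: "real^'n \<Rightarrow> complex" and M
    proof -
      have "?\<phi> f 0 \<rho> \<le> ennreal M" if "0 < \<rho>" for \<rho>
      proof -
        have "?\<phi> f 0 \<rho> \<le> (SUP x. SUP \<rho>\<in>{0<..}. ?\<phi> f x \<rho>)"
          using that by (intro SUP_upper2[of 0] SUP_upper) auto
        also have "\<dots> = Morrey_norm p q r f" using True by (simp add: Morrey_norm_def)
        finally show ?thesis using \<open>Morrey_norm p q r f \<le> ennreal M\<close> by simp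
      qed
      then show ?thesis using central[of f M] that by simp
    qed
    then show ?thesis by (intro exI[of _ 1]) auto
  next
    case False
    define R where "R = enn2real r"
    have rR: "r = ennreal R" using False by (simp add: R_def less_top)
    have R: "1 \<le> R" using r unfolding rR by (simp add: ennreal_ge_1)
    define C where "C = 2 powr (1 / R) * 2 powr (?n / q - ?n / p)"
    have "central_morrey_bound p q (C * M) f" if f: "f \<in> borel_measurable lebesgue" and M: "0 < M" and norm: "Morrey_norm p q r f \<le> ennreal M" for f :: "real^'n \<Rightarrow> complex" and M
    proof (rule central[OF f])
      show "0 < C * M" using M by (simp add: C_def)
      fix \<rho> :: real assume \<rho>: "0 < \<rho>"
      have "(\<integral>\<^sup>+\<rho>\<in>{0<..}. (?\<phi> f 0 \<rho> epowr R) / ennreal \<rho> \<partial>lborel) epowr (1 / R) \<le> 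
         (SUP x. (\<integral>\<^sup>+\<rho>\<in>{0<..}. (?\<phi> f x \<rho> epowr R) / ennreal \<rho> \<partial>lborel) epowr (1 / R))"
        by (rule SUP_upper) simp
      also have "\<dots> = Morrey_norm p q r f" using False by (simp add: Morrey_norm_def R_def)
      also note norm
      finally have "(\<integral>\<^sup>+\<rho>\<in>{0<..}. (?\<phi> f 0 \<rho> epowr R) / ennreal \<rho> \<partial>lborel) \<le> ennreal (M powr (1 / (1 / R)))"
        using R M by (subst (asm) epowr_le_iff) auto
      then have int: "(\<integral>\<^sup>+\<rho>\<in>{0<..}. (?\<phi> f 0 \<rho> epowr R) / ennreal \<rho> \<partial>lborel) \<le> ennreal (M powr R)" by simp
      define c where "c = ennreal ((2 * \<rho>) powr (?n / p - ?n / q)) * ?F f \<rho> epowr (1 / q)"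
      have c: "c \<le> ?\<phi> f 0 \<rho>'" if "\<rho>' \<in> {\<rho>..2 * \<rho>}" for \<rho>'
        unfolding c_def
      proof (intro mult_mono epowr_mono)
        show "ennreal ((2 * \<rho>) powr (?n / p - ?n / q)) \<le> ennreal (\<rho>' powr (?n / p - ?n / q))"
          using that \<rho> np by (intro ennreal_leI powr_mono2') auto
        have "ball (0::real^'n) \<rho> \<subseteq> ball 0 \<rho>'" using that by (intro subset_ball) auto
        then show "?F f \<rho> \<le> ?F f \<rho>'"
          by (intro nn_integral_mono mult_left_mono) (auto simp: indicator_def)
      qed (use q in auto)
      \<comment> \<open>\<open>c\<close> bounds the integrand from below on the interval from \<open>\<rho>\<close> to \<open>2\<rho>\<close>, of length \<open>\<rho>\<close>.\<close>
      have "(c epowr R / ennreal (2 * \<rho>)) * ennreal \<rho> = (c epowr R / ennreal (2 * \<rho>)) * emeasure lborel {\<rho>..2 * \<rho>}"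
        using \<rho> by simp
      also have "\<dots> = (\<integral>\<^sup>+\<rho>'. (c epowr R / ennreal (2 * \<rho>)) * indicator {\<rho>..2 * \<rho>} \<rho>' \<partial>lborel)"
        by (rule nn_integral_cmult_indicator[symmetric]) simp
      also have "\<dots> \<le> (\<integral>\<^sup>+\<rho>\<in>{0<..}. (?\<phi> f 0 \<rho> epowr R) / ennreal \<rho> \<partial>lborel)"
      proof (intro nn_integral_mono)
        fix \<rho>' :: real
        show "(c epowr R / ennreal (2 * \<rho>)) * indicator {\<rho>..2 * \<rho>} \<rho>' \<le> (?\<phi> f 0 \<rho>' epowr R) / ennreal \<rho>' * indicator {0<..} \<rho>'"
        proof (cases "\<rho>' \<in> {\<rho>..2 * \<rho>}")
          case True
          have "c epowr R / ennreal (2 * \<rho>) \<le> ?\<phi> f 0 \<rho>' epowr R / ennreal \<rho>'"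
          proof -
            have "inverse (2 * \<rho>) \<le> inverse \<rho>'" using True \<rho> by (intro le_imp_inverse_le) auto
            then have "inverse (ennreal (2 * \<rho>)) \<le> inverse (ennreal \<rho>')"
              using True \<rho> by (simp only: inverse_ennreal mult_pos_pos zero_less_numeral) (simp add: inverse_ennreal ennreal_leI)
            then show ?thesis
              unfolding divide_ennreal_def using R c[OF True] by (intro mult_mono epowr_mono) auto
          qed
          then show ?thesis using True \<rho> by simp
        qed simp
      qed
      also note int
      finally have "c epowr R / ennreal (2 * \<rho>) * ennreal \<rho> \<le> ennreal (M powr R)" .
      then have "ennreal 2 * (c epowr R / ennreal (2 * \<rho>) * ennreal \<rho>) \<le> ennreal 2 * ennreal (M powr R)"
        by (rule mult_left_mono) simp
      also have "ennreal 2 * (c epowr R / ennreal (2 * \<rho>) * ennreal \<rho>) = c epowr R * (ennreal 2 * ennreal (1 / (2 * \<rho>)) * ennreal \<rho>)"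
        using \<rho> by (simp add: divide_ennreal_def inverse_ennreal inverse_eq_divide mult_ac)
      also have "ennreal 2 * ennreal (1 / (2 * \<rho>)) * ennreal \<rho> = ennreal (2 * (1 / (2 * \<rho>)) * \<rho>)"
      proof -
        have "ennreal (2 * (1 / (2 * \<rho>)) * \<rho>) = ennreal (2 * (1 / (2 * \<rho>))) * ennreal \<rho>"
          using \<rho> by (intro ennreal_mult) auto
        also have "ennreal (2 * (1 / (2 * \<rho>))) = ennreal 2 * ennreal (1 / (2 * \<rho>))"
          using \<rho> by (intro ennreal_mult) auto
        finally show ?thesis by (rule sym)
      qed
      also have "2 * (1 / (2 * \<rho>)) * \<rho> = 1" using \<rho> by simp
      also have "ennreal 2 * ennreal (M powr R) = ennreal (2 * M powr R)" by (simp only: ennreal_mult zero_le_numeral powr_ge_zero)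
      finally have "c epowr R \<le> ennreal (2 * M powr R)" by simp
      then have cM: "c \<le> ennreal ((2 * M powr R) powr (1 / R))"
        using R by (subst (asm) epowr_le_iff) auto
      have e: "(2 * M powr R) powr (1 / R) = 2 powr (1 / R) * M" using R M by (simp add: powr_mult powr_powr)
      have "?\<phi> f 0 \<rho> = ennreal (2 powr (?n / q - ?n / p)) * c"
      proof -
        have "\<rho> powr (?n / p - ?n / q) = 2 powr (?n / q - ?n / p) * (2 powr (?n / p - ?n / q) * \<rho> powr (?n / p - ?n / q))"
          by (simp add: mult.assoc[symmetric] powr_add[symmetric])
        then have "\<rho> powr (?n / p - ?n / q) = 2 powr (?n / q - ?n / p) * (2 * \<rho>) powr (?n / p - ?n / q)"
          using \<rho> by (simp add: powr_mult)
        then show ?thesis unfolding c_def by (simp add: ennreal_mult mult.assoc)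
      qed
      also have "\<dots> \<le> ennreal (2 powr (?n / q - ?n / p)) * ennreal (2 powr (1 / R) * M)"
        using cM unfolding e by (intro mult_left_mono) auto
      also have "\<dots> = ennreal (C * M)" using M by (simp add: C_def ennreal_mult[symmetric] mult_ac)
      finally show "?\<phi> f 0 \<rho> \<le> ennreal (C * M)" .
    qed
    then show ?thesis by (intro exI[of _ C]) (auto simp: C_def)
  qed
qed

lemma Lebesgue_norm_bounded:
  fixes h :: "real^'n \<Rightarrow> complex"
  assumes [measurable]: "h \<in> borel_measurable lebesgue"
    and S: "0 < S" "\<And>x. norm (h x) \<le> S" and A: "0 < A" "(\<integral>\<^sup>+x. ennreal (norm (h x) powr a) \<partial>lebesgue) \<le> ennreal A"
    and s: "0 < a" "a \<le> s"
  shows "Lebesgue_norm s h \<le> ennreal ((S powr (s - a) * A) powr (1 / s))"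
proof -
  have "(\<integral>\<^sup>+x. ennreal (norm (h x) powr s) \<partial>lebesgue) \<le> (\<integral>\<^sup>+x. ennreal (S powr (s - a)) * ennreal (norm (h x) powr a) \<partial>lebesgue)"
  proof (intro nn_integral_mono)
    fix x
    have "norm (h x) powr s = norm (h x) powr (s - a) * norm (h x) powr a" by (simp add: powr_add[symmetric])
    also have "\<dots> \<le> S powr (s - a) * norm (h x) powr a" using S s by (intro mult_right_mono powr_mono2) auto
    finally show "ennreal (norm (h x) powr s) \<le> ennreal (S powr (s - a)) * ennreal (norm (h x) powr a)"
      by (simp add: ennreal_mult[symmetric] ennreal_leI)
  qed
  also have "\<dots> = ennreal (S powr (s - a)) * (\<integral>\<^sup>+x. ennreal (norm (h x) powr a) \<partial>lebesgue)"
    by (rule nn_integral_cmult) simp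
  also have "\<dots> \<le> ennreal (S powr (s - a)) * ennreal A" by (intro mult_left_mono A) auto
  also have "\<dots> = ennreal (S powr (s - a) * A)" using A by (simp add: ennreal_mult)
  finally have "Lebesgue_norm s h \<le> ennreal (S powr (s - a) * A) epowr (1 / s)"
    unfolding Lebesgue_norm_def using s by (intro epowr_mono) auto
  then show ?thesis using A by (simp add: ennreal_epowr)
qed

text \<open>
  Chebyshev's inequality, together with the absence of levels above the supremum of \<open>h\<close>.
\<close>
lemma distribution_function_bounded:
  fixes h :: "real^'n \<Rightarrow> complex"
  assumes [measurable]: "h \<in> borel_measurable lebesgue"
    and S: "\<And>x. norm (h x) \<le> S" and A: "0 < A" "(\<integral>\<^sup>+x. ennreal (norm (h x) powr a) \<partial>lebesgue) \<le> ennreal A"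
    and s: "0 < a" "0 < s" and l: "0 < l"
  shows "ennreal l * Lebesgue_norm s (indicat_real {x. norm (h x) > l})
    \<le> ennreal (A powr (1 / s) * l powr (1 - a / s)) * indicator {..S} l"
proof (cases "l \<le> S")
  case False
  have "norm (h x) \<le> l" for x using S[of x] False by linarith
  then have "{x. norm (h x) > l} = {}" by (auto simp: not_less)
  then show ?thesis using s by (simp add: Lebesgue_norm_def epowr_def)
next
  case True
  have "(\<integral>\<^sup>+x. ennreal (norm (indicat_real {x. norm (h x) > l} x) powr s) \<partial>lebesgue)
     \<le> (\<integral>\<^sup>+x. ennreal (l powr - a) * ennreal (norm (h x) powr a) \<partial>lebesgue)"
  proof (intro nn_integral_mono)
    fix x
    show "ennreal (norm (indicat_real {x. norm (h x) > l} x) powr s) \<le> ennreal (l powr - a) * ennreal (norm (h x) powr a)"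
    proof (cases "norm (h x) > l")
      case True
      have "1 = l powr - a * l powr a" using l by (simp add: powr_add[symmetric])
      also have "\<dots> \<le> l powr - a * norm (h x) powr a" using True l s by (intro mult_left_mono powr_mono2) auto
      finally show ?thesis using True by (simp add: ennreal_mult[symmetric])
    qed (use s in simp)
  qed
  also have "\<dots> = ennreal (l powr - a) * (\<integral>\<^sup>+x. ennreal (norm (h x) powr a) \<partial>lebesgue)"
    by (rule nn_integral_cmult) simp
  also have "\<dots> \<le> ennreal (l powr - a) * ennreal A" by (intro mult_left_mono A) auto
  also have "\<dots> = ennreal (l powr - a * A)" using A by (simp add: ennreal_mult)
  finally have "Lebesgue_norm s (indicat_real {x. norm (h x) > l}) \<le> ennreal (l powr - a * A) epowr (1 / s)"
    unfolding Lebesgue_norm_def using s by (intro epowr_mono) auto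
  also have "\<dots> = ennreal (l powr (- a / s) * A powr (1 / s))"
    using A by (simp add: ennreal_epowr powr_mult powr_powr)
  finally have "ennreal l * Lebesgue_norm s (indicat_real {x. norm (h x) > l}) \<le> ennreal l * ennreal (l powr (- a / s) * A powr (1 / s))"
    by (rule mult_left_mono) simp
  also have "\<dots> = ennreal (A powr (1 / s) * (l powr 1 * l powr (- a / s)))"
    using l by (simp add: ennreal_mult[symmetric] mult_ac)
  also have "l powr 1 * l powr (- a / s) = l powr (1 - a / s)" unfolding powr_add[symmetric] by simp
  finally show ?thesis using True by simp
qed

text \<open>
  For finite \<open>r\<close> the level integral becomes that of \<open>l\<close> to the power \<open>\<beta> - 1\<close> over \<open>{0..S}\<close>, with
  \<open>\<beta> = r (1 - a/s) > 0\<close>; here \<open>a < s\<close> is essential.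
\<close>
lemma Lorentz_norm_bounded:
  fixes s a :: real and r :: ennreal
  assumes s: "0 < a" "a < s" and r: "1 \<le> r"
  shows "\<exists>C>0. \<forall>(h :: real^'n \<Rightarrow> complex) S A. h \<in> borel_measurable lebesgue \<and> 0 < S \<and> (\<forall>x. norm (h x) \<le> S) \<and>
     0 < A \<and> (\<integral>\<^sup>+x. ennreal (norm (h x) powr a) \<partial>lebesgue) \<le> ennreal A \<longrightarrow>
     Lorentz_norm s r h \<le> ennreal (C * (S powr (s - a) * A) powr (1 / s))"
proof -
  let ?\<phi> = "\<lambda>(h :: real^'n \<Rightarrow> complex) l. ennreal l * Lebesgue_norm s (indicat_real {x. norm (h x) > l})"
  have SA: "A powr (1 / s) * S powr (1 - a / s) = (S powr (s - a) * A) powr (1 / s)" if "0 < S" "0 < A" for S A :: real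
  proof -
    have "(s - a) / s = 1 - a / s" using s by (simp add: diff_divide_distrib)
    then show ?thesis using that by (simp add: powr_mult powr_powr mult.commute)
  qed
  show ?thesis
  proof (cases "r = top")
    case True
    have "Lorentz_norm s r h \<le> ennreal (1 * (S powr (s - a) * A) powr (1 / s))"
      if h: "h \<in> borel_measurable lebesgue" and S: "0 < S" "\<And>x. norm (h x) \<le> S" and A: "0 < A" "(\<integral>\<^sup>+x. ennreal (norm (h x) powr a) \<partial>lebesgue) \<le> ennreal A"
      for h :: "real^'n \<Rightarrow> complex" and S A
    proof -
      have "?\<phi> h l \<le> ennreal ((S powr (s - a) * A) powr (1 / s))" if l: "l \<in> {0<..}" for l
      proof -
        have "?\<phi> h l \<le> ennreal (A powr (1 / s) * l powr (1 - a / s)) * indicator {..S} l"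
          using l s by (intro distribution_function_bounded[OF h S(2) A]) auto
        also have "\<dots> \<le> ennreal (A powr (1 / s) * S powr (1 - a / s))"
          using l s by (auto simp: indicator_def intro!: ennreal_leI mult_left_mono powr_mono2)
        finally show ?thesis using SA[OF S(1) A(1)] by simp
      qed
      then show ?thesis using True by (auto simp: Lorentz_norm_def intro!: SUP_least)
    qed
    then show ?thesis by (intro exI[of _ 1]) auto
  next
    case False
    define R where "R = enn2real r"
    have rR: "r = ennreal R" using False by (simp add: R_def less_top)
    have R: "1 \<le> R" using r unfolding rR by (simp add: ennreal_ge_1)
    define \<beta> where "\<beta> = R * (1 - a / s)"
    have \<beta>: "\<beta> > 0" using R s by (simp add: \<beta>_def)
    define C where "C = (1 / \<beta>) powr (1 / R)"
    have "Lorentz_norm s r h \<le> ennreal (C * (S powr (s - a) * A) powr (1 / s))"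
      if h: "h \<in> borel_measurable lebesgue" and S: "0 < S" "\<And>x. norm (h x) \<le> S" and A: "0 < A" "(\<integral>\<^sup>+x. ennreal (norm (h x) powr a) \<partial>lebesgue) \<le> ennreal A"
      for h :: "real^'n \<Rightarrow> complex" and S A
    proof -
      let ?T = "A powr (R / s)"
      have T: "?T > 0" using A by simp
      have le: "(?\<phi> h l epowr R) / ennreal l * indicator {0<..} l \<le> ennreal ?T * ennreal (indicator {0..S} l * l powr (\<beta> - 1))" for l
      proof (cases "0 < l \<and> l \<le> S")
        case False
        have "?\<phi> h l \<le> 0" if "S < l" "0 < l"
          using distribution_function_bounded[OF h S(2) A, of s l] that s by simp
        then have "0 < l \<Longrightarrow> ?\<phi> h l epowr R = 0" using False R by (auto simp: epowr_def)
        then show ?thesis by (auto simp: indicator_def)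
      next
        case True
        then have l: "0 < l" "l \<le> S" by auto
        have "?\<phi> h l \<le> ennreal (A powr (1 / s) * l powr (1 - a / s))"
          using distribution_function_bounded[OF h S(2) A, of s l] l s by simp
        then have "?\<phi> h l epowr R \<le> ennreal (A powr (1 / s) * l powr (1 - a / s)) epowr R" using R by (intro epowr_mono) auto
        also have "\<dots> = ennreal (?T * l powr \<beta>)" using A by (simp add: ennreal_epowr powr_mult powr_powr \<beta>_def mult.commute)
        finally have "?\<phi> h l epowr R / ennreal l \<le> ennreal (?T * l powr \<beta>) / ennreal l" by (rule divide_right_mono_ennreal)
        also have "\<dots> = ennreal (?T * (l powr \<beta> / l))" using l by (simp add: divide_ennreal)
        also have "l powr \<beta> / l = l powr (\<beta> - 1)" using l by (simp add: powr_diff)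
        finally show ?thesis using l by (simp add: ennreal_mult)
      qed
      have hi: "((\<lambda>l. l powr (\<beta> - 1)) has_integral (S powr \<beta> / \<beta>)) {0..S}"
        using has_integral_powr_from_0[of "\<beta> - 1" S] \<beta> S by simp
      have "(\<integral>\<^sup>+l\<in>{0<..}. (?\<phi> h l epowr R) / ennreal l \<partial>lborel) \<le> (\<integral>\<^sup>+l. ennreal ?T * ennreal (indicator {0..S} l * l powr (\<beta> - 1)) \<partial>lborel)"
        by (intro nn_integral_mono le)
      also have "\<dots> = ennreal ?T * (\<integral>\<^sup>+l. ennreal (indicator {0..S} l * l powr (\<beta> - 1)) \<partial>lborel)"
        by (rule nn_integral_cmult) simp
      also have "(\<integral>\<^sup>+l. ennreal (indicator {0..S} l * l powr (\<beta> - 1)) \<partial>lborel) = ennreal (S powr \<beta> / \<beta>)"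
        using nn_integral_has_integral_lebesgue[OF _ hi] by (simp add: nn_integral_completion)
      also have "ennreal ?T * ennreal (S powr \<beta> / \<beta>) = ennreal (?T * (S powr \<beta> / \<beta>))"
        using \<beta> by (intro ennreal_mult[symmetric]) auto
      finally have "Lorentz_norm s r h \<le> ennreal (?T * (S powr \<beta> / \<beta>)) epowr (1 / R)"
        using False R by (auto simp: Lorentz_norm_def R_def[symmetric] intro!: epowr_mono)
      also have "\<dots> = ennreal ((?T * (S powr \<beta> / \<beta>)) powr (1 / R))" using \<beta> by (intro ennreal_epowr) auto
      also have "(?T * (S powr \<beta> / \<beta>)) powr (1 / R) = C * (A powr (1 / s) * S powr (1 - a / s))"
      proof -
        have "?T * (S powr \<beta> / \<beta>) = (1 / \<beta>) * (?T * S powr \<beta>)" by simp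
        moreover have "?T powr (1 / R) = A powr (1 / s)" "(S powr \<beta>) powr (1 / R) = S powr (1 - a / s)"
          using R by (simp_all add: powr_powr \<beta>_def)
        ultimately show ?thesis using \<beta> by (simp only: C_def powr_mult)
      qed
      finally show ?thesis using SA[OF S(1) A(1)] by simp
    qed
    moreover have "C > 0" using \<beta> by (simp add: C_def)
    ultimately show ?thesis by blast
  qed
qed

section \<open>The weighted heat semigroup\<close>

text \<open>
  Tonelli's theorem is applied on the Borel sets, where the product measure is well behaved; Lebesgue
  measurable functions are first replaced by Borel measurable ones.
\<close>
lemma borel_representative:
  fixes g :: "real^'n \<Rightarrow> complex"
  assumes g: "g \<in> borel_measurable lebesgue"
  obtains g' :: "real^'n \<Rightarrow> real" where "g' \<in> borel_measurable borel" "\<And>y. 0 \<le> g' y" "AE y in lborel. norm (g y) = g' y"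
proof -
  have "(\<lambda>y. norm (g y)) \<in> borel_measurable (completion lborel)" using g by simp
  then obtain g' where g': "g' \<in> borel_measurable lborel" "AE y in lborel. norm (g y) = g' y"
    using completion_ex_borel_measurable_real by blast
  show thesis
  proof
    show "(\<lambda>y. \<bar>g' y\<bar>) \<in> borel_measurable borel" using g'(1) by simp
    show "AE y in lborel. norm (g y) = \<bar>g' y\<bar>" using g'(2)
      by eventually_elim (metis abs_norm_cancel)
  qed simp
qed

text \<open>
  The exponent \<open>a\<close> has to satisfy \<open>n/a < n/p + \<gamma>\<close>, \<open>1 \<le> a\<close> and \<open>a < q\<close>. Both lower bounds for \<open>a\<close> lie strictly below
  \<open>q\<close>, the first by the lower bound on \<open>\<gamma>\<close>, so the midpoint between their maximum and \<open>q\<close> will do.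
\<close>
lemma weighted_gauss_bounds:
  fixes p q \<gamma> :: real
  assumes q: "1 < q" "q \<le> p" and \<gamma>: "0 < \<gamma>"
    and lo: "real CARD('n) / q - real CARD('n) / p < \<gamma>" and hi: "\<gamma> < real CARD('n) - real CARD('n) / p"
  shows "\<exists>a C. 1 \<le> a \<and> a < q \<and> 0 < C \<and> (\<forall>(f :: real^'n \<Rightarrow> complex) M t. central_morrey_bound p q M f \<and> 0 < t \<longrightarrow>
    (\<forall>x. (\<integral>\<^sup>+y. ennreal (exp (- ((norm (x - y))\<^sup>2 / (8 * t))) * norm (weighted \<gamma> f y)) \<partial>lebesgue)
       \<le> ennreal (C * M * t powr ((real CARD('n) - real CARD('n) / p - \<gamma>) / 2))) \<and>
    (\<integral>\<^sup>+x. (\<integral>\<^sup>+y. ennreal (exp (- ((norm (x - y))\<^sup>2 / (8 * t))) * norm (weighted \<gamma> f y)) \<partial>lebesgue) epowr a \<partial>lebesgue)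
       \<le> ennreal ((C * M) powr a * t powr ((a * (real CARD('n) - real CARD('n) / p - \<gamma>) + real CARD('n)) / 2)))"
proof -
  let ?n = "real CARD('n)"
  define e where "e = ?n - ?n / p - \<gamma>"
  have e: "e > 0" using hi by (simp add: e_def)
  have p: "0 < p" using q by simp
  have den: "0 < ?n / p + \<gamma>" using p \<gamma> by (simp add: add_nonneg_pos)
  define a where "a = (max 1 (?n / (?n / p + \<gamma>)) + q) / 2"
  have "?n / (?n / p + \<gamma>) < q" using lo q den by (simp add: field_simps)
  moreover have "1 \<le> (max 1 x + q) / 2 \<and> (max 1 x + q) / 2 < q \<and> x < (max 1 x + q) / 2" if "x < q" for x :: real
    using that q by (auto simp: max_def)
  ultimately have a: "1 \<le> a" "a < q" "?n / (?n / p + \<gamma>) < a" unfolding a_def by blast+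
  define d where "d = a * e - a * ?n + ?n"
  have dd: "a * (?n / a - ?n / p - \<gamma>) = d" using a by (simp add: d_def e_def algebra_simps)
  have d: "d < 0"
  proof -
    have "?n < a * (?n / p + \<gamma>)" using a(3) den by (simp add: pos_divide_less_eq)
    then show ?thesis by (simp add: d_def e_def algebra_simps)
  qed
  obtain C1 where C1: "C1 > 0" "\<And>(f :: real^'n \<Rightarrow> complex) M R. central_morrey_bound p q M f \<Longrightarrow> 0 < R \<Longrightarrow>
    (\<integral>\<^sup>+y\<in>dyadic_ring R. ennreal (norm (weighted \<gamma> f y) powr 1) \<partial>lebesgue) \<le> ennreal (C1 * M powr 1 * R powr (1 * (?n / 1 - ?n / p - \<gamma>)))"
    using weighted_ring_bound[of 1 q p \<gamma>, where 'n = 'n] q \<gamma> by auto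
  obtain C2 where C2: "C2 > 0" "\<And>(f :: real^'n \<Rightarrow> complex) M R. central_morrey_bound p q M f \<Longrightarrow> 0 < R \<Longrightarrow>
    (\<integral>\<^sup>+y\<in>dyadic_ring R. ennreal (norm (weighted \<gamma> f y) powr a) \<partial>lebesgue) \<le> ennreal (C2 * M powr a * R powr d)"
    using weighted_ring_bound[of a q p \<gamma>, where 'n = 'n] q \<gamma> a unfolding dd by auto
  have two: "2 powr - e < 1" "2 powr d < 1" using e d by (auto intro: powr_less_one)
  define K where "K = 1 + C1 / (1 - 2 powr - e) + C2 / (1 - 2 powr d)"
  have K0: "0 \<le> C1 / (1 - 2 powr - e)" "0 \<le> C2 / (1 - 2 powr d)" using C1(1) C2(1) two by auto
  have K: "1 \<le> K" "C1 / (1 - 2 powr - e) \<le> K" "C2 / (1 - 2 powr d) \<le> K" using K0 by (auto simp: K_def)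
  have Ka: "K \<le> K powr a" using K(1) a powr_mono[of 1 a K] by simp
  obtain C where C: "0 < C" and conv: "\<And>(g :: real^'n \<Rightarrow> real) \<sigma> M e. g \<in> borel_measurable borel \<Longrightarrow> (\<forall>y. 0 \<le> g y) \<Longrightarrow> 0 < \<sigma> \<Longrightarrow> 0 < M \<Longrightarrow>
    (\<integral>\<^sup>+y\<in>{y. norm y < \<sigma>}. ennreal (g y) \<partial>lborel) \<le> ennreal (M * \<sigma> powr e) \<Longrightarrow>
    (\<integral>\<^sup>+y\<in>{y. \<sigma> \<le> norm y}. ennreal (g y powr a) \<partial>lborel) \<le> ennreal (M powr a * \<sigma> powr (a * e - a * ?n + ?n)) \<Longrightarrow>
    (\<forall>x. (\<integral>\<^sup>+y. ennreal (exp (- ((norm (x - y))\<^sup>2 / (8 * \<sigma>\<^sup>2))) * g y) \<partial>lborel) \<le> ennreal (C * M * \<sigma> powr e)) \<and>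
    (\<integral>\<^sup>+x. (\<integral>\<^sup>+y. ennreal (exp (- ((norm (x - y))\<^sup>2 / (8 * \<sigma>\<^sup>2))) * g y) \<partial>lborel) epowr a \<partial>lborel)
      \<le> ennreal (C * M powr a * \<sigma> powr (a * e + ?n))"
    using gauss_convolution_bounds[OF a(1), where 'n = 'n] by blast
  \<comment> \<open>One constant that works, with its power \<open>a\<close>, for both bounds.\<close>
  define D where "D = (1 + C) * K"
  have D: "0 < D" using C K by (simp add: D_def)
  have D1: "C * K \<le> D" using K by (simp add: D_def algebra_simps)
  have Da: "C * K powr a \<le> D powr a"
  proof -
    have "C \<le> (1 + C) powr a" using powr_mono[of 1 a "1 + C"] C a by simp
    then have "C * K powr a \<le> (1 + C) powr a * K powr a" by (intro mult_right_mono) auto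
    then show ?thesis using C K by (simp add: D_def powr_mult)
  qed
  show ?thesis
  proof (rule exI[of _ a], rule exI[of _ D], intro conjI allI impI a D)
    fix f :: "real^'n \<Rightarrow> complex" and M t :: real
    assume "central_morrey_bound p q M f \<and> 0 < t"
    then have f: "central_morrey_bound p q M f" and t: "0 < t" by auto
    have M: "0 < M" and fm [measurable]: "f \<in> borel_measurable lebesgue" using f by (auto simp: central_morrey_bound_def)
    let ?g = "weighted \<gamma> f"
    have gm [measurable]: "?g \<in> borel_measurable lebesgue" by (rule weighted_measurable) simp
    have g0: "?g 0 = 0" by (simp add: weighted_def)
    obtain g' where g': "g' \<in> borel_measurable borel" "\<And>y. 0 \<le> g' y" "AE y in lborel. norm (?g y) = g' y"
      by (rule borel_representative[OF gm]) (rule that)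
    define \<sigma> where "\<sigma> = sqrt t"
    have \<sigma>: "0 < \<sigma>" and \<sigma>2: "\<sigma>\<^sup>2 = t" using t by (auto simp: \<sigma>_def)
    have \<sigma>p: "\<sigma> powr x = t powr (x / 2)" for x
      using t by (simp add: \<sigma>_def powr_half_sqrt[symmetric] powr_powr)
    have "(\<integral>\<^sup>+y\<in>{y. norm y < \<sigma>}. ennreal (norm (?g y)) \<partial>lebesgue) \<le> ennreal (C1 * M * \<sigma> powr e / (1 - 2 powr - e))"
    proof (rule nn_integral_inside_ball)
      show "(\<integral>\<^sup>+y\<in>dyadic_ring R. ennreal (norm (?g y)) \<partial>lebesgue) \<le> ennreal (C1 * M * R powr e)" if "0 < R" for R
        using C1(2)[OF f that] M by (simp add: e_def)
    qed (use \<sigma> e M C1(1) g0 in auto)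
    also have "\<dots> \<le> ennreal ((K * M) * \<sigma> powr e)"
    proof (intro ennreal_leI)
      have "C1 * M * \<sigma> powr e / (1 - 2 powr - e) = C1 / (1 - 2 powr - e) * (M * \<sigma> powr e)" by simp
      also have "\<dots> \<le> K * (M * \<sigma> powr e)" using K M by (intro mult_right_mono) auto
      finally show "C1 * M * \<sigma> powr e / (1 - 2 powr - e) \<le> (K * M) * \<sigma> powr e" by (simp add: mult.assoc)
    qed
    also have "(\<integral>\<^sup>+y\<in>{y. norm y < \<sigma>}. ennreal (norm (?g y)) \<partial>lebesgue) = (\<integral>\<^sup>+y\<in>{y. norm y < \<sigma>}. ennreal (g' y) \<partial>lborel)"
      unfolding nn_integral_completion using g'(3) by (intro nn_integral_cong_AE) (auto elim: eventually_mono)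
    finally have inner: "(\<integral>\<^sup>+y\<in>{y. norm y < \<sigma>}. ennreal (g' y) \<partial>lborel) \<le> ennreal ((K * M) * \<sigma> powr e)" .
    have "(\<integral>\<^sup>+y\<in>{y. \<sigma> \<le> norm y}. ennreal (norm (?g y) powr a) \<partial>lebesgue) \<le> ennreal (C2 * M powr a * \<sigma> powr d / (1 - 2 powr d))"
    proof (rule nn_integral_outside_ball)
      show "(\<integral>\<^sup>+y\<in>dyadic_ring R. ennreal (norm (?g y) powr a) \<partial>lebesgue) \<le> ennreal (C2 * M powr a * R powr d)" if "\<sigma> \<le> R" for R
        using that \<sigma> by (intro C2(2) f) auto
    qed (use \<sigma> d C2(1) in auto)
    also have "\<dots> \<le> ennreal ((K * M) powr a * \<sigma> powr d)"
    proof (intro ennreal_leI)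
      have "C2 * M powr a * \<sigma> powr d / (1 - 2 powr d) = C2 / (1 - 2 powr d) * (M powr a * \<sigma> powr d)" by simp
      also have "\<dots> \<le> K powr a * (M powr a * \<sigma> powr d)" using K Ka by (intro mult_right_mono) auto
      finally show "C2 * M powr a * \<sigma> powr d / (1 - 2 powr d) \<le> (K * M) powr a * \<sigma> powr d"
        using K M by (simp add: powr_mult mult.assoc)
    qed
    also have "(\<integral>\<^sup>+y\<in>{y. \<sigma> \<le> norm y}. ennreal (norm (?g y) powr a) \<partial>lebesgue) = (\<integral>\<^sup>+y\<in>{y. \<sigma> \<le> norm y}. ennreal (g' y powr a) \<partial>lborel)"
      unfolding nn_integral_completion using g'(3) by (intro nn_integral_cong_AE) (auto elim: eventually_mono)
    finally have outer: "(\<integral>\<^sup>+y\<in>{y. \<sigma> \<le> norm y}. ennreal (g' y powr a) \<partial>lborel) \<le> ennreal ((K * M) powr a * \<sigma> powr (a * e - a * ?n + ?n))"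
      unfolding d_def .
    have KM: "0 < K * M" using K M by simp
    have v: "(\<integral>\<^sup>+y. ennreal (exp (- ((norm (x - y))\<^sup>2 / (8 * t))) * norm (?g y)) \<partial>lebesgue) =
       (\<integral>\<^sup>+y. ennreal (exp (- ((norm (x - y))\<^sup>2 / (8 * \<sigma>\<^sup>2))) * g' y) \<partial>lborel)" for x
      unfolding nn_integral_completion \<sigma>2 using g'(3) by (intro nn_integral_cong_AE) (auto elim: eventually_mono)
    note bounds = conv[OF g'(1) _ \<sigma> KM inner outer]
    show "(\<integral>\<^sup>+y. ennreal (exp (- ((norm (x - y))\<^sup>2 / (8 * t))) * norm (?g y)) \<partial>lebesgue) \<le> ennreal (D * M * t powr ((?n - ?n / p - \<gamma>) / 2))" for x
    proof -
      have "(\<integral>\<^sup>+y. ennreal (exp (- ((norm (x - y))\<^sup>2 / (8 * \<sigma>\<^sup>2))) * g' y) \<partial>lborel) \<le> ennreal (C * (K * M) * \<sigma> powr e)"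
        using bounds g'(2) by blast
      also have "\<dots> \<le> ennreal (D * M * \<sigma> powr e)"
        using D1 M by (intro ennreal_leI mult_right_mono) (auto simp: mult.assoc[symmetric])
      finally show ?thesis unfolding v \<sigma>p e_def .
    qed
    show "(\<integral>\<^sup>+x. (\<integral>\<^sup>+y. ennreal (exp (- ((norm (x - y))\<^sup>2 / (8 * t))) * norm (?g y)) \<partial>lebesgue) epowr a \<partial>lebesgue)
       \<le> ennreal ((D * M) powr a * t powr ((a * (?n - ?n / p - \<gamma>) + ?n) / 2))"
    proof -
      have "(\<integral>\<^sup>+x. (\<integral>\<^sup>+y. ennreal (exp (- ((norm (x - y))\<^sup>2 / (8 * \<sigma>\<^sup>2))) * g' y) \<partial>lborel) epowr a \<partial>lborel)
        \<le> ennreal (C * (K * M) powr a * \<sigma> powr (a * e + ?n))"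
        using bounds g'(2) by blast
      also have "\<dots> \<le> ennreal ((D * M) powr a * \<sigma> powr (a * e + ?n))"
      proof (intro ennreal_leI mult_right_mono)
        have "C * (K * M) powr a = C * K powr a * M powr a" using K M by (simp add: powr_mult)
        also have "\<dots> \<le> D powr a * M powr a" using Da by (intro mult_right_mono) auto
        finally show "C * (K * M) powr a \<le> (D * M) powr a" using D M by (simp add: powr_mult)
      qed auto
      finally show ?thesis unfolding v unfolding \<sigma>p e_def nn_integral_completion .
    qed
  qed
qed

lemma gauss_integrableI:
  fixes g :: "real^'n \<Rightarrow> complex"
  assumes g [measurable]: "g \<in> borel_measurable lebesgue"
    and fin: "\<And>t x. 0 < t \<Longrightarrow> (\<integral>\<^sup>+y. ennreal (exp (- ((norm (x - y))\<^sup>2 / (8 * t))) * norm (g y)) \<partial>lebesgue) < top"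
  shows "gauss_integrable g"
  unfolding gauss_integrable_def
proof (intro conjI g allI impI)
  fix c :: real and x :: "real^'n" assume c: "0 < c"
  have [measurable]: "(\<lambda>y. exp (- (c * (norm (x - y))\<^sup>2))) \<in> borel_measurable lebesgue"
    by (intro measurable_completion) simp
  show "integrable lebesgue (\<lambda>y. exp (- (c * (norm (x - y))\<^sup>2)) *\<^sub>R g y)"
  proof (rule integrableI_bounded)
    have "(\<integral>\<^sup>+y. ennreal (norm (exp (- (c * (norm (x - y))\<^sup>2)) *\<^sub>R g y)) \<partial>lebesgue) =
      (\<integral>\<^sup>+y. ennreal (exp (- ((norm (x - y))\<^sup>2 / (8 * (1 / (8 * c))))) * norm (g y)) \<partial>lebesgue)"
      using c by (simp add: mult.commute)
    also have "\<dots> < top" using c by (intro fin) simp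
    finally show "(\<integral>\<^sup>+y. ennreal (norm (exp (- (c * (norm (x - y))\<^sup>2)) *\<^sub>R g y)) \<partial>lebesgue) < \<infinity>" by simp
  qed simp
qed

lemma kernel_conv_bound:
  fixes K :: "real \<Rightarrow> real^'n \<Rightarrow> real"
  assumes K: "heat_kernel d K"
  shows "\<exists>C>0. \<forall>t>0. \<forall>(g :: real^'n \<Rightarrow> complex) x. gauss_integrable g \<longrightarrow> ennreal (norm (kernel_conv (K t) g x)) \<le>
    ennreal (C * t powr (d / 2)) * (\<integral>\<^sup>+y. ennreal (exp (- ((norm (x - y))\<^sup>2 / (8 * t))) * norm (g y)) \<partial>lebesgue)"
proof -
  obtain C where C: "C > 0" "\<And>t z. t > 0 \<Longrightarrow> \<bar>K t z\<bar> \<le> C * t powr (d/2) * exp (- ((1/8) * (norm z)\<^sup>2 / t))"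
    using heat_kernel_bound[OF K, of "1/8"] by auto
  have "ennreal (norm (kernel_conv (K t) g x)) \<le>
    ennreal (C * t powr (d / 2)) * (\<integral>\<^sup>+y. ennreal (exp (- ((norm (x - y))\<^sup>2 / (8 * t))) * norm (g y)) \<partial>lebesgue)"
    if t: "t > 0" and g: "gauss_integrable g" for t and g :: "real^'n \<Rightarrow> complex" and x
  proof -
    have [measurable]: "g \<in> borel_measurable lebesgue" using g by (simp add: gauss_integrable_def)
    have [measurable]: "(\<lambda>y. exp (- ((norm (x - y))\<^sup>2 / (8 * t)))) \<in> borel_measurable lebesgue"
      by (intro measurable_completion) simp
    have "ennreal (norm (kernel_conv (K t) g x)) \<le> (\<integral>\<^sup>+y. ennreal (norm (K t (x - y) *\<^sub>R g y)) \<partial>lebesgue)"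
      unfolding kernel_conv_def by (rule integral_norm_bound_ennreal[OF heat_kernel_integrable[OF K g t]])
    also have "\<dots> \<le> (\<integral>\<^sup>+y. ennreal (C * t powr (d / 2)) * ennreal (exp (- ((norm (x - y))\<^sup>2 / (8 * t))) * norm (g y)) \<partial>lebesgue)"
    proof (intro nn_integral_mono)
      fix y
      have "norm (K t (x - y) *\<^sub>R g y) \<le> (C * t powr (d/2) * exp (- ((1/8) * (norm (x - y))\<^sup>2 / t))) * norm (g y)"
        unfolding norm_scaleR by (intro mult_right_mono C t) auto
      then show "ennreal (norm (K t (x - y) *\<^sub>R g y)) \<le> ennreal (C * t powr (d / 2)) * ennreal (exp (- ((norm (x - y))\<^sup>2 / (8 * t))) * norm (g y))"
        using C(1) by (simp add: ennreal_mult[symmetric] ennreal_leI mult.assoc)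
    qed
    also have "\<dots> = ennreal (C * t powr (d / 2)) * (\<integral>\<^sup>+y. ennreal (exp (- ((norm (x - y))\<^sup>2 / (8 * t))) * norm (g y)) \<partial>lebesgue)"
      by (rule nn_integral_cmult) simp
    finally show ?thesis .
  qed
  then show ?thesis using C(1) by blast
qed

text \<open>
  Passes from the bounds \<open>M > 0\<close> used throughout to the norm itself, which may be zero.
\<close>
lemma ennreal_le_mult_of_all_bounds:
  assumes c: "0 \<le> c" and N: "N < top" and le: "\<And>M. 0 < M \<Longrightarrow> N \<le> ennreal M \<Longrightarrow> x \<le> ennreal (c * M)"
  shows "x \<le> ennreal c * N"
proof -
  obtain \<nu> where \<nu>: "N = ennreal \<nu>" "0 \<le> \<nu>" using N by (cases N) auto
  show ?thesis
  proof (rule ennreal_le_epsilon)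
    fix \<epsilon> :: real assume \<epsilon>: "0 < \<epsilon>"
    define M where "M = \<nu> + \<epsilon> / (c + 1)"
    have "0 < \<epsilon> / (c + 1)" using c \<epsilon> by (intro divide_pos_pos) auto
    then have M: "0 < M" "N \<le> ennreal M" using \<nu> by (auto simp: M_def intro!: ennreal_leI)
    have "c / (c + 1) * \<epsilon> \<le> 1 * \<epsilon>" using c \<epsilon> by (intro mult_right_mono) auto
    then have "c * M \<le> c * \<nu> + \<epsilon>" by (simp add: M_def algebra_simps)
    then have "x \<le> ennreal (c * \<nu> + \<epsilon>)" using le[OF M] by (meson ennreal_leI order_trans)
    also have "\<dots> = ennreal c * N + ennreal \<epsilon>" using c \<nu> \<epsilon> by (simp add: ennreal_mult)
    finally show "x \<le> ennreal c * N + ennreal \<epsilon>" .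
  qed
qed

lemma gauss_conv_measurable:
  fixes g :: "real^'n \<Rightarrow> complex"
  assumes g: "g \<in> borel_measurable lebesgue"
  shows "(\<lambda>x. \<integral>\<^sup>+y. ennreal (exp (- ((norm (x - y))\<^sup>2 / c)) * norm (g y)) \<partial>lebesgue) \<in> borel_measurable lebesgue"
proof -
  obtain g' where [measurable]: "g' \<in> borel_measurable borel" and g': "AE y in lborel. norm (g y) = g' y"
    by (rule borel_representative[OF g])
  have "(\<integral>\<^sup>+y. ennreal (exp (- ((norm (x - y))\<^sup>2 / c)) * norm (g y)) \<partial>lebesgue) =
     (\<integral>\<^sup>+y. ennreal (exp (- ((norm (x - y))\<^sup>2 / c)) * g' y) \<partial>lborel)" for x
    unfolding nn_integral_completion using g' by (intro nn_integral_cong_AE) (auto elim: eventually_mono)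
  then show ?thesis by (simp add: measurable_completion)
qed

text \<open>
  Both bounds are expressed through the same quantity \<open>C M t\<^sup>E\<close>, so that in the interpolation between them the
  powers of \<open>C\<close> and \<open>M\<close> add up to one.
\<close>
lemma heat_deriv_bounds:
  fixes p q \<gamma> :: real and k :: nat and \<alpha> :: "'n::{finite,linorder} \<Rightarrow> nat"
  defines "E \<equiv> - real k - real (\<Sum>i\<in>UNIV. \<alpha> i) / 2 - real CARD('n) / (2 * p) - \<gamma> / 2"
  assumes q: "1 < q" "q \<le> p" and \<gamma>: "0 < \<gamma>"
    and lo: "real CARD('n) / q - real CARD('n) / p < \<gamma>" and hi: "\<gamma> < real CARD('n) - real CARD('n) / p"
  shows "\<exists>a C. 1 \<le> a \<and> a < q \<and> 0 < C \<and> (\<forall>f M t. central_morrey_bound p q M f \<and> 0 < t \<longrightarrow>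
    heat_deriv_exists k \<alpha> (weighted \<gamma> f) \<and>
    heat_deriv k \<alpha> (weighted \<gamma> f) t \<in> borel_measurable lebesgue \<and>
    (\<forall>x. norm (heat_deriv k \<alpha> (weighted \<gamma> f) t x) \<le> C * M * t powr E) \<and>
    (\<integral>\<^sup>+x. ennreal (norm (heat_deriv k \<alpha> (weighted \<gamma> f) t x) powr a) \<partial>lebesgue)
      \<le> ennreal ((C * M * t powr E) powr a * t powr (real CARD('n) / 2)))"
proof -
  let ?n = "real CARD('n)"
  let ?e = "?n - ?n / p - \<gamma>"
  define d where "d = - ?n - real (\<Sum>i\<in>UNIV. \<alpha> i) - 2 * real k"
  have E: "d / 2 + ?e / 2 = E" unfolding E_def d_def by (simp add: field_simps)
  obtain a C1 where a: "1 \<le> a" "a < q" and C1: "0 < C1" and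
    sup: "\<And>(f :: real^'n::{finite,linorder} \<Rightarrow> complex) M t x. central_morrey_bound p q M f \<Longrightarrow> 0 < t \<Longrightarrow>
      (\<integral>\<^sup>+y. ennreal (exp (- ((norm (x - y))\<^sup>2 / (8 * t))) * norm (weighted \<gamma> f y)) \<partial>lebesgue)
       \<le> ennreal (C1 * M * t powr (?e / 2))" and
    int: "\<And>(f :: real^'n::{finite,linorder} \<Rightarrow> complex) M t. central_morrey_bound p q M f \<Longrightarrow> 0 < t \<Longrightarrow>
      (\<integral>\<^sup>+x. (\<integral>\<^sup>+y. ennreal (exp (- ((norm (x - y :: real^'n::{finite,linorder}))\<^sup>2 / (8 * t))) * norm (weighted \<gamma> f y)) \<partial>lebesgue) epowr a \<partial>lebesgue)
       \<le> ennreal ((C1 * M) powr a * t powr ((a * ?e + ?n) / 2))"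
    using weighted_gauss_bounds[OF q \<gamma> lo hi] by blast
  obtain L where L: "heat_kernel d L" and
    u: "\<And>g. gauss_integrable g \<Longrightarrow> heat_deriv_exists k \<alpha> g" "\<And>g t. gauss_integrable g \<Longrightarrow> 0 < t \<Longrightarrow> heat_deriv k \<alpha> g t = kernel_conv (L t) g"
    using heat_deriv_eq_kernel_conv[of \<alpha> k] unfolding d_def by blast
  obtain C2 where C2: "0 < C2" and conv: "\<And>t g x. 0 < t \<Longrightarrow> gauss_integrable g \<Longrightarrow> ennreal (norm (kernel_conv (L t) g x)) \<le>
    ennreal (C2 * t powr (d / 2)) * (\<integral>\<^sup>+y. ennreal (exp (- ((norm (x - y))\<^sup>2 / (8 * t))) * norm (g y)) \<partial>lebesgue)"
    using kernel_conv_bound[OF L] by blast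
  define C where "C = C2 * C1"
  have C: "0 < C" using C1 C2 by (simp add: C_def)
  show ?thesis
  proof (rule exI[of _ a], rule exI[of _ C], intro conjI allI impI a C; elim conjE)
    fix f :: "real^'n::{finite,linorder} \<Rightarrow> complex" and M t :: real
    assume f: "central_morrey_bound p q M f" and t: "0 < t"
    have M: "0 < M" and fm: "f \<in> borel_measurable lebesgue" using f by (auto simp: central_morrey_bound_def)
    let ?g = "weighted \<gamma> f"
    let ?v = "\<lambda>x. \<integral>\<^sup>+y. ennreal (exp (- ((norm (x - y))\<^sup>2 / (8 * t))) * norm (?g y)) \<partial>lebesgue"
    have g: "gauss_integrable ?g"
      by (rule gauss_integrableI[OF weighted_measurable[OF fm]]) (rule le_less_trans[OF sup[OF f]], auto)
    note u = u(1)[OF g] u(2)[OF g t]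
    show "heat_deriv_exists k \<alpha> ?g" by (rule u)
    show "heat_deriv k \<alpha> ?g t \<in> borel_measurable lebesgue"
      unfolding u(2) by (intro measurable_completion) (simp add: borel_measurable_continuous_onI kernel_conv_continuous[OF L g t])
    have le: "ennreal (norm (heat_deriv k \<alpha> ?g t x)) \<le> ennreal (C2 * t powr (d / 2)) * ?v x" for x
      unfolding u(2) by (rule conv[OF t g])
    show "norm (heat_deriv k \<alpha> ?g t x) \<le> C * M * t powr E" for x
    proof -
      have "ennreal (norm (heat_deriv k \<alpha> ?g t x)) \<le> ennreal (C2 * t powr (d / 2)) * ennreal (C1 * M * t powr (?e / 2))"
        by (rule order_trans[OF le]) (intro mult_left_mono sup[OF f t], simp)
      also have "\<dots> = ennreal (C2 * t powr (d / 2) * (C1 * M * t powr (?e / 2)))"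
        using C1 C2 M by (intro ennreal_mult[symmetric]) auto
      also have "C2 * t powr (d / 2) * (C1 * M * t powr (?e / 2)) = C * M * (t powr (d / 2) * t powr (?e / 2))"
        by (simp only: C_def mult_ac)
      also have "t powr (d / 2) * t powr (?e / 2) = t powr E" unfolding powr_add[symmetric] E ..
      finally show ?thesis using C M by (subst (asm) ennreal_le_iff) auto
    qed
    have "(\<integral>\<^sup>+x. ennreal (norm (heat_deriv k \<alpha> ?g t x) powr a) \<partial>lebesgue) \<le> (\<integral>\<^sup>+x. ennreal ((C2 * t powr (d / 2)) powr a) * (?v x epowr a) \<partial>lebesgue)"
    proof (intro nn_integral_mono)
      fix x
      obtain v where v: "?v x = ennreal v" "0 \<le> v" using sup[OF f t, of x] by (cases "?v x") (auto simp: top_unique)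
      have "norm (heat_deriv k \<alpha> ?g t x) \<le> (C2 * t powr (d / 2)) * v"
        using le[of x] C2 v(2) unfolding v(1) by (simp add: ennreal_mult[symmetric])
      then have "norm (heat_deriv k \<alpha> ?g t x) powr a \<le> ((C2 * t powr (d / 2)) * v) powr a"
        using a by (intro powr_mono2) auto
      also have "\<dots> = (C2 * t powr (d / 2)) powr a * v powr a" using C2 v by (simp add: powr_mult)
      finally show "ennreal (norm (heat_deriv k \<alpha> ?g t x) powr a) \<le> ennreal ((C2 * t powr (d / 2)) powr a) * (?v x epowr a)"
        unfolding v(1) using v(2) by (simp add: ennreal_epowr ennreal_mult[symmetric] ennreal_leI)
    qed
    also have "\<dots> = ennreal ((C2 * t powr (d / 2)) powr a) * (\<integral>\<^sup>+x. ?v x epowr a \<partial>lebesgue)"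
      using gauss_conv_measurable[OF weighted_measurable[OF fm]] by (intro nn_integral_cmult) (simp add: epowr_def)
    also have "\<dots> \<le> ennreal ((C2 * t powr (d / 2)) powr a) * ennreal ((C1 * M) powr a * t powr ((a * ?e + ?n) / 2))"
      by (intro mult_left_mono int[OF f t]) auto
    also have "\<dots> = ennreal ((C2 * t powr (d / 2)) powr a * ((C1 * M) powr a * t powr ((a * ?e + ?n) / 2)))"
      by (intro ennreal_mult[symmetric]) auto
    also have "(C2 * t powr (d / 2)) powr a * ((C1 * M) powr a * t powr ((a * ?e + ?n) / 2)) = (C * M * t powr E) powr a * t powr (?n / 2)"
    proof -
      have "t powr ((a * ?e + ?n) / 2) = (t powr (?e / 2)) powr a * t powr (?n / 2)"
        by (simp add: powr_powr powr_add[symmetric] add_divide_distrib mult.commute add.commute)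
      moreover have "t powr E = t powr (d / 2) * t powr (?e / 2)" unfolding powr_add[symmetric] E ..
      ultimately show ?thesis using C1 C2 M by (simp add: C_def powr_mult mult_ac)
    qed
    finally show "(\<integral>\<^sup>+x. ennreal (norm (heat_deriv k \<alpha> ?g t x) powr a) \<partial>lebesgue) \<le> ennreal ((C * M * t powr E) powr a * t powr (?n / 2))" .
  qed
qed

theorem theorem4p4:
  fixes k :: nat and \<alpha> :: "'n::{finite,linorder} \<Rightarrow> nat"
    and p q s \<gamma> :: real and r :: ennreal
  assumes "1 < q" and "q \<le> p" and "1 \<le> r" and "1 < s" and "0 < \<gamma>"
    and "real CARD('n) / q - real CARD('n) / p < \<gamma>"
    and "\<gamma> < real CARD('n) - real CARD('n) / p"
  shows
    "(q \<le> s \<longrightarrow>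
       (\<exists>C>0. \<forall>t>0. \<forall>f \<in> (Morrey_space p q r :: (real^'n::{finite,linorder} \<Rightarrow> complex) set).
          heat_deriv_exists k \<alpha> (weighted \<gamma> f) \<and>
          heat_deriv k \<alpha> (weighted \<gamma> f) t \<in> Lorentz_space s r \<and>
          Lorentz_norm s r (heat_deriv k \<alpha> (weighted \<gamma> f) t)
            \<le> ennreal (C * t powr (- (real CARD('n) / 2) * (1 / p - 1 / s) - real k
                                     - real (\<Sum>i\<in>UNIV. \<alpha> i) / 2 - \<gamma> / 2))
               * Morrey_norm p q r f)) \<and>
     (q < s \<longrightarrow>
       (\<exists>C>0. \<forall>t>0. \<forall>f \<in> (Morrey_space p q top :: (real^'n::{finite,linorder} \<Rightarrow> complex) set).
          heat_deriv_exists k \<alpha> (weighted \<gamma> f) \<and>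
          heat_deriv k \<alpha> (weighted \<gamma> f) t \<in> Lebesgue_space s \<and>
          Lebesgue_norm s (heat_deriv k \<alpha> (weighted \<gamma> f) t)
            \<le> ennreal (C * t powr (- (real CARD('n) / 2) * (1 / p - 1 / s) - real k
                                     - real (\<Sum>i\<in>UNIV. \<alpha> i) / 2 - \<gamma> / 2))
               * Morrey_norm p q top f))"
proof -
  let ?n = "real CARD('n)"
  define E where "E = - real k - real (\<Sum>i\<in>UNIV. \<alpha> i) / 2 - ?n / (2 * p) - \<gamma> / 2"
  let ?X = "- (?n / 2) * (1 / p - 1 / s) - real k - real (\<Sum>i\<in>UNIV. \<alpha> i) / 2 - \<gamma> / 2"
  have X: "?X = E + ?n / 2 / s" using assms(1,2,4) by (simp add: E_def field_simps)
  let ?u = "\<lambda>f t. heat_deriv k \<alpha> (weighted \<gamma> f) t :: real^'n::{finite,linorder} \<Rightarrow> complex"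
  obtain a C where a: "1 \<le> a" "a < q" and C: "0 < C" and
    ex: "\<And>f M (t::real). central_morrey_bound p q M f \<Longrightarrow> 0 < t \<Longrightarrow> heat_deriv_exists k \<alpha> (weighted \<gamma> f)" and
    meas: "\<And>f M t. central_morrey_bound p q M f \<Longrightarrow> 0 < t \<Longrightarrow> ?u f t \<in> borel_measurable lebesgue" and
    sup: "\<And>f M t x. central_morrey_bound p q M f \<Longrightarrow> 0 < t \<Longrightarrow> norm (?u f t x) \<le> C * M * t powr E" and
    int: "\<And>f M t. central_morrey_bound p q M f \<Longrightarrow> 0 < t \<Longrightarrow> (\<integral>\<^sup>+x. ennreal (norm (?u f t x) powr a) \<partial>lebesgue)
      \<le> ennreal ((C * M * t powr E) powr a * t powr (?n / 2))"
    using heat_deriv_bounds[OF assms(1,2,5-7), of k \<alpha>] unfolding E_def by blast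
  have scale: "((C * M * t powr E) powr (s - a) * ((C * M * t powr E) powr a * t powr (?n / 2))) powr (1 / s) = (C * M) * t powr ?X"
    if "q \<le> s" "0 < M" "0 < t" for M t
  proof -
    let ?Y = "C * M * t powr E"
    have Y: "0 < ?Y" and s: "0 < s" using C that assms by auto
    have "?Y powr (s - a) * (?Y powr a * t powr (?n / 2)) = ?Y powr s * t powr (?n / 2)"
      by (simp only: mult.assoc[symmetric] powr_add[symmetric]) simp
    also have "(?Y powr s * t powr (?n / 2)) powr (1 / s) = ?Y powr (s * (1 / s)) * t powr (?n / 2 * (1 / s))"
      by (simp only: powr_mult powr_powr mult.assoc)
    also have "\<dots> = C * M * (t powr E * t powr (?n / 2 / s))" using Y s by simp
    finally have "(?Y powr (s - a) * (?Y powr a * t powr (?n / 2))) powr (1 / s) = C * M * (t powr E * t powr (?n / 2 / s))" .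
    then show ?thesis unfolding X powr_add .
  qed
  \<comment> \<open>Both assertions have this form; they differ in the norm \<open>N\<close> on the left and in the index \<open>r'\<close>.\<close>
  have main: "\<exists>D>0. \<forall>t>0. \<forall>f \<in> Morrey_space p q r'. heat_deriv_exists k \<alpha> (weighted \<gamma> f) \<and> ?u f t \<in> borel_measurable lebesgue \<and>
      N (?u f t) < top \<and> N (?u f t) \<le> ennreal (D * t powr ?X) * Morrey_norm p q r' f"
    if r': "1 \<le> r'" and qs: "q \<le> s" and N: "\<exists>B>0. \<forall>(h :: real^'n::{finite,linorder} \<Rightarrow> complex) S A. h \<in> borel_measurable lebesgue \<and> 0 < S \<and> (\<forall>x. norm (h x) \<le> S) \<and>
     0 < A \<and> (\<integral>\<^sup>+x. ennreal (norm (h x) powr a) \<partial>lebesgue) \<le> ennreal A \<longrightarrow>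
     N h \<le> ennreal (B * (S powr (s - a) * A) powr (1 / s))" for r' and N :: "(real^'n::{finite,linorder} \<Rightarrow> complex) \<Rightarrow> ennreal"
  proof -
    obtain B where B: "0 < B" and NB: "\<And>(h :: real^'n::{finite,linorder} \<Rightarrow> complex) S A. h \<in> borel_measurable lebesgue \<Longrightarrow> 0 < S \<Longrightarrow> (\<forall>x. norm (h x) \<le> S) \<Longrightarrow>
     0 < A \<Longrightarrow> (\<integral>\<^sup>+x. ennreal (norm (h x) powr a) \<partial>lebesgue) \<le> ennreal A \<Longrightarrow>
     N h \<le> ennreal (B * (S powr (s - a) * A) powr (1 / s))" using N by blast
    obtain C' where C': "0 < C'" and central: "\<And>(f :: real^'n::{finite,linorder} \<Rightarrow> complex) M. f \<in> borel_measurable lebesgue \<Longrightarrow> 0 < M \<Longrightarrow>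
      Morrey_norm p q r' f \<le> ennreal M \<Longrightarrow> central_morrey_bound p q (C' * M) f"
      using Morrey_norm_central[of q p r'] assms(1,2) r' by auto
    show ?thesis
    proof (rule exI[of _ "B * (C * C')"], intro conjI allI ballI impI)
      show "0 < B * (C * C')" using B C C' by simp
      fix t :: real and f :: "real^'n::{finite,linorder} \<Rightarrow> complex"
      assume t: "0 < t" and f: "f \<in> Morrey_space p q r'"
      have fm: "f \<in> borel_measurable lebesgue" and fin: "Morrey_norm p q r' f < top"
        using f by (auto simp: Morrey_space_def)
      \<comment> \<open>Some positive bound for the norm, to establish existence and measurability.\<close>
      have "Morrey_norm p q r' f \<le> ennreal (enn2real (Morrey_norm p q r' f) + 1)"
        using fin by (cases "Morrey_norm p q r' f") (auto intro!: ennreal_leI)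
      then have c1: "central_morrey_bound p q (C' * (enn2real (Morrey_norm p q r' f) + 1)) f"
        by (intro central[OF fm]) (auto intro: add_nonneg_pos)
      show "heat_deriv_exists k \<alpha> (weighted \<gamma> f)" by (rule ex[OF c1 t])
      show m: "?u f t \<in> borel_measurable lebesgue" by (rule meas[OF c1 t])
      have "N (?u f t) \<le> ennreal (B * (C * C') * t powr ?X * M)" if M: "0 < M" and le: "Morrey_norm p q r' f \<le> ennreal M" for M
      proof -
        have c: "central_morrey_bound p q (C' * M) f" by (rule central[OF fm M le])
        have "N (?u f t) \<le> ennreal (B * ((C * (C' * M) * t powr E) powr (s - a) * ((C * (C' * M) * t powr E) powr a * t powr (?n / 2))) powr (1 / s))"
          using sup[OF c t] C C' M t by (intro NB m int[OF c t]) auto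
        also have "B * ((C * (C' * M) * t powr E) powr (s - a) * ((C * (C' * M) * t powr E) powr a * t powr (?n / 2))) powr (1 / s) = B * (C * C') * t powr ?X * M"
          using C' M by (subst scale[OF qs _ t]) (simp_all only: mult_pos_pos mult_ac)
        finally show ?thesis .
      qed
      then show le: "N (?u f t) \<le> ennreal (B * (C * C') * t powr ?X) * Morrey_norm p q r' f"
        using B C C' by (intro ennreal_le_mult_of_all_bounds fin) auto
      show "N (?u f t) < top"
        by (rule le_less_trans[OF le]) (use fin in \<open>simp add: ennreal_mult_less_top\<close>)
    qed
  qed
  have "0 < a" using a by simp
  show ?thesis
  proof (intro conjI impI)
    assume qs: "q \<le> s"
    then have "a < s" using a by simp
    from main[OF assms(3) qs Lorentz_norm_bounded[OF \<open>0 < a\<close> this assms(3)]]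
    show "\<exists>C>0. \<forall>t>0. \<forall>f \<in> Morrey_space p q r. heat_deriv_exists k \<alpha> (weighted \<gamma> f) \<and> ?u f t \<in> Lorentz_space s r \<and>
      Lorentz_norm s r (?u f t) \<le> ennreal (C * t powr ?X) * Morrey_norm p q r f"
      unfolding Lorentz_space_def by blast
  next
    assume "q < s"
    then have qs: "q \<le> s" and as: "a \<le> s" using a by auto
    have "\<exists>B>0. \<forall>(h :: real^'n::{finite,linorder} \<Rightarrow> complex) S A. h \<in> borel_measurable lebesgue \<and> 0 < S \<and> (\<forall>x. norm (h x) \<le> S) \<and>
     0 < A \<and> (\<integral>\<^sup>+x. ennreal (norm (h x) powr a) \<partial>lebesgue) \<le> ennreal A \<longrightarrow>
     Lebesgue_norm s h \<le> ennreal (B * (S powr (s - a) * A) powr (1 / s))"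
      using Lebesgue_norm_bounded[OF _ _ _ _ _ \<open>0 < a\<close> as] by (intro exI[of _ 1]) auto
    from main[OF _ qs this, of top]
    show "\<exists>C>0. \<forall>t>0. \<forall>f \<in> Morrey_space p q top. heat_deriv_exists k \<alpha> (weighted \<gamma> f) \<and> ?u f t \<in> Lebesgue_space s \<and>
      Lebesgue_norm s (?u f t) \<le> ennreal (C * t powr ?X) * Morrey_norm p q top f"
      unfolding Lebesgue_space_def by simp
  qed
qed

end
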